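(* (Wick rule for a product of free noises.) In the setting and notation of the context, for each $n\in\mathbb N$, $$\omega(t_1)\cdots\omega(t_n)=\sum_{\varkappa\in G_n}{:}W(\varkappa)\omega(t_1)\cdots\omega(t_n){:}\,,$$ in the sense that, after smearing with any $f^{(n)}\in\mathcal D^{(n)}$, both sides define the same operator on $\mathcal F(\mathcal H)$: $$\langle f^{(n)},\omega^{\otimes n}\rangle=\sum_{\varkappa\in G_n}\int_{T^n}\sigma(dt_1)\cdots\sigma(dt_n)f^{(n)}(t_1,\dots,t_n)\,{:}W(\varkappa)\omega(t_1)\cdots\omega(t_n){:}\,.$$
   Context: $T$ is a locally compact, second countable Hausdorff space without isolated points, $\sigma$ a Radon non-atomic measure on $T$ with $\sigma(O)>0$ for every non-empty open $O$. $\mathcal D^{(n)}=C_0(T^n)$ (real continuous functions with compact support), $\mathcal D^{(0)}=\mathbb R$. $\mathcal H=L^2(T,\sigma)$ (real), $\mathcal F(\mathcal H)=\mathbb R\oplus\bigoplus_{n\ge1}\mathcal H^{\otimes n}$ is the full Fock space, $\Omega=(1,0,0,\dots)$. A function $\lambda\in C(T)$ (real continuous) is fixed. Formally $\omega(t)=\partial_t^\dagger+\partial_t+\lambda(t)\partial_t^\dagger\partial_t$, where $\partial_t^\dagger,\partial_t$ are the creation and annihilation operators at the point $t$ with $\partial_s\partial_t^\dagger=\delta(s,t)$. Rigorously, smeared products are defined as follows. For a function $h(t_1,\dots,t_k;y_1,\dots,y_m)$ ($k\ge1$, all variables in $T$) put $(Ch)(t_1,\dots,t_{k-1};y_1,\dots,y_{m+1})=h(t_1,\dots,t_{k-1},y_1;y_2,\dots,y_{m+1})$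 (corresponding to $\partial_{t_k}^\dagger$), $(Ah)(t_1,\dots,t_{k-1};y_1,\dots,y_{m-1})=\int_T\sigma(dt)\,h(t_1,\dots,t_{k-1},t;t,y_1,\dots,y_{m-1})$ (corresponding to $\partial_{t_k}$), $(Nh)(t_1,\dots,t_{k-1};y_1,\dots,y_m)=\lambda(y_1)h(t_1,\dots,t_{k-1},y_1;y_1,\dots,y_m)$ (corresponding to $\lambda(t_k)\partial_{t_k}^\dagger\partial_{t_k}$), with $Ah=Nh=0$ if $m=0$. For a word $w=(w_1,\dots,w_n)\in\{C,A,N\}^n$ and $f^{(n)}\in\mathcal D^{(n)}$, let $w(f^{(n)})$ be the bounded operator on $\mathcal F(\mathcal H)$ with $w(f^{(n)})g^{(m)}=w_1w_2\cdots w_n(f^{(n)}\otimes g^{(m)})$ ($w_n$ applied first), where $(f^{(n)}\otimes g^{(m)})(t;y)=f^{(n)}(t)g^{(m)}(y)$. Then $\langle f^{(n)},\omega^{\otimes n}\rangle:=\sum_{w\in\{C,A,N\}^n}w(f^{(n)})$ is the smearing of $\omega(t_1)\cdots\omega(t_n)$. Free Wick product: ${:}\omega(t_1)\cdots\omega(t_n){:}$ is obtained by formally expanding $\omega(t_1)\cdots\omega(t_n)$ and removing all terms containing $\partial_{t_i}\partial_{t_{i+1}}^\dagger$ for some $i$. Its smearing, denoted $\langle f^{(n)},{:}\omega^{\otimes n}{:}\rangle$, is the sum of $w(f^{(n)})$ over the $2n+1$ words $C^n$, $C^{i-1}A^{n-i+1}$ and $C^{i-1}NA^{n-i}$, $i=1,\dots,n$.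 For $n=0$, $\langle c,{:}\omega^{\otimes0}{:}\rangle=c\mathbf 1$. Marked partitions: $NC(n,\pm1)$ is the set of all $\varkappa=\{(A_1,m_1),\dots,(A_k,m_k)\}$ where $\{A_1,\dots,A_k\}$ is a non-crossing partition of $\{1,\dots,n\}$, $m_j\in\{-1,+1\}$, and $m_j=+1$ whenever $A_j$ is a singleton. $G_n\subset NC(n,\pm1)$ consists of those $\varkappa$ for which there are no $i\ne j$ with $\min A_i<\min A_j\le\max A_j<\max A_i$ and $m_j=+1$ (a block with mark $+1$ is never nested within another block). For $\varkappa\in G_n$, $W(\varkappa)\omega(t_1)\cdots\omega(t_n)$ is obtained from $\omega(t_1)\cdots\omega(t_n)$ thus: for each block $A_i=\{j_1<\dots<j_l\}$, if $m_i=-1$ replace $\omega(t_{j_1}),\dots,\omega(t_{j_l})$ by $\lambda^{l-2}(t_{j_1})\delta(t_{j_1},\dots,t_{j_l})$; if $m_i=+1$ keep $\omega(t_{j_1})$ and, if $l\ge2$, replace $\omega(t_{j_2}),\dots,\omega(t_{j_l})$ by $\lambda^{l-1}(t_{j_1})\delta(t_{j_1},\dots,t_{j_l})$; here $\int_{T^k}\sigma(dt_1)\cdots\sigma(dt_k)f^{(k)}(t_1,\dots,t_k)\delta(t_1,\dots,t_k)=\int_T\sigma(dt)f^{(k)}(t,\dots,t)$. Explicitly: let $B_1,\dots,B_p$ be the $+1$ blocks ordered by their minima and $D_1,\dots,D_q$ the $-1$ blocks; put $$f_\varkappa(u_1,\dots,u_p)=\int_{T^q}\sigma(dv_1)\cdots\sigma(dv_q)\,f^{(n)}(t_1,\dots,t_n)\prod_{j=1}^p\lambda(u_j)^{|B_j|-1}\prod_{j=1}^q\lambda(v_j)^{|D_j|-2},$$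 where $t_i=u_j$ if $i\in B_j$, $t_i=v_j$ if $i\in D_j$ (and $\lambda^0=1$). Then $\int_{T^n}\sigma(dt_1)\cdots\sigma(dt_n)f^{(n)}\,{:}W(\varkappa)\omega(t_1)\cdots\omega(t_n){:}=\langle f_\varkappa,{:}\omega^{\otimes p}{:}\rangle$. *)

theory Defs
  imports "HOL-Analysis.Analysis" "HOL-Library.Disjoint_Sets"
begin

text \<open>The space and the measure\<close>

definition radon_measure :: "'a::topological_space measure \<Rightarrow> bool" where
  "radon_measure \<sigma> \<longleftrightarrow>
     sets \<sigma> = sets borel \<and>
     (\<forall>K. compact K \<longrightarrow> emeasure \<sigma> K < \<infinity>) \<and>
     (\<forall>B\<in>sets borel. emeasure \<sigma> B = (SUP K\<in>{K. compact K \<and> K \<subseteq> B}. emeasure \<sigma> K))"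

definition non_atomic :: "'a measure \<Rightarrow> bool" where
  "non_atomic \<sigma> \<longleftrightarrow>
     (\<forall>A\<in>sets \<sigma>. 0 < emeasure \<sigma> A \<longrightarrow>
        (\<exists>B\<in>sets \<sigma>. B \<subseteq> A \<and> 0 < emeasure \<sigma> B \<and> emeasure \<sigma> B < emeasure \<sigma> A))"

text \<open>
  A point \<open>(t\<^sub>1, \<dots>, t\<^sub>n)\<close> of \<open>T\<^sup>n\<close> is represented by a list of length \<open>n\<close>, and a real function
  on \<open>T\<^sup>n\<close> by a function on lists, of which only the values on lists of length \<open>n\<close> matter.
  For topology and measure, \<open>T\<^sup>n\<close> is the product with index set \<open>{..<n}\<close>, whose points are
  read as lists by \<open>tuple n\<close>. Coordinates are counted from 0, so that the partitions below are
  partitions of \<open>{..<n}\<close>.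
\<close>

definition tuple :: "nat \<Rightarrow> (nat \<Rightarrow> 'a) \<Rightarrow> 'a list" where
  "tuple n t = map t [0..<n]"

definition power_top :: "nat \<Rightarrow> (nat \<Rightarrow> 'a::topological_space) topology" where
  "power_top n = product_topology (\<lambda>_. euclidean) {..<n}"

definition power_measure :: "'a measure \<Rightarrow> nat \<Rightarrow> (nat \<Rightarrow> 'a) measure" where
  "power_measure \<sigma> n = PiM {..<n} (\<lambda>_. \<sigma>)"

definition test_functions :: "nat \<Rightarrow> ('a::topological_space list \<Rightarrow> real) set" where
  "test_functions n =
     {f. continuous_map (power_top n) euclideanreal (\<lambda>t. f (tuple n t)) \<and>
         compactin (power_top n)
           (power_top n closure_of {t \<in> topspace (power_top n). f (tuple n t) \<noteq> 0})}"


text \<open>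
  The full Fock space over \<open>L\<^sup>2(T, \<sigma>)\<close>, where the \<open>m\<close>-th tensor power is \<open>L\<^sup>2(T\<^sup>m, \<sigma>\<^sup>m)\<close>. A vector
  \<open>(g\<^sup>(\<^sup>0\<^sup>), g\<^sup>(\<^sup>1\<^sup>), \<dots>)\<close> is represented by one function on lists of all lengths, \<open>g\<^sup>(\<^sup>m\<^sup>)\<close> being its
  restriction to the lists of length \<open>m\<close>. Two representatives are the same vector iff they are
  related by \<open>fock_eq\<close>.
\<close>

definition fock :: "'a measure \<Rightarrow> ('a list \<Rightarrow> real) set" where
  "fock \<sigma> =
     {g. (\<forall>m. (\<lambda>y. g (tuple m y)) \<in> borel_measurable (power_measure \<sigma> m) \<and>
              integrable (power_measure \<sigma> m) (\<lambda>y. (g (tuple m y))\<^sup>2)) \<and>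
         summable (\<lambda>m. LINT y|power_measure \<sigma> m. (g (tuple m y))\<^sup>2)}"

definition fock_norm :: "'a measure \<Rightarrow> ('a list \<Rightarrow> real) \<Rightarrow> real" where
  "fock_norm \<sigma> g = sqrt (\<Sum>m. LINT y|power_measure \<sigma> m. (g (tuple m y))\<^sup>2)"

definition fock_eq :: "'a measure \<Rightarrow> ('a list \<Rightarrow> real) \<Rightarrow> ('a list \<Rightarrow> real) \<Rightarrow> bool" where
  "fock_eq \<sigma> g h \<longleftrightarrow> (\<forall>m. AE y in power_measure \<sigma> m. g (tuple m y) = h (tuple m y))"

definition bounded_fock_operator ::
    "'a measure \<Rightarrow> (('a list \<Rightarrow> real) \<Rightarrow> ('a list \<Rightarrow> real)) \<Rightarrow> bool" where
  "bounded_fock_operator \<sigma> W \<longleftrightarrow>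
     (\<forall>g\<in>fock \<sigma>. W g \<in> fock \<sigma>) \<and>
     (\<forall>g\<in>fock \<sigma>. \<forall>h\<in>fock \<sigma>. fock_eq \<sigma> g h \<longrightarrow> fock_eq \<sigma> (W g) (W h)) \<and>
     (\<forall>g\<in>fock \<sigma>. \<forall>h\<in>fock \<sigma>. \<forall>a b.
        fock_eq \<sigma> (W (\<lambda>y. a * g y + b * h y)) (\<lambda>y. a * W g y + b * W h y)) \<and>
     (\<exists>c. \<forall>g\<in>fock \<sigma>. fock_norm \<sigma> (W g) \<le> c * fock_norm \<sigma> g)"

definition same_fock_operator ::
    "'a measure \<Rightarrow> (('a list \<Rightarrow> real) \<Rightarrow> ('a list \<Rightarrow> real)) \<Rightarrow>
       (('a list \<Rightarrow> real) \<Rightarrow> ('a list \<Rightarrow> real)) \<Rightarrow> bool" where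
  "same_fock_operator \<sigma> V W \<longleftrightarrow>
     bounded_fock_operator \<sigma> V \<and> bounded_fock_operator \<sigma> W \<and>
     (\<forall>g\<in>fock \<sigma>. fock_eq \<sigma> (V g) (W g))"


text \<open>
  The letters stand for \<open>\<partial>\<^sup>\<dagger>\<close> (\<open>Cre\<close>), \<open>\<partial>\<close> (\<open>Ann\<close>) and \<open>\<lambda> \<partial>\<^sup>\<dagger> \<partial>\<close> (\<open>Num\<close>). They act on functions
  \<open>h(t\<^sub>1, \<dots>, t\<^sub>k; y\<^sub>1, \<dots>, y\<^sub>m)\<close>, with all \<open>m\<close> treated at once. The component with \<open>m = 0\<close> is
  annihilated by \<open>Ann\<close>, since the output of \<open>Ann\<close> at a list of length \<open>m\<close> uses only the component
  with \<open>m + 1\<close>, and by \<open>Num\<close>, since the output of \<open>Num\<close> at the empty list is 0. The output of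
  \<open>Cre\<close> has no component with \<open>m = 0\<close>.
\<close>

datatype letter = Cre | Ann | Num

fun letter_op :: "'a measure \<Rightarrow> ('a \<Rightarrow> real) \<Rightarrow> letter \<Rightarrow>
    ('a list \<Rightarrow> 'a list \<Rightarrow> real) \<Rightarrow> ('a list \<Rightarrow> 'a list \<Rightarrow> real)" where
  "letter_op \<sigma> lam Cre h ts [] = 0"
| "letter_op \<sigma> lam Cre h ts (y # ys) = h (ts @ [y]) ys"
| "letter_op \<sigma> lam Ann h ts ys = (LINT t|\<sigma>. h (ts @ [t]) (t # ys))"
| "letter_op \<sigma> lam Num h ts [] = 0"
| "letter_op \<sigma> lam Num h ts (y # ys) = lam y * h (ts @ [y]) (y # ys)"

text \<open>In \<open>foldr\<close> the last letter of the word acts first.\<close>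

definition word_op :: "'a measure \<Rightarrow> ('a \<Rightarrow> real) \<Rightarrow> letter list \<Rightarrow> ('a list \<Rightarrow> real) \<Rightarrow>
    ('a list \<Rightarrow> real) \<Rightarrow> ('a list \<Rightarrow> real)" where
  "word_op \<sigma> lam w f g = (\<lambda>ys. foldr (letter_op \<sigma> lam) w (\<lambda>ts ys. f ts * g ys) [] ys)"

definition noise_product :: "'a measure \<Rightarrow> ('a \<Rightarrow> real) \<Rightarrow> nat \<Rightarrow> ('a list \<Rightarrow> real) \<Rightarrow>
    ('a list \<Rightarrow> real) \<Rightarrow> ('a list \<Rightarrow> real)" where
  "noise_product \<sigma> lam n f g = (\<lambda>ys. \<Sum>w | length w = n. word_op \<sigma> lam w f g ys)"

text \<open>
  These are the words in which no letter containing \<open>\<partial>\<close> (\<open>Ann\<close> or \<open>Num\<close>) stands immediately to the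
  left of a letter beginning with \<open>\<partial>\<^sup>\<dagger>\<close> (\<open>Cre\<close> or \<open>Num\<close>).
\<close>

definition wick_words :: "nat \<Rightarrow> letter list set" where
  "wick_words n =
     {replicate n Cre} \<union>
     {replicate (i - 1) Cre @ replicate (n - i + 1) Ann | i. i \<in> {1..n}} \<union>
     {replicate (i - 1) Cre @ [Num] @ replicate (n - i) Ann | i. i \<in> {1..n}}"

definition wick_product :: "'a measure \<Rightarrow> ('a \<Rightarrow> real) \<Rightarrow> nat \<Rightarrow> ('a list \<Rightarrow> real) \<Rightarrow>
    ('a list \<Rightarrow> real) \<Rightarrow> ('a list \<Rightarrow> real)" where
  "wick_product \<sigma> lam n f g = (\<lambda>ys. \<Sum>w\<in>wick_words n. word_op \<sigma> lam w f g ys)"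


text \<open>Marked non-crossing partitions\<close>

definition noncrossing :: "nat set set \<Rightarrow> bool" where
  "noncrossing P \<longleftrightarrow>
     (\<forall>A\<in>P. \<forall>B\<in>P. A \<noteq> B \<longrightarrow>
        \<not> (\<exists>a b c d. a < b \<and> b < c \<and> c < d \<and> a \<in> A \<and> c \<in> A \<and> b \<in> B \<and> d \<in> B))"

text \<open>Injectivity of \<open>fst\<close> says that every block carries exactly one mark.\<close>

definition NC_marked :: "nat \<Rightarrow> (nat set \<times> int) set set" where
  "NC_marked n =
     {\<kappa>. inj_on fst \<kappa> \<and> partition_on {..<n} (fst ` \<kappa>) \<and> noncrossing (fst ` \<kappa>) \<and>
         (\<forall>(A, m)\<in>\<kappa>. m \<in> {-1, 1} \<and> (card A = 1 \<longrightarrow> m = 1))}"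

definition G :: "nat \<Rightarrow> (nat set \<times> int) set set" where
  "G n =
     {\<kappa> \<in> NC_marked n.
        \<not> (\<exists>(A, a)\<in>\<kappa>. \<exists>(B, b)\<in>\<kappa>. Min A < Min B \<and> Max B < Max A \<and> b = 1)}"

definition pos_blocks :: "(nat set \<times> int) set \<Rightarrow> nat set set" where
  "pos_blocks \<kappa> = {A. (A, 1) \<in> \<kappa>}"

definition neg_blocks :: "(nat set \<times> int) set \<Rightarrow> nat set set" where
  "neg_blocks \<kappa> = {A. (A, -1) \<in> \<kappa>}"

text \<open>The position, counted from 0, of a \<open>+1\<close> block when these are ordered by their minima.\<close>

definition pos_index :: "(nat set \<times> int) set \<Rightarrow> nat set \<Rightarrow> nat" where
  "pos_index \<kappa> A = card {B \<in> pos_blocks \<kappa>. Min B < Min A}"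

definition block_of :: "(nat set \<times> int) set \<Rightarrow> nat \<Rightarrow> nat set" where
  "block_of \<kappa> i = (THE A. A \<in> fst ` \<kappa> \<and> i \<in> A)"

text \<open>
  The function \<open>f\<^sub>\<kappa>\<close> of the variables \<open>us = (u\<^sub>1, \<dots>, u\<^sub>p)\<close>. The integration variables are indexed by
  the \<open>-1\<close> blocks themselves.
\<close>

definition contracted :: "'a measure \<Rightarrow> ('a \<Rightarrow> real) \<Rightarrow> nat \<Rightarrow> (nat set \<times> int) set \<Rightarrow>
    ('a list \<Rightarrow> real) \<Rightarrow> ('a list \<Rightarrow> real)" where
  "contracted \<sigma> lam n \<kappa> f us =
     (LINT v|PiM (neg_blocks \<kappa>) (\<lambda>_. \<sigma>).
        f (map (\<lambda>i. if block_of \<kappa> i \<in> pos_blocks \<kappa>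
                     then us ! pos_index \<kappa> (block_of \<kappa> i)
                     else v (block_of \<kappa> i)) [0..<n])
        * (\<Prod>B\<in>pos_blocks \<kappa>. lam (us ! pos_index \<kappa> B) ^ (card B - 1))
        * (\<Prod>D\<in>neg_blocks \<kappa>. lam (v D) ^ (card D - 2)))"

text \<open>The smearing of \<open>:W(\<kappa>) \<omega>(t\<^sub>1) \<cdots> \<omega>(t\<^sub>n):\<close> with \<open>f\<close>.\<close>

definition wick_term :: "'a measure \<Rightarrow> ('a \<Rightarrow> real) \<Rightarrow> nat \<Rightarrow> (nat set \<times> int) set \<Rightarrow>
    ('a list \<Rightarrow> real) \<Rightarrow> ('a list \<Rightarrow> real) \<Rightarrow> ('a list \<Rightarrow> real)" where
  "wick_term \<sigma> lam n \<kappa> f =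
     wick_product \<sigma> lam (card (pos_blocks \<kappa>)) (contracted \<sigma> lam n \<kappa> f)"

end

theory Submission
  imports Defs
begin

text \<open>
  Expanding \<open>\<omega>(t\<^sub>1) \<cdots> \<omega>(t\<^sub>n)\<close> gives one term for every word of length
  \<open>n\<close> in the letters \<open>Cre\<close>, \<open>Ann\<close> and \<open>Num\<close>. A word is Wick ordered unless
  \<open>Ann\<close> or \<open>Num\<close> stands immediately to the left of \<open>Cre\<close> or \<open>Num\<close>, and in that
  case the two neighbouring letters contract: \<open>\<partial>\<^sub>s \<partial>\<^sub>t\<^sup>\<dagger> = \<delta>(s,
  t)\<close>, and since \<open>\<lambda> \<partial>\<^sup>\<dagger> \<partial>\<close> begins with
  \<open>\<partial>\<^sup>\<dagger>\<close> and ends with \<open>\<partial>\<close>, \<open>\<partial>\<^sub>s (\<lambda>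
  \<partial>\<^sup>\<dagger> \<partial>)\<^sub>t = \<lambda> \<delta>(s, t) \<partial>\<^sub>t\<close>, \<open>(\<lambda>
  \<partial>\<^sup>\<dagger> \<partial>)\<^sub>s \<partial>\<^sub>t\<^sup>\<dagger> = \<lambda> \<delta>(s, t)
  \<partial>\<^sub>t\<^sup>\<dagger>\<close> and \<open>(\<lambda> \<partial>\<^sup>\<dagger> \<partial>)\<^sub>s (\<lambda>
  \<partial>\<^sup>\<dagger> \<partial>)\<^sub>t = \<lambda> \<delta>(s, t) (\<lambda> \<partial>\<^sup>\<dagger>
  \<partial>)\<^sub>t\<close>.

  The product is reduced from the right. Suppose that the last \<open>n\<close> factors have been brought into the form
  \<open>:W(\<kappa>) \<omega>(t\<^sub>1) \<cdots> \<omega>(t\<^sub>n):\<close> with \<open>\<kappa> \<in> G n\<close>, whose free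
  variables are those of the \<open>+1\<close> blocks in order of their minima. A further letter on the left is either prepended
  to a Wick ordered word in these variables, and its argument becomes a new singleton block, or it contracts with the first letter
  of that word, and its argument joins the first \<open>+1\<close> block. The mark of the enlarged block is \<open>-1\<close> when
  the contraction consumes both letters and \<open>+1\<close> when one letter survives. Every element of \<open>G (Suc n)\<close>
  arises in exactly one of these ways (\<open>sum_G_Suc\<close>): deleting the leftmost point and marking the rest of its block
  with \<open>+1\<close> recovers \<open>\<kappa>\<close>, because in \<open>G (Suc n)\<close> nothing can cross that block and no
  \<open>+1\<close> block can be nested in it, so that its rest comes first among the \<open>+1\<close> blocks. So reduction is a
  bijection from the words of length \<open>n\<close> to the pairs of some \<open>\<kappa> \<in> G n\<close> and a Wick ordered
  word on its \<open>+1\<close> blocks (\<open>sum_reduce\<close>), and the function that is smeared is transformed exactly as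
  \<open>contracted\<close> prescribes (\<open>contracted_new\<close>, \<open>contracted_join_pos\<close>,
  \<open>contracted_join_neg\<close>).

  What remains is analysis. A contraction \<open>\<partial>\<^sub>s \<partial>\<^sub>t\<^sup>\<dagger>\<close> exchanges the
  integral over the contracted variable with the integrals against \<open>g\<close> (\<open>word_op_integral\<close>), which is
  legitimate at every list where the corresponding integrals of \<open>\<bar>g\<bar>\<close> are finite. A fixed positive operator
  attached to each word dominates the smeared word (\<open>word_op_le_majorants\<close>) and is bounded in
  \<open>L\<^sup>2\<close> (\<open>sq_norm_majorants\<close>). This gives at once the boundedness of all operators
  (\<open>fock_op_word_op\<close>) and a null set, the same for all words and all kernels, off which both sides agree
  (\<open>AE_good\<close>, \<open>wick_rule_pointwise\<close>).
\<close>

section \<open>Lists as points of a measurable space\<close>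

text \<open>
  The letters shift variables between two lists, so measurability is wanted on lists and not on
  functions with index set \<open>{..<n}\<close>. Pulling back the product \<open>\<sigma>\<close>-algebra makes the two notions agree
  (\<open>borel_measurable_lists_iff\<close>).
\<close>
definition list_space :: "'a measure \<Rightarrow> nat \<Rightarrow> 'a list measure" where
  "list_space \<sigma> n =
     vimage_algebra {xs. length xs = n} (\<lambda>xs. \<lambda>i\<in>{..<n}. xs ! i) (PiM {..<n} (\<lambda>_. \<sigma>))"

text \<open>
  \<open>K\<close> stands for a compact set such that the function to be smeared is supported in \<open>K\<^sup>n\<close>, and \<open>L\<close> for a
  bound of \<open>\<lambda>\<close> on it.
\<close>
locale noise_space = sigma_finite_measure \<sigma>
  for \<sigma> :: "'a measure" +
  fixes lam :: "'a \<Rightarrow> real" and K :: "'a set" and L :: real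
  assumes space_UNIV [simp]: "space \<sigma> = UNIV"
    and K_sets [measurable]: "K \<in> sets \<sigma>"
    and K_finite: "emeasure \<sigma> K < \<infinity>"
    and lam_measurable [measurable]: "lam \<in> borel_measurable \<sigma>"
    and lam_bounded: "x \<in> K \<Longrightarrow> \<bar>lam x\<bar> \<le> L"
    and L_nonneg: "0 \<le> L"
begin

sublocale product_sigma_finite "\<lambda>_. \<sigma>"
  by standard

sublocale pairs: pair_sigma_finite \<sigma> \<sigma>
  by standard

abbreviation lists_of :: "nat \<Rightarrow> 'a list measure" where
  "lists_of n \<equiv> list_space \<sigma> n"

lemma space_lists_of [simp]: "space (lists_of n) = {xs. length xs = n}"
  by (simp add: list_space_def)

lemma nth_measurable: "i < n \<Longrightarrow> (\<lambda>xs. xs ! i) \<in> lists_of n \<rightarrow>\<^sub>M \<sigma>"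
proof -
  assume i: "i < n"
  have "(\<lambda>xs. \<lambda>i\<in>{..<n}. xs ! i) \<in> lists_of n \<rightarrow>\<^sub>M PiM {..<n} (\<lambda>_. \<sigma>)"
    unfolding list_space_def by (rule measurable_vimage_algebra1) (auto simp: space_PiM)
  then have "(\<lambda>xs. (\<lambda>i\<in>{..<n}. xs ! i) i) \<in> lists_of n \<rightarrow>\<^sub>M \<sigma>"
    by (rule measurable_compose) (use i in \<open>auto intro: measurable_component_singleton\<close>)
  then show ?thesis
    using i by simp
qed

text \<open>
  A list of fixed length depends measurably on a parameter as soon as its entries do. All
  measurability of list operations below comes from this.
\<close>
lemma measurable_into_lists:
  assumes "\<And>x. x \<in> space N \<Longrightarrow> length (F x) = n"
    and "\<And>i. i < n \<Longrightarrow> (\<lambda>x. F x ! i) \<in> N \<rightarrow>\<^sub>M \<sigma>"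
  shows "F \<in> N \<rightarrow>\<^sub>M lists_of n"
  unfolding list_space_def
proof (rule measurable_vimage_algebra2)
  show "F \<in> space N \<rightarrow> {xs. length xs = n}"
    using assms(1) by auto
  show "(\<lambda>x. \<lambda>i\<in>{..<n}. F x ! i) \<in> N \<rightarrow>\<^sub>M PiM {..<n} (\<lambda>_. \<sigma>)"
    by (rule measurable_restrict) (use assms(2) in auto)
qed

lemma measurable_nth_of:
  "F \<in> N \<rightarrow>\<^sub>M lists_of n \<Longrightarrow> i < n \<Longrightarrow> (\<lambda>x. F x ! i) \<in> N \<rightarrow>\<^sub>M \<sigma>"
  by (rule measurable_compose[OF _ nth_measurable])

lemma length_measurable: "F \<in> N \<rightarrow>\<^sub>M lists_of n \<Longrightarrow> x \<in> space N \<Longrightarrow> length (F x) = n"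
  by (drule (1) measurable_space) simp

lemma append_measurable [measurable (raw)]:
  assumes "F \<in> N \<rightarrow>\<^sub>M lists_of k" "H \<in> N \<rightarrow>\<^sub>M lists_of m"
  shows "(\<lambda>x. F x @ H x) \<in> N \<rightarrow>\<^sub>M lists_of (k + m)"
proof (rule measurable_into_lists)
  fix i assume i: "i < k + m"
  show "(\<lambda>x. (F x @ H x) ! i) \<in> N \<rightarrow>\<^sub>M \<sigma>"
  proof (cases "i < k")
    case True
    have "(\<lambda>x. (F x @ H x) ! i) \<in> N \<rightarrow>\<^sub>M \<sigma> \<longleftrightarrow> (\<lambda>x. F x ! i) \<in> N \<rightarrow>\<^sub>M \<sigma>"
      by (rule measurable_cong) (use True length_measurable[OF assms(1)] in \<open>simp add: nth_append\<close>)
    then show ?thesis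
      using measurable_nth_of[OF assms(1) True] by simp
  next
    case False
    have "(\<lambda>x. (F x @ H x) ! i) \<in> N \<rightarrow>\<^sub>M \<sigma> \<longleftrightarrow> (\<lambda>x. H x ! (i - k)) \<in> N \<rightarrow>\<^sub>M \<sigma>"
      by (rule measurable_cong) (use False length_measurable[OF assms(1)] in \<open>simp add: nth_append\<close>)
    then show ?thesis
      using measurable_nth_of[OF assms(2), of "i - k"] False i by simp
  qed
qed (use length_measurable[OF assms(1)] length_measurable[OF assms(2)] in auto)

lemma Cons_measurable [measurable (raw)]:
  assumes "F \<in> N \<rightarrow>\<^sub>M \<sigma>" "H \<in> N \<rightarrow>\<^sub>M lists_of m"
  shows "(\<lambda>x. F x # H x) \<in> N \<rightarrow>\<^sub>M lists_of (Suc m)"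
proof (rule measurable_into_lists)
  fix i assume i: "i < Suc m"
  show "(\<lambda>x. (F x # H x) ! i) \<in> N \<rightarrow>\<^sub>M \<sigma>"
    using measurable_nth_of[OF assms(2), of "i - 1"] assms(1) i by (cases i) auto
qed (use length_measurable[OF assms(2)] in auto)

lemma Nil_measurable [measurable]: "(\<lambda>x. []) \<in> N \<rightarrow>\<^sub>M lists_of 0"
  by (rule measurable_into_lists) auto

lemma hd_measurable [measurable]: "hd \<in> lists_of (Suc m) \<rightarrow>\<^sub>M \<sigma>"
proof -
  have "hd \<in> lists_of (Suc m) \<rightarrow>\<^sub>M \<sigma> \<longleftrightarrow> (\<lambda>xs. xs ! 0) \<in> lists_of (Suc m) \<rightarrow>\<^sub>M \<sigma>"
    by (rule measurable_cong) (metis hd_conv_nth length_0_conv mem_Collect_eq old.nat.distinct(2) space_lists_of)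
  then show ?thesis
    using nth_measurable[of 0 "Suc m"] by simp
qed

lemma tl_measurable [measurable]: "tl \<in> lists_of (Suc m) \<rightarrow>\<^sub>M lists_of m"
proof (rule measurable_into_lists)
  fix i assume i: "i < m"
  have "(\<lambda>x. tl x ! i) \<in> lists_of (Suc m) \<rightarrow>\<^sub>M \<sigma> \<longleftrightarrow> (\<lambda>xs. xs ! Suc i) \<in> lists_of (Suc m) \<rightarrow>\<^sub>M \<sigma>"
    by (rule measurable_cong) (use i in \<open>auto simp: nth_tl\<close>)
  then show "(\<lambda>x. tl x ! i) \<in> lists_of (Suc m) \<rightarrow>\<^sub>M \<sigma>"
    using nth_measurable[of "Suc i" "Suc m"] i by simp
qed auto

lemma snoc_measurable [measurable (raw)]:
  assumes [measurable]: "F \<in> N \<rightarrow>\<^sub>M \<sigma>" "H \<in> N \<rightarrow>\<^sub>M lists_of m"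
  shows "(\<lambda>x. H x @ [F x]) \<in> N \<rightarrow>\<^sub>M lists_of (Suc m)"
proof -
  have "(\<lambda>x. H x @ [F x]) \<in> N \<rightarrow>\<^sub>M lists_of (m + Suc 0)"
    by measurable
  then show ?thesis by simp
qed

lemma tuple_measurable [measurable]: "tuple n \<in> power_measure \<sigma> n \<rightarrow>\<^sub>M lists_of n"
  by (rule measurable_into_lists)
    (auto simp: tuple_def power_measure_def intro: measurable_component_singleton)

lemma borel_measurable_lists_iff:
  "(\<lambda>y. g (tuple n y)) \<in> borel_measurable (power_measure \<sigma> n) \<longleftrightarrow> g \<in> borel_measurable (lists_of n)"
proof
  assume g: "(\<lambda>y. g (tuple n y)) \<in> borel_measurable (power_measure \<sigma> n)"
  have "(\<lambda>xs. \<lambda>i\<in>{..<n}. xs ! i) \<in> lists_of n \<rightarrow>\<^sub>M power_measure \<sigma> n"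
    unfolding power_measure_def by (rule measurable_restrict) (auto intro: nth_measurable)
  from measurable_compose[OF this g]
  have "(\<lambda>xs. g (tuple n (\<lambda>i\<in>{..<n}. xs ! i))) \<in> borel_measurable (lists_of n)" .
  also have "?this \<longleftrightarrow> g \<in> borel_measurable (lists_of n)"
  proof (rule measurable_cong)
    fix xs :: "'a list" assume "xs \<in> space (lists_of n)"
    then have "tuple n (\<lambda>i\<in>{..<n}. xs ! i) = xs"
      by (auto simp: tuple_def intro!: nth_equalityI)
    then show "g (tuple n (\<lambda>i\<in>{..<n}. xs ! i)) = g xs" by simp
  qed
  finally show "g \<in> borel_measurable (lists_of n)" .
next
  assume "g \<in> borel_measurable (lists_of n)"
  then show "(\<lambda>y. g (tuple n y)) \<in> borel_measurable (power_measure \<sigma> n)"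
    by (rule measurable_compose[OF tuple_measurable])
qed

text \<open>
  Both measures give the same mass to boxes, which determines a finite product of \<open>\<sigma>\<close>-finite
  measures. It serves to shift indices: those of coordinates by one when a head is split off a
  list, and those of integration variables, which are blocks, when all blocks are shifted.
\<close>
lemma distr_PiM_bij:
  assumes "finite J" and \<pi>: "bij_betw \<pi> I J"
  shows "distr (PiM J (\<lambda>_. \<sigma>)) (PiM I (\<lambda>_. \<sigma>)) (\<lambda>v. \<lambda>i\<in>I. v (\<pi> i)) = PiM I (\<lambda>_. \<sigma>)"
proof (rule PiM_eqI)
  show "finite I" using assms bij_betw_finite by blast
  have meas: "(\<lambda>v. \<lambda>i\<in>I. v (\<pi> i)) \<in> PiM J (\<lambda>_. \<sigma>) \<rightarrow>\<^sub>M PiM I (\<lambda>_. \<sigma>)"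
    by (rule measurable_restrict)
      (use \<pi> in \<open>auto simp: bij_betw_def intro: measurable_component_singleton\<close>)
  fix A assume A: "\<And>i. i \<in> I \<Longrightarrow> A i \<in> sets \<sigma>"
  define \<rho> where "\<rho> = inv_into I \<pi>"
  have \<rho>: "bij_betw \<rho> J I" "\<And>i. i \<in> I \<Longrightarrow> \<rho> (\<pi> i) = i" "\<And>j. j \<in> J \<Longrightarrow> \<pi> (\<rho> j) = j"
    unfolding \<rho>_def using \<pi> bij_betw_inv_into inv_into_f_f f_inv_into_f
    by (auto simp: bij_betw_def inv_into_into)
  have eq: "(\<lambda>v. \<lambda>i\<in>I. v (\<pi> i)) -` (PiE I A) \<inter> space (PiM J (\<lambda>_. \<sigma>)) = PiE J (\<lambda>j. A (\<rho> j))"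
  proof (intro equalityI subsetI)
    fix v assume "v \<in> (\<lambda>v. \<lambda>i\<in>I. v (\<pi> i)) -` (PiE I A) \<inter> space (PiM J (\<lambda>_. \<sigma>))"
    then have v: "v \<in> extensional J" "\<And>i. i \<in> I \<Longrightarrow> v (\<pi> i) \<in> A i"
      by (auto simp: space_PiM PiE_def Pi_def restrict_def split: if_splits)
    show "v \<in> PiE J (\<lambda>j. A (\<rho> j))"
      using v \<rho> by (auto simp: PiE_def bij_betw_def) (metis image_eqI)
  next
    fix v assume "v \<in> PiE J (\<lambda>j. A (\<rho> j))"
    then show "v \<in> (\<lambda>v. \<lambda>i\<in>I. v (\<pi> i)) -` (PiE I A) \<inter> space (PiM J (\<lambda>_. \<sigma>))"
      using \<rho> \<pi> by (auto simp: space_PiM PiE_def Pi_def bij_betw_def)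
  qed
  have "emeasure (distr (PiM J (\<lambda>_. \<sigma>)) (PiM I (\<lambda>_. \<sigma>)) (\<lambda>v. \<lambda>i\<in>I. v (\<pi> i))) (PiE I A)
      = emeasure (PiM J (\<lambda>_. \<sigma>)) (PiE J (\<lambda>j. A (\<rho> j)))"
    using A \<open>finite I\<close> by (subst emeasure_distr[OF meas]) (auto simp: eq intro: sets_PiM_I_finite)
  also have "\<dots> = (\<Prod>j\<in>J. emeasure \<sigma> (A (\<rho> j)))"
    using A \<rho> assms by (intro emeasure_PiM) (auto simp: bij_betw_def)
  also have "\<dots> = (\<Prod>i\<in>I. emeasure \<sigma> (A i))"
    by (rule prod.reindex_bij_betw[OF \<rho>(1)])
  finally show "emeasure (distr (PiM J (\<lambda>_. \<sigma>)) (PiM I (\<lambda>_. \<sigma>)) (\<lambda>v. \<lambda>i\<in>I. v (\<pi> i))) (PiE I A)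
      = (\<Prod>i\<in>I. emeasure \<sigma> (A i))" .
qed simp

lemma integral_PiM_bij:
  fixes F :: "('i \<Rightarrow> 'a) \<Rightarrow> real"
  assumes "finite J" and \<pi>: "bij_betw \<pi> I J" and F: "F \<in> borel_measurable (PiM I (\<lambda>_. \<sigma>))"
  shows "(LINT v|PiM J (\<lambda>_. \<sigma>). F (\<lambda>i\<in>I. v (\<pi> i))) = (LINT v|PiM I (\<lambda>_. \<sigma>). F v)"
proof -
  have meas: "(\<lambda>v. \<lambda>i\<in>I. v (\<pi> i)) \<in> PiM J (\<lambda>_. \<sigma>) \<rightarrow>\<^sub>M PiM I (\<lambda>_. \<sigma>)"
    by (rule measurable_restrict)
      (use \<pi> in \<open>auto simp: bij_betw_def intro: measurable_component_singleton\<close>)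
  show ?thesis
    using integral_distr[OF meas F] by (simp add: distr_PiM_bij[OF assms(1,2)])
qed

lemma nn_integral_PiM_bij:
  fixes F :: "('i \<Rightarrow> 'a) \<Rightarrow> ennreal"
  assumes "finite J" and \<pi>: "bij_betw \<pi> I J" and F: "F \<in> borel_measurable (PiM I (\<lambda>_. \<sigma>))"
  shows "(\<integral>\<^sup>+ v. F (\<lambda>i\<in>I. v (\<pi> i)) \<partial>PiM J (\<lambda>_. \<sigma>)) = (\<integral>\<^sup>+ v. F v \<partial>PiM I (\<lambda>_. \<sigma>))"
proof -
  have meas: "(\<lambda>v. \<lambda>i\<in>I. v (\<pi> i)) \<in> PiM J (\<lambda>_. \<sigma>) \<rightarrow>\<^sub>M PiM I (\<lambda>_. \<sigma>)"
    by (rule measurable_restrict)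
      (use \<pi> in \<open>auto simp: bij_betw_def intro: measurable_component_singleton\<close>)
  show ?thesis
    using nn_integral_distr[of _ _ "PiM I (\<lambda>_. \<sigma>)", OF meas] F
    by (simp add: distr_PiM_bij[OF assms(1,2)])
qed

text \<open>
  Tonelli for a list split into head and tail, the form in which the letters see the measure
  \<open>\<sigma>\<^sup>m\<close>.
\<close>
lemma nn_integral_tuple_Suc:
  assumes H: "H \<in> borel_measurable (lists_of (Suc m))"
  shows "(\<integral>\<^sup>+ y. H (tuple (Suc m) y) \<partial>power_measure \<sigma> (Suc m)) =
    (\<integral>\<^sup>+ t. (\<integral>\<^sup>+ y. H (t # tuple m y) \<partial>power_measure \<sigma> m) \<partial>\<sigma>)"
proof -
  have ins: "{..<Suc m} = insert 0 (Suc ` {..<m})"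
    by (auto simp: less_Suc_eq_0_disj)
  have m: "(\<lambda>y. H (tuple (Suc m) y)) \<in> borel_measurable (PiM (insert 0 (Suc ` {..<m})) (\<lambda>_. \<sigma>))"
    using H tuple_measurable[of "Suc m"] unfolding power_measure_def ins[symmetric] by measurable
  have "(\<integral>\<^sup>+ y. H (tuple (Suc m) y) \<partial>power_measure \<sigma> (Suc m)) =
     (\<integral>\<^sup>+ t. (\<integral>\<^sup>+ y. H (tuple (Suc m) (y(0 := t))) \<partial>PiM (Suc ` {..<m}) (\<lambda>_. \<sigma>)) \<partial>\<sigma>)"
    unfolding power_measure_def ins by (rule product_nn_integral_insert_rev) (use m in auto)
  also have "\<dots> = (\<integral>\<^sup>+ t. (\<integral>\<^sup>+ y. H (t # tuple m (\<lambda>i\<in>{..<m}. y (Suc i))) \<partial>PiM (Suc ` {..<m}) (\<lambda>_. \<sigma>)) \<partial>\<sigma>)"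
    by (intro nn_integral_cong arg_cong[where f = H])
      (simp add: tuple_def upt_conv_Cons map_Suc_upt[symmetric] del: upt_Suc)
  also have "\<dots> = (\<integral>\<^sup>+ t. (\<integral>\<^sup>+ y. H (t # tuple m y) \<partial>power_measure \<sigma> m) \<partial>\<sigma>)"
  proof (rule nn_integral_cong)
    fix t
    have "(\<lambda>y. H (t # tuple m y)) \<in> borel_measurable (PiM {..<m} (\<lambda>_. \<sigma>))"
      using H tuple_measurable[of m] unfolding power_measure_def by measurable
    then show "(\<integral>\<^sup>+ y. H (t # tuple m (\<lambda>i\<in>{..<m}. y (Suc i))) \<partial>PiM (Suc ` {..<m}) (\<lambda>_. \<sigma>)) =
        (\<integral>\<^sup>+ y. H (t # tuple m y) \<partial>power_measure \<sigma> m)"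
      unfolding power_measure_def
      by (intro nn_integral_PiM_bij[where F = "\<lambda>y. H (t # tuple m y)"]) (auto simp: bij_betw_def)
  qed
  finally show ?thesis .
qed

end

section \<open>Words as operators\<close>

text \<open>
  The arguments already waiting in the first list are parameters of the function that is smeared.
  This turns \<open>foldr\<close> into the recursion \<open>word_op_Cons\<close> on the leftmost letter, in which no waiting list
  is left.
\<close>
lemma foldr_letter_op_prefix:
  "foldr (letter_op \<sigma> lam) w (\<lambda>ts ys. f ts * g ys) ts ys = word_op \<sigma> lam w (\<lambda>ss. f (ts @ ss)) g ys"
proof (induction w arbitrary: f ts ys)
  case Nil
  show ?case by (simp add: word_op_def)
next
  case (Cons x w)
  show ?case
    by (cases x; cases ys) (simp_all add: word_op_def Cons.IH[of f] Cons.IH[of "\<lambda>ss. f (ts @ ss)"])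
qed

lemma word_op_Nil: "word_op \<sigma> lam [] f g ys = f [] * g ys"
  by (simp add: word_op_def)

lemma word_op_Cons:
  "word_op \<sigma> lam (Cre # w) f g [] = 0"
  "word_op \<sigma> lam (Cre # w) f g (y # ys) = word_op \<sigma> lam w (\<lambda>ss. f (y # ss)) g ys"
  "word_op \<sigma> lam (Ann # w) f g zs = (LINT t|\<sigma>. word_op \<sigma> lam w (\<lambda>ss. f (t # ss)) g (t # zs))"
  "word_op \<sigma> lam (Num # w) f g [] = 0"
  "word_op \<sigma> lam (Num # w) f g (y # ys) = lam y * word_op \<sigma> lam w (\<lambda>ss. f (y # ss)) g (y # ys)"
  by (simp_all add: word_op_def[of _ _ "_ # _"] foldr_letter_op_prefix)

lemma word_op_cong:
  assumes "\<And>ss. length ss = length w \<Longrightarrow> f ss = f' ss"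
  shows "word_op \<sigma> lam w f g ys = word_op \<sigma> lam w f' g ys"
  using assms
proof (induction w arbitrary: f f' ys)
  case (Cons x w)
  have "word_op \<sigma> lam w (\<lambda>ss. f (t # ss)) g zs = word_op \<sigma> lam w (\<lambda>ss. f' (t # ss)) g zs" for t zs
    by (rule Cons.IH) (simp add: Cons.prems)
  then show ?case
    by (cases x; cases ys) (simp_all add: word_op_Cons)
qed (simp add: word_op_Nil)

lemma word_op_scale:
  "word_op \<sigma> lam w (\<lambda>ss. c * f ss) g ys = c * word_op \<sigma> lam w f g ys"
proof (induction w arbitrary: f ys)
  case (Cons x w)
  then show ?case
    by (cases x; cases ys) (simp_all add: word_op_Cons)
qed (simp add: word_op_Nil)

lemma word_op_zero:
  assumes "\<And>ss. length ss = length w \<Longrightarrow> f ss = 0"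
  shows "word_op \<sigma> lam w f g ys = 0"
proof -
  have "word_op \<sigma> lam w f g ys = word_op \<sigma> lam w (\<lambda>ss. 0 * f ss) g ys"
    by (rule word_op_cong) (simp add: assms)
  also have "\<dots> = 0 * word_op \<sigma> lam w f g ys"
    by (rule word_op_scale)
  finally show ?thesis by simp
qed

context noise_space
begin

text \<open>
  The class of functions to be smeared. It contains the test functions, and restriction to diagonals,
  partial integration and multiplication by \<open>\<lambda>\<close> at one of the arguments lead back into it without
  any argument about continuity.
\<close>
definition kernel :: "nat \<Rightarrow> ('a list \<Rightarrow> real) \<Rightarrow> bool" where
  "kernel n f \<longleftrightarrow> f \<in> borel_measurable (lists_of n) \<and>
     (\<exists>B\<ge>0. \<forall>ts. length ts = n \<longrightarrow> \<bar>f ts\<bar> \<le> B * of_bool (set ts \<subseteq> K))"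

lemma kernelI:
  assumes "f \<in> borel_measurable (lists_of n)" "0 \<le> B"
    and "\<And>ts. length ts = n \<Longrightarrow> \<bar>f ts\<bar> \<le> B * of_bool (set ts \<subseteq> K)"
  shows "kernel n f"
  unfolding kernel_def using assms by blast

lemma kernelE:
  assumes "kernel n f"
  obtains B where "f \<in> borel_measurable (lists_of n)" "0 \<le> B"
    "\<And>ts. length ts = n \<Longrightarrow> \<bar>f ts\<bar> \<le> B * of_bool (set ts \<subseteq> K)"
  using assms by (auto simp: kernel_def)

lemma kernel_measurable: "kernel n f \<Longrightarrow> f \<in> borel_measurable (lists_of n)"
  by (simp add: kernel_def)

lemma kernel_outside:
  assumes "kernel n f" "length ts = n" "\<not> set ts \<subseteq> K"
  shows "f ts = 0"
proof (rule kernelE[OF assms(1)])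
  fix B assume "\<And>ts. length ts = n \<Longrightarrow> \<bar>f ts\<bar> \<le> B * of_bool (set ts \<subseteq> K)"
  from this[OF assms(2)] show "f ts = 0"
    using assms(3) by simp
qed

lemma kernel_Cons:
  assumes "kernel (Suc n) f"
  shows "kernel n (\<lambda>ss. f (t # ss))"
proof (rule kernelE[OF assms])
  fix B assume m: "f \<in> borel_measurable (lists_of (Suc n))" and B: "0 \<le> B"
    and le: "\<And>ts. length ts = Suc n \<Longrightarrow> \<bar>f ts\<bar> \<le> B * of_bool (set ts \<subseteq> K)"
  show ?thesis
  proof (rule kernelI[OF _ B])
    show "(\<lambda>ss. f (t # ss)) \<in> borel_measurable (lists_of n)"
      by (rule measurable_compose[OF Cons_measurable m]) auto
    show "\<bar>f (t # ts)\<bar> \<le> B * of_bool (set ts \<subseteq> K)" if "length ts = n" for ts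
      using le[of "t # ts"] that B by (cases "t \<in> K") auto
  qed
qed

lemma kernel_congI:
  assumes "kernel n f" "\<And>ts. length ts = n \<Longrightarrow> f ts = f' ts"
  shows "kernel n f'"
proof (rule kernelE[OF assms(1)])
  fix B assume m: "f \<in> borel_measurable (lists_of n)" and B: "0 \<le> B"
    and le: "\<And>ts. length ts = n \<Longrightarrow> \<bar>f ts\<bar> \<le> B * of_bool (set ts \<subseteq> K)"
  have "f' \<in> borel_measurable (lists_of n)"
    using m by (subst measurable_cong[of _ _ f]) (auto simp: assms(2))
  then show ?thesis
    by (rule kernelI[OF _ B]) (use le assms(2) in auto)
qed

definition levelwise_measurable :: "('a list \<Rightarrow> 'b::topological_space) \<Rightarrow> bool" where
  "levelwise_measurable g \<longleftrightarrow> (\<forall>m. g \<in> borel_measurable (lists_of m))"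

lemma levelwise_measurableD [measurable_dest]:
  "levelwise_measurable g \<Longrightarrow> g \<in> borel_measurable (lists_of m)"
  by (simp add: levelwise_measurable_def)

text \<open>
  Joint measurability in both lists is what survives an annihilation, by measurability of parameter
  integrals.
\<close>
lemma foldr_letter_op_measurable:
  assumes f: "f \<in> borel_measurable (lists_of (k + length w))" and g: "levelwise_measurable g"
  shows "(\<lambda>(ts, ys). foldr (letter_op \<sigma> lam) w (\<lambda>ts ys. f ts * g ys) ts ys)
           \<in> borel_measurable (lists_of k \<Otimes>\<^sub>M lists_of m)"
  using f
proof (induction w arbitrary: k m)
  case Nil
  have [measurable]: "f \<in> borel_measurable (lists_of k)" using Nil by simp
  note levelwise_measurableD[OF g, measurable]
  show ?case by simp
next
  case (Cons x w)
  define h where "h = foldr (letter_op \<sigma> lam) w (\<lambda>ts ys. f ts * g ys)"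
  have h: "(\<lambda>(ts, ys). h ts ys) \<in> borel_measurable (lists_of (Suc k) \<Otimes>\<^sub>M lists_of m)" for m
    unfolding h_def by (rule Cons.IH) (use Cons.prems in simp)
  have hc: "(\<lambda>x. h (F x) (H x)) \<in> borel_measurable N"
    if "F \<in> N \<rightarrow>\<^sub>M lists_of (Suc k)" "H \<in> N \<rightarrow>\<^sub>M lists_of m" for F H m and N :: "'z measure"
    using measurable_compose[OF measurable_Pair[OF that] h] by simp
  have split: "ys \<noteq> [] \<and> length (tl ys) = m'" if "m = Suc m'" "length ys = m" for ys :: "'a list" and m'
    using that by (cases ys) auto
  have "(\<lambda>(ts, ys). letter_op \<sigma> lam x h ts ys) \<in> borel_measurable (lists_of k \<Otimes>\<^sub>M lists_of m)"
  proof (cases "x = Ann")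
    case True
    have "(\<lambda>p. LINT t|\<sigma>. h (fst p @ [t]) (t # snd p)) \<in> borel_measurable (lists_of k \<Otimes>\<^sub>M lists_of m)"
    proof (rule borel_measurable_lebesgue_integral)
      show "(\<lambda>(p, t). h (fst p @ [t]) (t # snd p))
          \<in> borel_measurable ((lists_of k \<Otimes>\<^sub>M lists_of m) \<Otimes>\<^sub>M \<sigma>)"
        unfolding case_prod_beta by (rule hc) measurable
    qed
    then show ?thesis
      by (simp add: True case_prod_beta)
  next
    case False
    show ?thesis
    proof (cases m)
      case 0
      have "(\<lambda>(ts, ys). letter_op \<sigma> lam x h ts ys) \<in> borel_measurable (lists_of k \<Otimes>\<^sub>M lists_of m) \<longleftrightarrow>
          (\<lambda>_. 0::real) \<in> borel_measurable (lists_of k \<Otimes>\<^sub>M lists_of m)"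
        by (rule measurable_cong) (use False 0 in \<open>cases x; auto simp: space_pair_measure\<close>)
      then show ?thesis by simp
    next
      case (Suc m')
      have "(\<lambda>p. h (fst p @ [hd (snd p)]) (tl (snd p))) \<in> borel_measurable (lists_of k \<Otimes>\<^sub>M lists_of m)"
        unfolding Suc by (rule hc) measurable
      moreover have "(\<lambda>p. lam (hd (snd p)) * h (fst p @ [hd (snd p)]) (snd p))
          \<in> borel_measurable (lists_of k \<Otimes>\<^sub>M lists_of m)"
        unfolding Suc by (intro borel_measurable_times hc) measurable
      ultimately have "(\<lambda>p. case x of Cre \<Rightarrow> h (fst p @ [hd (snd p)]) (tl (snd p))
            | _ \<Rightarrow> lam (hd (snd p)) * h (fst p @ [hd (snd p)]) (snd p))
          \<in> borel_measurable (lists_of k \<Otimes>\<^sub>M lists_of m)"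
        by (cases x) auto
      also have "?this \<longleftrightarrow> ?thesis"
      proof (rule measurable_cong)
        fix p assume "p \<in> space (lists_of k \<Otimes>\<^sub>M lists_of m)"
        then obtain ts y ys where "p = (ts, y # ys)"
          using Suc by (cases p; cases "snd p") (auto simp: space_pair_measure)
        then show "(case x of Cre \<Rightarrow> h (fst p @ [hd (snd p)]) (tl (snd p))
            | _ \<Rightarrow> lam (hd (snd p)) * h (fst p @ [hd (snd p)]) (snd p)) =
            (case p of (ts, ys) \<Rightarrow> letter_op \<sigma> lam x h ts ys)"
          using False by (cases x) auto
      qed
      finally show ?thesis .
    qed
  qed
  then show ?case
    by (simp add: h_def)
qed

lemma word_op_measurable:
  assumes f: "f \<in> borel_measurable (lists_of (k + length w))" and g: "levelwise_measurable g"
    and "F \<in> N \<rightarrow>\<^sub>M lists_of k" "Y \<in> N \<rightarrow>\<^sub>M lists_of m"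
  shows "(\<lambda>x. word_op \<sigma> lam w (\<lambda>ss. f (F x @ ss)) g (Y x)) \<in> borel_measurable N"
  using measurable_compose[OF measurable_Pair[OF assms(3,4)] foldr_letter_op_measurable[OF f g]]
  by (simp add: foldr_letter_op_prefix)

lemma levelwise_measurable_word_op:
  assumes "f \<in> borel_measurable (lists_of (length w))" "levelwise_measurable g"
  shows "levelwise_measurable (word_op \<sigma> lam w f g)"
  unfolding levelwise_measurable_def
proof
  fix m
  show "word_op \<sigma> lam w f g \<in> borel_measurable (lists_of m)"
    using word_op_measurable[of f 0 w g "\<lambda>_. []" "lists_of m" "\<lambda>ys. ys" m] assms by simp
qed

lemma word_op_Cons_measurable:
  assumes "f \<in> borel_measurable (lists_of (Suc (length w)))" "levelwise_measurable g"
  shows "(\<lambda>t. word_op \<sigma> lam w (\<lambda>ss. f (t # ss)) g (t # ys)) \<in> borel_measurable \<sigma>"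
proof -
  have "(\<lambda>t. word_op \<sigma> lam w (\<lambda>ss. f ([t] @ ss)) g (t # ys)) \<in> borel_measurable \<sigma>"
  proof (rule word_op_measurable[OF _ assms(2)])
    show "(\<lambda>t. t # ys) \<in> \<sigma> \<rightarrow>\<^sub>M lists_of (Suc (length ys))"
      by (rule Cons_measurable) (auto intro!: measurable_const)
    show "(\<lambda>t. [t]) \<in> \<sigma> \<rightarrow>\<^sub>M lists_of (Suc 0)"
      by measurable
  qed (use assms(1) in simp)
  then show ?thesis by simp
qed

section \<open>Domination by positive operators\<close>

text \<open>
  The letter with its argument cut off to \<open>K\<close> and \<open>\<lambda>\<close> replaced by its bound. The values are in
  \<open>[0, \<infinity>]\<close>, so that domination holds at every list and no integrability has to be checked.
\<close>
fun majorant :: "letter \<Rightarrow> ('a list \<Rightarrow> ennreal) \<Rightarrow> 'a list \<Rightarrow> ennreal" where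
  "majorant Cre H [] = 0"
| "majorant Cre H (y # ys) = indicator K y * H ys"
| "majorant Ann H ys = (\<integral>\<^sup>+ t. indicator K t * H (t # ys) \<partial>\<sigma>)"
| "majorant Num H [] = 0"
| "majorant Num H (y # ys) = ennreal L * (indicator K y * H (y # ys))"

abbreviation majorants :: "letter list \<Rightarrow> ('a list \<Rightarrow> ennreal) \<Rightarrow> 'a list \<Rightarrow> ennreal" where
  "majorants w H \<equiv> foldr majorant w H"

lemma majorant_measurable:
  assumes H: "levelwise_measurable H"
  shows "levelwise_measurable (majorant x H)"
  unfolding levelwise_measurable_def
proof
  fix m
  note levelwise_measurableD[OF H, measurable]
  show "majorant x H \<in> borel_measurable (lists_of m)"
  proof (cases "x = Ann")
    case True
    have "(\<lambda>ys. \<integral>\<^sup>+ t. indicator K t * H (t # ys) \<partial>\<sigma>) \<in> borel_measurable (lists_of m)"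
      by measurable
    moreover have "majorant Ann H = (\<lambda>ys. \<integral>\<^sup>+ t. indicator K t * H (t # ys) \<partial>\<sigma>)"
      by (rule ext) simp
    ultimately show ?thesis
      using True by simp
  next
    case False
    show ?thesis
    proof (cases m)
      case 0
      have "majorant x H \<in> borel_measurable (lists_of m) \<longleftrightarrow> (\<lambda>_. 0::ennreal) \<in> borel_measurable (lists_of m)"
        by (rule measurable_cong) (use False 0 in \<open>cases x; auto\<close>)
      then show ?thesis by simp
    next
      case (Suc m')
      have "(\<lambda>ys. case x of Cre \<Rightarrow> indicator K (hd ys) * H (tl ys)
            | _ \<Rightarrow> ennreal L * (indicator K (hd ys) * H ys)) \<in> borel_measurable (lists_of m)"
        unfolding Suc by (cases x) simp_all
      also have "?this \<longleftrightarrow> majorant x H \<in> borel_measurable (lists_of m)"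
      proof (rule measurable_cong)
        fix ys :: "'a list" assume "ys \<in> space (lists_of m)"
        then obtain z zs where "ys = z # zs" using Suc by (cases ys) auto
        then show "(case x of Cre \<Rightarrow> indicator K (hd ys) * H (tl ys)
            | _ \<Rightarrow> ennreal L * (indicator K (hd ys) * H ys)) = majorant x H ys"
          using False by (cases x) auto
      qed
      finally show ?thesis .
    qed
  qed
qed

lemma majorants_measurable: "levelwise_measurable H \<Longrightarrow> levelwise_measurable (majorants w H)"
  by (induction w) (auto intro: majorant_measurable)

abbreviation modulus :: "('a list \<Rightarrow> real) \<Rightarrow> 'a list \<Rightarrow> ennreal" where
  "modulus g \<equiv> \<lambda>ys. ennreal \<bar>g ys\<bar>"

lemma levelwise_measurable_abs:
  fixes g :: "'a list \<Rightarrow> real"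
  assumes "levelwise_measurable g"
  shows "levelwise_measurable (modulus g)"
  unfolding levelwise_measurable_def
proof
  fix m
  note levelwise_measurableD[OF assms, measurable]
  show "(modulus g) \<in> borel_measurable (lists_of m)"
    by measurable
qed

text \<open>
  For a function that is not integrable the left side is 0 by convention.
\<close>
lemma ennreal_abs_integral_le: "ennreal \<bar>LINT x|M. h x\<bar> \<le> (\<integral>\<^sup>+ x. ennreal \<bar>h x\<bar> \<partial>M)"
  using integral_norm_bound_ennreal[of M h] by (cases "integrable M h") (auto simp: not_integrable_integral_eq)

lemma word_op_le_majorants:
  assumes "0 \<le> B" and "\<And>ts. length ts = length w \<Longrightarrow> \<bar>f ts\<bar> \<le> B * of_bool (set ts \<subseteq> K)"
    and g: "levelwise_measurable g"
  shows "ennreal \<bar>word_op \<sigma> lam w f g ys\<bar> \<le> ennreal B * majorants w (modulus g) ys"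
  using assms(1,2)
proof (induction w arbitrary: f B ys)
  case Nil
  then have "\<bar>f []\<bar> \<le> B" by auto
  then show ?case
    using Nil.prems(1) by (simp add: word_op_Nil abs_mult ennreal_mult mult_right_mono)
next
  case (Cons x w)
  have *: "ennreal \<bar>word_op \<sigma> lam w (\<lambda>ss. f (t # ss)) g zs\<bar>
      \<le> ennreal B * (indicator K t * majorants w (modulus g) zs)" for t zs
  proof -
    have "ennreal \<bar>word_op \<sigma> lam w (\<lambda>ss. f (t # ss)) g zs\<bar>
        \<le> ennreal (B * indicator K t) * majorants w (modulus g) zs"
    proof (rule Cons.IH)
      fix ts :: "'a list" assume "length ts = length w"
      then have "\<bar>f (t # ts)\<bar> \<le> B * of_bool (set (t # ts) \<subseteq> K)"
        by (intro Cons.prems) simp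
      then show "\<bar>f (t # ts)\<bar> \<le> B * indicator K t * of_bool (set ts \<subseteq> K)"
        by (cases "t \<in> K"; cases "set ts \<subseteq> K") auto
    qed (use Cons.prems(1) in simp)
    then show ?thesis
      using Cons.prems(1) by (simp add: ennreal_mult ennreal_indicator mult.assoc)
  qed
  show ?case
  proof (cases x)
    case Cre
    then show ?thesis using * by (cases ys) (auto simp: word_op_Cons)
  next
    case Ann
    have "ennreal \<bar>word_op \<sigma> lam (x # w) f g ys\<bar>
        \<le> (\<integral>\<^sup>+ t. ennreal \<bar>word_op \<sigma> lam w (\<lambda>ss. f (t # ss)) g (t # ys)\<bar> \<partial>\<sigma>)"
      unfolding Ann word_op_Cons by (rule ennreal_abs_integral_le)
    also have "\<dots> \<le> (\<integral>\<^sup>+ t. ennreal B * (indicator K t * majorants w (modulus g) (t # ys)) \<partial>\<sigma>)"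
      by (intro nn_integral_mono *)
    also have "\<dots> = ennreal B * majorants (x # w) (modulus g) ys"
    proof -
      from majorants_measurable[OF levelwise_measurable_abs[OF g], of w]
      have [measurable]: "majorants w (modulus g) \<in> borel_measurable (lists_of (Suc (length ys)))"
        by (rule levelwise_measurableD)
      have [measurable]: "(\<lambda>t. t # ys) \<in> \<sigma> \<rightarrow>\<^sub>M lists_of (Suc (length ys))"
        by (rule Cons_measurable) (auto intro!: measurable_const)
      show ?thesis
        by (simp add: Ann nn_integral_cmult)
    qed
    finally show ?thesis .
  next
    case Num
    show ?thesis
    proof (cases ys)
      case (Cons y zs)
      have "ennreal (\<bar>lam y\<bar> * \<bar>word_op \<sigma> lam w (\<lambda>ss. f (y # ss)) g ys\<bar>)
          \<le> ennreal \<bar>lam y\<bar> * (ennreal B * (indicator K y * majorants w (modulus g) ys))"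
        by (simp add: ennreal_mult mult_left_mono *)
      also have "\<dots> \<le> ennreal B * (ennreal L * (indicator K y * majorants w (modulus g) ys))"
        using lam_bounded[of y]
        by (cases "y \<in> K") (auto simp: mult.left_commute intro!: mult_left_mono mult_right_mono)
      finally show ?thesis
        using Num Cons by (simp add: word_op_Cons abs_mult)
    qed (simp add: Num word_op_Cons)
  qed
qed

text \<open>
  The square of \<open>fock_norm\<close> for functions with values in \<open>[0, \<infinity>]\<close>.
\<close>
definition sq_norm :: "('a list \<Rightarrow> ennreal) \<Rightarrow> ennreal" where
  "sq_norm H = (\<Sum>m. \<integral>\<^sup>+ y. (H (tuple m y))\<^sup>2 \<partial>power_measure \<sigma> m)"

lemma sq_norm_leI:
  assumes "\<And>N. (\<Sum>m<N. \<integral>\<^sup>+ y. (H (tuple m y))\<^sup>2 \<partial>power_measure \<sigma> m) \<le> C"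
  shows "sq_norm H \<le> C"
  unfolding sq_norm_def by (rule suminf_le_const) (auto intro: assms)

lemma partial_le_sq_norm:
  "finite I \<Longrightarrow> (\<Sum>m\<in>I. \<integral>\<^sup>+ y. (H (tuple m y))\<^sup>2 \<partial>power_measure \<sigma> m) \<le> sq_norm H"
  unfolding sq_norm_def by (rule sum_le_suminf) auto

lemma level_le_sq_norm: "(\<integral>\<^sup>+ y. (H (tuple m y))\<^sup>2 \<partial>power_measure \<sigma> m) \<le> sq_norm H"
  using partial_le_sq_norm[of "{m}"] by simp

lemma sq_norm_mono:
  assumes "\<And>ys. H ys \<le> H' ys"
  shows "sq_norm H \<le> sq_norm H'"
  unfolding sq_norm_def
  by (intro suminf_le nn_integral_mono power_mono assms summableI) auto

lemma level_measurable:
  "levelwise_measurable H \<Longrightarrow> (\<lambda>y. H (tuple m y)) \<in> borel_measurable (power_measure \<sigma> m)"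
  by (rule measurable_compose[OF tuple_measurable levelwise_measurableD])

lemma sq_norm_cmult:
  assumes "levelwise_measurable H"
  shows "sq_norm (\<lambda>ys. c * H ys) = c\<^sup>2 * sq_norm H"
proof -
  have "(\<integral>\<^sup>+ y. (c * H (tuple m y))\<^sup>2 \<partial>power_measure \<sigma> m) =
      c\<^sup>2 * (\<integral>\<^sup>+ y. (H (tuple m y))\<^sup>2 \<partial>power_measure \<sigma> m)" for m
    using level_measurable[OF assms, of m] by (simp add: power_mult_distrib nn_integral_cmult)
  then show ?thesis
    by (simp add: sq_norm_def)
qed

text \<open>
  One bound for the squared operator norms of all three majorants: \<open>\<sigma>(K)\<close> for \<open>Cre\<close> and \<open>Ann\<close> and \<open>L\<^sup>2\<close>
  for \<open>Num\<close>.
\<close>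
definition growth :: ennreal where
  "growth = emeasure \<sigma> K + ennreal (L\<^sup>2)"

lemma growth_finite: "growth < \<infinity>"
  using K_finite by (simp add: growth_def)

lemma indicator_sq: "(indicator K t :: ennreal)\<^sup>2 = indicator K t"
  by (simp add: indicator_def)

lemma sigma_finite_power: "sigma_finite_measure (power_measure \<sigma> m)"
  unfolding power_measure_def
  by (rule sigma_finite) simp

text \<open>
  Cauchy-Schwarz in the annihilated variable against the indicator of \<open>K\<close>, then Tonelli.
\<close>
lemma level_majorant_Ann:
  assumes H: "levelwise_measurable H"
  shows "(\<integral>\<^sup>+ y. (majorant Ann H (tuple m y))\<^sup>2 \<partial>power_measure \<sigma> m)
    \<le> emeasure \<sigma> K * (\<integral>\<^sup>+ y. (H (tuple (Suc m) y))\<^sup>2 \<partial>power_measure \<sigma> (Suc m))"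
proof -
  interpret P: sigma_finite_measure "power_measure \<sigma> m" by (rule sigma_finite_power)
  interpret PP: pair_sigma_finite \<sigma> "power_measure \<sigma> m" by standard
  note levelwise_measurableD[OF H, measurable]
  have cons [measurable]: "(\<lambda>t. t # tuple m y) \<in> \<sigma> \<rightarrow>\<^sub>M lists_of (Suc m)" for y
    by (rule Cons_measurable) (auto intro!: measurable_const simp: tuple_def)
  have "(\<integral>\<^sup>+ y. (majorant Ann H (tuple m y))\<^sup>2 \<partial>power_measure \<sigma> m)
      \<le> (\<integral>\<^sup>+ y. emeasure \<sigma> K * (\<integral>\<^sup>+ t. (H (t # tuple m y))\<^sup>2 \<partial>\<sigma>) \<partial>power_measure \<sigma> m)"
  proof (rule nn_integral_mono)
    fix y
    have "(majorant Ann H (tuple m y))\<^sup>2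
        \<le> (\<integral>\<^sup>+ t. (indicator K t)\<^sup>2 \<partial>\<sigma>) * (\<integral>\<^sup>+ t. (H (t # tuple m y))\<^sup>2 \<partial>\<sigma>)"
      unfolding majorant.simps by (rule Cauchy_Schwarz_nn_integral) measurable
    then show "(majorant Ann H (tuple m y))\<^sup>2
        \<le> emeasure \<sigma> K * (\<integral>\<^sup>+ t. (H (t # tuple m y))\<^sup>2 \<partial>\<sigma>)"
      by (simp add: indicator_sq)
  qed
  also have "\<dots> = emeasure \<sigma> K * (\<integral>\<^sup>+ y. (\<integral>\<^sup>+ t. (H (t # tuple m y))\<^sup>2 \<partial>\<sigma>) \<partial>power_measure \<sigma> m)"
    by (rule nn_integral_cmult) measurable
  also have "(\<integral>\<^sup>+ y. (\<integral>\<^sup>+ t. (H (t # tuple m y))\<^sup>2 \<partial>\<sigma>) \<partial>power_measure \<sigma> m)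
      = (\<integral>\<^sup>+ t. (\<integral>\<^sup>+ y. (H (t # tuple m y))\<^sup>2 \<partial>power_measure \<sigma> m) \<partial>\<sigma>)"
    by (rule PP.Fubini') measurable
  also have "\<dots> = (\<integral>\<^sup>+ y. (H (tuple (Suc m) y))\<^sup>2 \<partial>power_measure \<sigma> (Suc m))"
    by (rule nn_integral_tuple_Suc[symmetric]) measurable
  finally show ?thesis .
qed

lemma level_majorant_Cre:
  assumes H: "levelwise_measurable H"
  shows "(\<integral>\<^sup>+ y. (majorant Cre H (tuple (Suc m) y))\<^sup>2 \<partial>power_measure \<sigma> (Suc m))
    = emeasure \<sigma> K * (\<integral>\<^sup>+ y. (H (tuple m y))\<^sup>2 \<partial>power_measure \<sigma> m)"
proof -
  note levelwise_measurableD[OF H, measurable]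
  note levelwise_measurableD[OF majorant_measurable[OF H], measurable]
  have "(\<integral>\<^sup>+ y. (majorant Cre H (tuple (Suc m) y))\<^sup>2 \<partial>power_measure \<sigma> (Suc m)) =
      (\<integral>\<^sup>+ t. (\<integral>\<^sup>+ y. (majorant Cre H (t # tuple m y))\<^sup>2 \<partial>power_measure \<sigma> m) \<partial>\<sigma>)"
    by (rule nn_integral_tuple_Suc) measurable
  also have "\<dots> = (\<integral>\<^sup>+ t. indicator K t * (\<integral>\<^sup>+ y. (H (tuple m y))\<^sup>2 \<partial>power_measure \<sigma> m) \<partial>\<sigma>)"
  proof (rule nn_integral_cong)
    fix t
    show "(\<integral>\<^sup>+ y. (majorant Cre H (t # tuple m y))\<^sup>2 \<partial>power_measure \<sigma> m) =
        indicator K t * (\<integral>\<^sup>+ y. (H (tuple m y))\<^sup>2 \<partial>power_measure \<sigma> m)"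
      by (subst nn_integral_cmult[symmetric]) (auto simp: power_mult_distrib indicator_sq)
  qed
  finally show ?thesis
    by (simp add: nn_integral_multc)
qed

lemma level_majorant_Num:
  assumes H: "levelwise_measurable H"
  shows "(\<integral>\<^sup>+ y. (majorant Num H (tuple m y))\<^sup>2 \<partial>power_measure \<sigma> m)
    \<le> ennreal (L\<^sup>2) * (\<integral>\<^sup>+ y. (H (tuple m y))\<^sup>2 \<partial>power_measure \<sigma> m)"
proof -
  have le: "(majorant Num H ys)\<^sup>2 \<le> ennreal (L\<^sup>2) * (H ys)\<^sup>2" for ys
  proof (cases ys)
    case (Cons y zs)
    then show ?thesis
      using L_nonneg by (simp add: power_mult_distrib indicator_sq ennreal_power indicator_def)
  qed simp
  have "(\<integral>\<^sup>+ y. (majorant Num H (tuple m y))\<^sup>2 \<partial>power_measure \<sigma> m)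
      \<le> (\<integral>\<^sup>+ y. ennreal (L\<^sup>2) * (H (tuple m y))\<^sup>2 \<partial>power_measure \<sigma> m)"
    by (intro nn_integral_mono le)
  also have "\<dots> = ennreal (L\<^sup>2) * (\<integral>\<^sup>+ y. (H (tuple m y))\<^sup>2 \<partial>power_measure \<sigma> m)"
    using level_measurable[OF H, of m] by (intro nn_integral_cmult) measurable
  finally show ?thesis .
qed

lemma sq_norm_majorant:
  assumes H: "levelwise_measurable H"
  shows "sq_norm (majorant x H) \<le> growth * sq_norm H"
proof (rule sq_norm_leI)
  fix N
  define a where "a m = (\<integral>\<^sup>+ y. (majorant x H (tuple m y))\<^sup>2 \<partial>power_measure \<sigma> m)" for m
  define b where "b m = (\<integral>\<^sup>+ y. (H (tuple m y))\<^sup>2 \<partial>power_measure \<sigma> m)" for m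
  have b: "(\<Sum>m\<in>I. b m) \<le> sq_norm H" if "finite I" for I
    unfolding b_def using that by (rule partial_le_sq_norm)
  have C: "emeasure \<sigma> K \<le> growth" "ennreal (L\<^sup>2) \<le> growth"
    by (simp_all add: growth_def)
  have "(\<Sum>m<N. a m) \<le> growth * sq_norm H"
  proof (cases x)
    case Cre
    have "a 0 = 0"
      by (simp add: a_def Cre tuple_def)
    moreover have "a (Suc m) = emeasure \<sigma> K * b m" for m
      unfolding a_def b_def Cre by (rule level_majorant_Cre[OF H])
    ultimately have "(\<Sum>m<Suc N. a m) = emeasure \<sigma> K * (\<Sum>m<N. b m)" for N
      by (simp add: sum.lessThan_Suc_shift sum_distrib_left del: sum.lessThan_Suc)
    then have "(\<Sum>m<Suc N. a m) \<le> growth * sq_norm H" for N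
      using mult_mono[OF C(1) b[of "{..<N}"]] by simp
    then show ?thesis
      by (cases N) auto
  next
    case Ann
    have "(\<Sum>m<N. a m) \<le> (\<Sum>m<N. emeasure \<sigma> K * b (Suc m))"
      unfolding a_def b_def Ann by (intro sum_mono level_majorant_Ann[OF H])
    also have "\<dots> = emeasure \<sigma> K * (\<Sum>m\<in>Suc ` {..<N}. b m)"
      by (simp add: sum.reindex sum_distrib_left)
    also have "\<dots> \<le> growth * sq_norm H"
      using mult_mono[OF C(1) b[of "Suc ` {..<N}"]] by simp
    finally show ?thesis .
  next
    case Num
    have "(\<Sum>m<N. a m) \<le> (\<Sum>m<N. ennreal (L\<^sup>2) * b m)"
      unfolding a_def b_def Num by (intro sum_mono level_majorant_Num[OF H])
    also have "\<dots> \<le> growth * sq_norm H"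
      using mult_mono[OF C(2) b[of "{..<N}"]] by (simp add: sum_distrib_left[symmetric])
    finally show ?thesis .
  qed
  then show "(\<Sum>m<N. \<integral>\<^sup>+ y. (majorant x H (tuple m y))\<^sup>2 \<partial>power_measure \<sigma> m) \<le> growth * sq_norm H"
    by (simp add: a_def)
qed

lemma sq_norm_majorants:
  assumes H: "levelwise_measurable H"
  shows "sq_norm (majorants w H) \<le> growth ^ length w * sq_norm H"
proof (induction w)
  case (Cons x w)
  have "sq_norm (majorants (x # w) H) \<le> growth * sq_norm (majorants w H)"
    by (simp add: sq_norm_majorant majorants_measurable H)
  also have "\<dots> \<le> growth * (growth ^ length w * sq_norm H)"
    by (intro mult_left_mono Cons.IH) simp
  finally show ?case
    by (simp add: mult.assoc)
qed simp

section \<open>Bounded operators on the Fock space\<close>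

lemma mem_fock_iff:
  "g \<in> fock \<sigma> \<longleftrightarrow> levelwise_measurable g \<and> sq_norm (modulus g) < \<infinity>"
  and fock_norm_eq:
  "g \<in> fock \<sigma> \<Longrightarrow> ennreal ((fock_norm \<sigma> g)\<^sup>2) = sq_norm (modulus g)"
proof -
  let ?I = "\<lambda>m. LINT y|power_measure \<sigma> m. (g (tuple m y))\<^sup>2"
  let ?N = "\<lambda>m. \<integral>\<^sup>+ y. (ennreal \<bar>g (tuple m y)\<bar>)\<^sup>2 \<partial>power_measure \<sigma> m"
  have N: "?N m = (\<integral>\<^sup>+ y. ennreal ((g (tuple m y))\<^sup>2) \<partial>power_measure \<sigma> m)" for m
    by (simp add: ennreal_power)
  have I0: "0 \<le> ?I m" for m
    by simp
  have eq: "?N m = ennreal (?I m)" if "integrable (power_measure \<sigma> m) (\<lambda>y. (g (tuple m y))\<^sup>2)" for m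
    unfolding N using that by (intro nn_integral_eq_integral) auto
  have fwd: "levelwise_measurable g \<and> sq_norm (modulus g) = ennreal (suminf ?I) \<and> 0 \<le> suminf ?I"
    if g: "g \<in> fock \<sigma>"
  proof -
    have int: "integrable (power_measure \<sigma> m) (\<lambda>y. (g (tuple m y))\<^sup>2)" for m
      using g by (auto simp: fock_def)
    have sm: "summable ?I"
      using g by (simp add: fock_def)
    have "sq_norm (modulus g) = (\<Sum>m. ennreal (?I m))"
      unfolding sq_norm_def eq[OF int] ..
    also have "\<dots> = ennreal (suminf ?I)"
      by (rule suminf_ennreal2[OF I0 sm])
    finally show ?thesis
      using g suminf_nonneg[OF sm I0] by (auto simp: fock_def levelwise_measurable_def borel_measurable_lists_iff)
  qed
  have bwd: "g \<in> fock \<sigma>" if g: "levelwise_measurable g" "sq_norm (modulus g) < \<infinity>"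
  proof -
    have m: "(\<lambda>y. g (tuple m y)) \<in> borel_measurable (power_measure \<sigma> m)" for m
      by (rule level_measurable[OF g(1)])
    have "?N m < \<infinity>" for m
      using level_le_sq_norm[where H = "modulus g" and m = m] g(2) by (rule order_le_less_trans)
    then have int: "integrable (power_measure \<sigma> m) (\<lambda>y. (g (tuple m y))\<^sup>2)" for m
      unfolding N using m[of m] by (intro integrableI_nonneg) auto
    have "(\<Sum>m. ennreal (?I m)) = sq_norm (modulus g)"
      unfolding sq_norm_def eq[OF int] ..
    then have "summable ?I"
      using g(2) by (intro summable_suminf_not_top I0) simp
    then show ?thesis
      using m int by (simp add: fock_def)
  qed
  show "g \<in> fock \<sigma> \<longleftrightarrow> levelwise_measurable g \<and> sq_norm (modulus g) < \<infinity>"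
    using fwd bwd by auto
  show "g \<in> fock \<sigma> \<Longrightarrow> ennreal ((fock_norm \<sigma> g)\<^sup>2) = sq_norm (modulus g)"
    using fwd by (simp add: fock_norm_def)
qed

lemma fock_norm_nonneg: "g \<in> fock \<sigma> \<Longrightarrow> 0 \<le> fock_norm \<sigma> g"
  by (auto simp: fock_norm_def fock_def intro!: suminf_nonneg)

lemma levelwise_measurable_lincomb:
  fixes g h :: "'a list \<Rightarrow> real"
  assumes g: "levelwise_measurable g" and h: "levelwise_measurable h"
  shows "levelwise_measurable (\<lambda>ys. a * g ys + b * h ys)"
  unfolding levelwise_measurable_def
proof
  fix m
  note levelwise_measurableD[OF g, measurable] levelwise_measurableD[OF h, measurable]
  show "(\<lambda>ys. a * g ys + b * h ys) \<in> borel_measurable (lists_of m)"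
    by measurable
qed

text \<open>
  Compared with \<open>bounded_fock_operator\<close>, the bound is on squares and holds for all measurable
  functions. In this form the condition passes to finite sums without a triangle inequality for
  \<open>fock_norm\<close>, and independence of the representative need not be included: it follows from
  linearity and the bound, applied to a difference of norm 0 (\<open>bounded_fock_operatorI\<close>).
\<close>
definition fock_op :: "(('a list \<Rightarrow> real) \<Rightarrow> ('a list \<Rightarrow> real)) \<Rightarrow> bool" where
  "fock_op W \<longleftrightarrow>
     (\<forall>g. levelwise_measurable g \<longrightarrow> levelwise_measurable (W g)) \<and>
     (\<exists>C<\<infinity>. \<forall>g. levelwise_measurable g \<longrightarrow>
        sq_norm (\<lambda>ys. ennreal \<bar>W g ys\<bar>) \<le> C * sq_norm (modulus g)) \<and>
     (\<forall>g\<in>fock \<sigma>. \<forall>h\<in>fock \<sigma>. \<forall>a b.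
        fock_eq \<sigma> (W (\<lambda>y. a * g y + b * h y)) (\<lambda>y. a * W g y + b * W h y))"

lemma fock_op_measurable: "fock_op W \<Longrightarrow> levelwise_measurable g \<Longrightarrow> levelwise_measurable (W g)"
  unfolding fock_op_def by blast

lemma fock_op_linear:
  "fock_op W \<Longrightarrow> g \<in> fock \<sigma> \<Longrightarrow> h \<in> fock \<sigma> \<Longrightarrow>
     fock_eq \<sigma> (W (\<lambda>y. a * g y + b * h y)) (\<lambda>y. a * W g y + b * W h y)"
  unfolding fock_op_def by blast

lemma fock_op_bounded:
  assumes "fock_op W"
  obtains C where "C < \<infinity>" "\<And>g. levelwise_measurable g \<Longrightarrow>
        sq_norm (\<lambda>ys. ennreal \<bar>W g ys\<bar>) \<le> C * sq_norm (modulus g)"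
  using assms unfolding fock_op_def by blast

lemma bounded_fock_operatorI:
  assumes "fock_op W"
  shows "bounded_fock_operator \<sigma> W"
proof -
  note meas = fock_op_measurable[OF assms]
  note lin = fock_op_linear[OF assms]
  obtain C where C: "C < \<infinity>" and bd: "\<And>g. levelwise_measurable g \<Longrightarrow>
        sq_norm (\<lambda>ys. ennreal \<bar>W g ys\<bar>) \<le> C * sq_norm (modulus g)"
    using fock_op_bounded[OF assms] by blast
  have in_fock: "W g \<in> fock \<sigma>" if "g \<in> fock \<sigma>" for g
  proof -
    from that have g: "levelwise_measurable g" "sq_norm (modulus g) < \<infinity>"
      by (simp_all add: mem_fock_iff)
    have "C * sq_norm (modulus g) < \<infinity>"
      using C g(2) by (simp add: ennreal_mult_less_top)
    then show ?thesis
      using bd[OF g(1)] meas[OF g(1)] by (simp add: mem_fock_iff)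
  qed
  have well: "fock_eq \<sigma> (W g) (W h)" if g: "g \<in> fock \<sigma>" and h: "h \<in> fock \<sigma>" and gh: "fock_eq \<sigma> g h" for g h
  proof -
    define d where "d = (\<lambda>ys. 1 * g ys + (-1) * h ys)"
    have d: "levelwise_measurable d"
      unfolding d_def using g h by (intro levelwise_measurable_lincomb) (simp_all add: mem_fock_iff)
    have "(\<integral>\<^sup>+ y. (ennreal \<bar>d (tuple m y)\<bar>)\<^sup>2 \<partial>power_measure \<sigma> m) = 0" for m
    proof -
      have "AE y in power_measure \<sigma> m. g (tuple m y) = h (tuple m y)"
        using gh by (simp add: fock_eq_def)
      then have "AE y in power_measure \<sigma> m. (ennreal \<bar>d (tuple m y)\<bar>)\<^sup>2 = 0"
        by eventually_elim (simp add: d_def)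
      then have "(\<integral>\<^sup>+ y. (ennreal \<bar>d (tuple m y)\<bar>)\<^sup>2 \<partial>power_measure \<sigma> m)
          = (\<integral>\<^sup>+ y. 0 \<partial>power_measure \<sigma> m)"
        by (rule nn_integral_cong_AE)
      then show ?thesis by simp
    qed
    then have "sq_norm (\<lambda>ys. ennreal \<bar>d ys\<bar>) = 0"
      by (simp add: sq_norm_def)
    then have "sq_norm (\<lambda>ys. ennreal \<bar>W d ys\<bar>) = 0"
      using bd[OF d] by simp
    then have null: "(\<integral>\<^sup>+ y. (ennreal \<bar>W d (tuple m y)\<bar>)\<^sup>2 \<partial>power_measure \<sigma> m) = 0" for m
      using level_le_sq_norm[where H = "\<lambda>ys. ennreal \<bar>W d ys\<bar>" and m = m] by simp
    have zero: "AE y in power_measure \<sigma> m. W d (tuple m y) = 0" for m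
    proof -
      note level_measurable[OF levelwise_measurable_abs[OF meas[OF d]], of m, measurable]
      have "AE y in power_measure \<sigma> m. (ennreal \<bar>W d (tuple m y)\<bar>)\<^sup>2 = 0"
        using null[of m] by (subst (asm) nn_integral_0_iff_AE) measurable
      then show ?thesis by eventually_elim simp
    qed
    have diff: "AE y in power_measure \<sigma> m. W d (tuple m y) = W g (tuple m y) - W h (tuple m y)" for m
      using lin[OF g h, of 1 "-1"] by (simp add: fock_eq_def d_def)
    have "AE y in power_measure \<sigma> m. W g (tuple m y) = W h (tuple m y)" for m
      using zero[of m] diff[of m] by eventually_elim simp
    then show ?thesis
      by (simp add: fock_eq_def)
  qed
  have norm: "fock_norm \<sigma> (W g) \<le> sqrt (enn2real C) * fock_norm \<sigma> g" if g: "g \<in> fock \<sigma>" for g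
  proof -
    have "ennreal ((fock_norm \<sigma> (W g))\<^sup>2) \<le> ennreal (enn2real C) * ennreal ((fock_norm \<sigma> g)\<^sup>2)"
      using bd[of g] g C unfolding fock_norm_eq[OF g] fock_norm_eq[OF in_fock[OF g]]
      by (simp add: mem_fock_iff)
    then have "(fock_norm \<sigma> (W g))\<^sup>2 \<le> enn2real C * (fock_norm \<sigma> g)\<^sup>2"
      by (subst (asm) ennreal_mult[symmetric]) auto
    also have "\<dots> = (sqrt (enn2real C) * fock_norm \<sigma> g)\<^sup>2"
      by (simp add: power_mult_distrib)
    finally show ?thesis
      by (rule power2_le_imp_le) (simp add: fock_norm_nonneg[OF g])
  qed
  show ?thesis
    unfolding bounded_fock_operator_def
    by (intro conjI ballI allI impI exI[of _ "sqrt (enn2real C)"]) (fact in_fock well lin norm)+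
qed

lemma fock_op_sum:
  assumes "finite I" "\<And>i. i \<in> I \<Longrightarrow> fock_op (W i)"
  shows "fock_op (\<lambda>g ys. \<Sum>i\<in>I. W i g ys)"
  using assms
proof (induction I)
  case empty
  show ?case
    unfolding fock_op_def levelwise_measurable_def fock_eq_def sq_norm_def
    by (auto intro!: exI[of _ 0])
next
  case (insert i I)
  define V where "V = (\<lambda>g ys. \<Sum>i\<in>I. W i g ys)"
  have V: "fock_op V" and W: "fock_op (W i)"
    using insert by (auto simp: V_def)
  note measW = fock_op_measurable[OF W]
  note linW = fock_op_linear[OF W]
  obtain C where C: "C < \<infinity>" and bdW: "\<And>g. levelwise_measurable g \<Longrightarrow>
        sq_norm (\<lambda>ys. ennreal \<bar>W i g ys\<bar>) \<le> C * sq_norm (modulus g)"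
    using fock_op_bounded[OF W] by blast
  note measV = fock_op_measurable[OF V]
  note linV = fock_op_linear[OF V]
  obtain D where D: "D < \<infinity>" and bdV: "\<And>g. levelwise_measurable g \<Longrightarrow>
        sq_norm (\<lambda>ys. ennreal \<bar>V g ys\<bar>) \<le> D * sq_norm (modulus g)"
    using fock_op_bounded[OF V] by blast
  have eq: "(\<lambda>g ys. \<Sum>i\<in>insert i I. W i g ys) = (\<lambda>g ys. W i g ys + V g ys)"
    using insert by (simp add: V_def)
  have "fock_op (\<lambda>g ys. W i g ys + V g ys)"
    unfolding fock_op_def
  proof (intro conjI exI[of _ "2 * C + 2 * D"] allI impI ballI)
    show "levelwise_measurable (\<lambda>ys. W i g ys + V g ys)" if "levelwise_measurable g" for g
      using levelwise_measurable_lincomb[OF measW measV, OF that that, of 1 1] by simp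
    show "2 * C + 2 * D < \<infinity>"
      using C D by (simp add: ennreal_mult_less_top)
    show "fock_eq \<sigma> (\<lambda>ys. W i (\<lambda>y. a * g y + b * h y) ys + V (\<lambda>y. a * g y + b * h y) ys)
        (\<lambda>y. a * (W i g y + V g y) + b * (W i h y + V h y))"
      if "g \<in> fock \<sigma>" "h \<in> fock \<sigma>" for g h a b
      unfolding fock_eq_def
    proof
      fix m
      have "AE y in power_measure \<sigma> m. W i (\<lambda>y. a * g y + b * h y) (tuple m y) =
          a * W i g (tuple m y) + b * W i h (tuple m y)"
        "AE y in power_measure \<sigma> m. V (\<lambda>y. a * g y + b * h y) (tuple m y) =
          a * V g (tuple m y) + b * V h (tuple m y)"
        using linW[OF that, of a b] linV[OF that, of a b] by (auto simp: fock_eq_def)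
      then show "AE y in power_measure \<sigma> m.
          W i (\<lambda>y. a * g y + b * h y) (tuple m y) + V (\<lambda>y. a * g y + b * h y) (tuple m y) =
          a * (W i g (tuple m y) + V g (tuple m y)) + b * (W i h (tuple m y) + V h (tuple m y))"
        by eventually_elim (simp add: algebra_simps)
    qed
    show "sq_norm (\<lambda>ys. ennreal \<bar>W i g ys + V g ys\<bar>) \<le> (2 * C + 2 * D) * sq_norm (modulus g)"
      if g: "levelwise_measurable g" for g
    proof -
      have sq: "(ennreal \<bar>x + y\<bar>)\<^sup>2 \<le> 2 * (ennreal \<bar>x\<bar>)\<^sup>2 + 2 * (ennreal \<bar>y\<bar>)\<^sup>2" for x y :: real
      proof -
        have "(x + y)\<^sup>2 \<le> 2 * x\<^sup>2 + 2 * y\<^sup>2"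
          using sum_squares_bound[of x y] by (simp add: power2_sum)
        then have "ennreal ((x + y)\<^sup>2) \<le> ennreal (2 * x\<^sup>2 + 2 * y\<^sup>2)"
          by (rule ennreal_leI)
        then show ?thesis
          by (simp add: ennreal_power ennreal_plus ennreal_mult)
      qed
      let ?w = "\<lambda>m. \<integral>\<^sup>+ y. (ennreal \<bar>W i g (tuple m y)\<bar>)\<^sup>2 \<partial>power_measure \<sigma> m"
      let ?v = "\<lambda>m. \<integral>\<^sup>+ y. (ennreal \<bar>V g (tuple m y)\<bar>)\<^sup>2 \<partial>power_measure \<sigma> m"
      have "(\<integral>\<^sup>+ y. (ennreal \<bar>W i g (tuple m y) + V g (tuple m y)\<bar>)\<^sup>2 \<partial>power_measure \<sigma> m)
          \<le> 2 * ?w m + 2 * ?v m" for m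
      proof -
        note level_measurable[OF levelwise_measurable_abs[OF measW[OF g]], of m, measurable]
        note level_measurable[OF levelwise_measurable_abs[OF measV[OF g]], of m, measurable]
        have "(\<integral>\<^sup>+ y. (ennreal \<bar>W i g (tuple m y) + V g (tuple m y)\<bar>)\<^sup>2 \<partial>power_measure \<sigma> m)
            \<le> (\<integral>\<^sup>+ y. 2 * (ennreal \<bar>W i g (tuple m y)\<bar>)\<^sup>2 + 2 * (ennreal \<bar>V g (tuple m y)\<bar>)\<^sup>2 \<partial>power_measure \<sigma> m)"
          by (intro nn_integral_mono sq)
        also have "\<dots> = 2 * ?w m + 2 * ?v m"
          by (subst nn_integral_add) (auto simp: nn_integral_cmult)
        finally show ?thesis .
      qed
      then have "sq_norm (\<lambda>ys. ennreal \<bar>W i g ys + V g ys\<bar>) \<le> (\<Sum>m. 2 * ?w m + 2 * ?v m)"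
        unfolding sq_norm_def by (intro suminf_le summableI)
      also have "\<dots> = 2 * suminf ?w + 2 * suminf ?v"
        by (subst suminf_add[symmetric]) (auto intro: summableI)
      also have "\<dots> \<le> 2 * (C * sq_norm (modulus g)) + 2 * (D * sq_norm (modulus g))"
        using bdW[OF g] bdV[OF g] by (intro add_mono mult_left_mono) (simp_all add: sq_norm_def)
      finally show ?thesis
        by (simp add: algebra_simps)
    qed
  qed
  then show ?case
    unfolding eq .
qed

section \<open>Lists at which all integrals converge\<close>

text \<open>
  Quantifying over all words makes the exceptional set independent of the word and of the kernel, and
  stable under the passage to the shorter and longer lists at which the recursion for \<open>word_op\<close>
  evaluates (\<open>good_Cons_tail\<close>, \<open>AE_good_Cons\<close>).
\<close>
definition good :: "('a list \<Rightarrow> real) \<Rightarrow> 'a list \<Rightarrow> bool" where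
  "good g ys \<longleftrightarrow> (\<forall>w. majorants w (modulus g) ys < \<infinity>)"

lemma countable_words: "countable (UNIV :: letter list set)"
proof -
  have "(UNIV :: letter set) = {Cre, Ann, Num}"
    using letter.exhaust by auto
  then have "finite (UNIV :: letter set)"
    by (metis finite.simps)
  then have "countable (lists (UNIV :: letter set))"
    by (intro countable_lists countable_finite)
  then show ?thesis by simp
qed

lemma AE_good:
  assumes g: "g \<in> fock \<sigma>"
  shows "AE y in power_measure \<sigma> m. good g (tuple m y)"
proof -
  let ?H = "\<lambda>w. majorants w (modulus g)"
  have lm: "levelwise_measurable g" and fin: "sq_norm (modulus g) < \<infinity>"
    using g by (simp_all add: mem_fock_iff)
  have "AE y in power_measure \<sigma> m. ?H w (tuple m y) < \<infinity>" for w
  proof -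
    have "sq_norm (?H w) \<le> growth ^ length w * sq_norm (modulus g)"
      by (rule sq_norm_majorants[OF levelwise_measurable_abs[OF lm]])
    also have "\<dots> < \<infinity>"
      using fin growth_finite by (simp add: ennreal_mult_less_top power_less_top_ennreal)
    finally have "(\<integral>\<^sup>+ y. (?H w (tuple m y))\<^sup>2 \<partial>power_measure \<sigma> m) \<noteq> \<infinity>"
      using level_le_sq_norm[where H = "?H w" and m = m] by auto
    moreover note level_measurable[OF majorants_measurable[OF levelwise_measurable_abs[OF lm]], measurable]
    ultimately have "AE y in power_measure \<sigma> m. (?H w (tuple m y))\<^sup>2 \<noteq> \<infinity>"
      by (intro nn_integral_PInf_AE) measurable
    then show ?thesis
      by eventually_elim (simp add: power_eq_top_ennreal less_top)
  qed
  then have "AE y in power_measure \<sigma> m. \<forall>w\<in>UNIV. ?H w (tuple m y) < \<infinity>"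
    using countable_words by (subst AE_ball_countable) auto
  then show ?thesis
    by (simp add: good_def)
qed

text \<open>
  If \<open>y\<close> is outside \<open>K\<close>, the majorant of \<open>Cre\<close> says nothing about the tail; but then every kernel with first
  argument \<open>y\<close> vanishes (\<open>word_op_Cons_outside\<close>), so that this case never matters.
\<close>
lemma good_Cons_tail: "good g (y # ys) \<Longrightarrow> y \<in> K \<Longrightarrow> good g ys"
  unfolding good_def
proof
  fix w assume "\<forall>w. majorants w (modulus g) (y # ys) < \<infinity>" "y \<in> K"
  from this(1)[rule_format, of "Cre # w"] this(2)
  show "majorants w (modulus g) ys < \<infinity>" by simp
qed

lemma Cons_const_measurable: "(\<lambda>t. t # ys) \<in> \<sigma> \<rightarrow>\<^sub>M lists_of (Suc (length ys))"
  by (rule Cons_measurable) (auto intro!: measurable_const)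

lemma majorants_Cons_measurable:
  assumes "levelwise_measurable g"
  shows "(\<lambda>t. majorants w (modulus g) (t # ys)) \<in> borel_measurable \<sigma>"
  by (rule measurable_compose[OF Cons_const_measurable
      levelwise_measurableD[OF majorants_measurable[OF levelwise_measurable_abs[OF assms]]]])

lemma AE_good_Cons:
  assumes g: "levelwise_measurable g" and ys: "good g ys"
  shows "AE t in \<sigma>. t \<in> K \<longrightarrow> good g (t # ys)"
proof -
  let ?H = "\<lambda>w. majorants w (modulus g)"
  have "AE t in \<sigma>. t \<in> K \<longrightarrow> ?H w (t # ys) < \<infinity>" for w
  proof -
    have "?H (Ann # w) ys \<noteq> \<infinity>"
      using ys unfolding good_def by (metis less_irrefl)
    moreover note majorants_Cons_measurable[OF g, measurable]
    ultimately have "AE t in \<sigma>. indicator K t * ?H w (t # ys) \<noteq> \<infinity>"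
      by (intro nn_integral_PInf_AE) simp_all
    then show ?thesis
      by eventually_elim (auto simp: less_top)
  qed
  then have "AE t in \<sigma>. \<forall>w\<in>UNIV. t \<in> K \<longrightarrow> ?H w (t # ys) < \<infinity>"
    using countable_words by (subst AE_ball_countable) auto
  then show ?thesis
    by eventually_elim (simp add: good_def)
qed

lemma kernel_Cons_outside:
  assumes "kernel (Suc n) f" "t \<notin> K" "length ss = n"
  shows "f (t # ss) = 0"
  using kernel_outside[OF assms(1), of "t # ss"] assms(2,3) by simp

lemma word_op_Cons_outside:
  assumes "kernel (Suc (length w)) f" "t \<notin> K"
  shows "word_op \<sigma> lam w (\<lambda>ss. f (t # ss)) g ys = 0"
  by (rule word_op_zero) (rule kernel_Cons_outside[OF assms])

lemma word_op_Cons_bound: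
  assumes f: "kernel (Suc (length w)) f" and g: "levelwise_measurable g"
  obtains B where "0 \<le> B"
    "\<And>t ys. ennreal \<bar>word_op \<sigma> lam w (\<lambda>ss. f (t # ss)) g ys\<bar>
        \<le> ennreal B * (indicator K t * majorants w (modulus g) ys)"
proof (rule kernelE[OF f])
  fix B assume B: "0 \<le> B"
    and le: "\<And>ts. length ts = Suc (length w) \<Longrightarrow> \<bar>f ts\<bar> \<le> B * of_bool (set ts \<subseteq> K)"
  have "ennreal \<bar>word_op \<sigma> lam w (\<lambda>ss. f (t # ss)) g ys\<bar>
        \<le> ennreal B * (indicator K t * majorants w (modulus g) ys)" for t ys
  proof (cases "t \<in> K")
    case True
    have "ennreal \<bar>word_op \<sigma> lam w (\<lambda>ss. f (t # ss)) g ys\<bar>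
        \<le> ennreal B * majorants w (modulus g) ys"
    proof (rule word_op_le_majorants[OF B _ g])
      show "\<bar>f (t # ts)\<bar> \<le> B * of_bool (set ts \<subseteq> K)" if "length ts = length w" for ts
        using le[of "t # ts"] that True by simp
    qed
    then show ?thesis
      using True by simp
  qed (simp add: word_op_Cons_outside[OF f])
  with B that show thesis by blast
qed

lemma integrable_word_op:
  assumes f: "kernel (Suc (length w)) f" and g: "levelwise_measurable g" and ys: "good g ys"
  shows "integrable \<sigma> (\<lambda>t. word_op \<sigma> lam w (\<lambda>ss. f (t # ss)) g (t # ys))"
proof (rule word_op_Cons_bound[OF f g])
  fix B assume B: "0 \<le> B" and le: "\<And>t ys. ennreal \<bar>word_op \<sigma> lam w (\<lambda>ss. f (t # ss)) g ys\<bar>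
        \<le> ennreal B * (indicator K t * majorants w (modulus g) ys)"
  show ?thesis
  proof (rule integrableI_bounded)
    show "(\<lambda>t. word_op \<sigma> lam w (\<lambda>ss. f (t # ss)) g (t # ys)) \<in> borel_measurable \<sigma>"
      by (rule word_op_Cons_measurable[OF kernel_measurable[OF f] g])
    have "(\<integral>\<^sup>+ t. ennreal (norm (word_op \<sigma> lam w (\<lambda>ss. f (t # ss)) g (t # ys))) \<partial>\<sigma>)
        \<le> (\<integral>\<^sup>+ t. ennreal B * (indicator K t * majorants w (modulus g) (t # ys)) \<partial>\<sigma>)"
      by (intro nn_integral_mono) (simp add: le)
    also have "\<dots> = ennreal B * majorants (Ann # w) (modulus g) ys"
      using majorants_Cons_measurable[OF g, of w ys] by (simp add: nn_integral_cmult)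
    also have "\<dots> < \<infinity>"
      using ys[unfolded good_def, rule_format, of "Ann # w"] by (simp add: ennreal_mult_less_top)
    finally show "(\<integral>\<^sup>+ t. ennreal (norm (word_op \<sigma> lam w (\<lambda>ss. f (t # ss)) g (t # ys))) \<partial>\<sigma>) < \<infinity>" .
  qed
qed

lemma word_op_linear:
  assumes "kernel (length w) f" "levelwise_measurable g" "levelwise_measurable h" "good g ys" "good h ys"
  shows "word_op \<sigma> lam w f (\<lambda>y. a * g y + b * h y) ys
       = a * word_op \<sigma> lam w f g ys + b * word_op \<sigma> lam w f h ys"
  using assms
proof (induction w arbitrary: f ys)
  case Nil
  then show ?case by (simp add: word_op_Nil algebra_simps)
next
  case (Cons x w)
  note g = Cons.prems(2) and h = Cons.prems(3)
  have f: "kernel (Suc (length w)) f"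
    using Cons.prems(1) by simp
  have step: "word_op \<sigma> lam w (\<lambda>ss. f (t # ss)) (\<lambda>y. a * g y + b * h y) zs
       = a * word_op \<sigma> lam w (\<lambda>ss. f (t # ss)) g zs + b * word_op \<sigma> lam w (\<lambda>ss. f (t # ss)) h zs"
    if "t \<in> K \<longrightarrow> good g zs \<and> good h zs" for t zs
  proof (cases "t \<in> K")
    case True
    then show ?thesis
      using that by (intro Cons.IH kernel_Cons[OF f] g h) auto
  qed (simp add: word_op_Cons_outside[OF f])
  show ?case
  proof (cases x)
    case Cre
    show ?thesis
    proof (cases ys)
      case (Cons y zs)
      then show ?thesis
        using Cre step[of y zs] good_Cons_tail[of _ y zs] Cons.prems by (simp add: word_op_Cons)
    qed (simp add: Cre word_op_Cons)
  next
    case Ann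
    have gh: "levelwise_measurable (\<lambda>y. a * g y + b * h y)"
      by (rule levelwise_measurable_lincomb[OF g h])
    note fm = kernel_measurable[OF f]
    have "(LINT t|\<sigma>. word_op \<sigma> lam w (\<lambda>ss. f (t # ss)) (\<lambda>y. a * g y + b * h y) (t # ys))
      = (LINT t|\<sigma>. a * word_op \<sigma> lam w (\<lambda>ss. f (t # ss)) g (t # ys)
          + b * word_op \<sigma> lam w (\<lambda>ss. f (t # ss)) h (t # ys))"
    proof (rule integral_cong_AE)
      show "(\<lambda>t. word_op \<sigma> lam w (\<lambda>ss. f (t # ss)) (\<lambda>y. a * g y + b * h y) (t # ys)) \<in> borel_measurable \<sigma>"
        by (rule word_op_Cons_measurable[OF fm gh])
      show "(\<lambda>t. a * word_op \<sigma> lam w (\<lambda>ss. f (t # ss)) g (t # ys)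
          + b * word_op \<sigma> lam w (\<lambda>ss. f (t # ss)) h (t # ys)) \<in> borel_measurable \<sigma>"
        using word_op_Cons_measurable[OF fm g] word_op_Cons_measurable[OF fm h] by simp
      show "AE t in \<sigma>. word_op \<sigma> lam w (\<lambda>ss. f (t # ss)) (\<lambda>y. a * g y + b * h y) (t # ys)
        = a * word_op \<sigma> lam w (\<lambda>ss. f (t # ss)) g (t # ys)
          + b * word_op \<sigma> lam w (\<lambda>ss. f (t # ss)) h (t # ys)"
        using AE_good_Cons[OF g Cons.prems(4)] AE_good_Cons[OF h Cons.prems(5)]
        by eventually_elim (simp add: step)
    qed
    also have "\<dots> = a * (LINT t|\<sigma>. word_op \<sigma> lam w (\<lambda>ss. f (t # ss)) g (t # ys))
          + b * (LINT t|\<sigma>. word_op \<sigma> lam w (\<lambda>ss. f (t # ss)) h (t # ys))"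
      using integrable_word_op[OF f g Cons.prems(4)] integrable_word_op[OF f h Cons.prems(5)] by simp
    finally show ?thesis
      by (simp add: Ann word_op_Cons)
  next
    case Num
    show ?thesis
    proof (cases ys)
      case (Cons y zs)
      then show ?thesis
        using Num step[of y ys] Cons.prems by (simp add: word_op_Cons algebra_simps)
    qed (simp add: Num word_op_Cons)
  qed
qed

lemma fock_op_word_op:
  assumes f: "kernel (length w) f"
  shows "fock_op (word_op \<sigma> lam w f)"
proof (rule kernelE[OF f])
  fix B assume fm: "f \<in> borel_measurable (lists_of (length w))" and B: "0 \<le> B"
    and le: "\<And>ts. length ts = length w \<Longrightarrow> \<bar>f ts\<bar> \<le> B * of_bool (set ts \<subseteq> K)"
  show ?thesis
    unfolding fock_op_def
  proof (intro conjI allI impI ballI exI[of _ "(ennreal B)\<^sup>2 * growth ^ length w"])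
    show "levelwise_measurable (word_op \<sigma> lam w f g)" if "levelwise_measurable g" for g
      by (rule levelwise_measurable_word_op[OF fm that])
    show "(ennreal B)\<^sup>2 * growth ^ length w < \<infinity>"
      using growth_finite by (simp add: ennreal_mult_less_top power_less_top_ennreal)
    show "fock_eq \<sigma> (word_op \<sigma> lam w f (\<lambda>y. a * g y + b * h y))
        (\<lambda>y. a * word_op \<sigma> lam w f g y + b * word_op \<sigma> lam w f h y)"
      if g: "g \<in> fock \<sigma>" and h: "h \<in> fock \<sigma>" for g h a b
      unfolding fock_eq_def
    proof
      fix m
      show "AE y in power_measure \<sigma> m. word_op \<sigma> lam w f (\<lambda>y. a * g y + b * h y) (tuple m y) =
          a * word_op \<sigma> lam w f g (tuple m y) + b * word_op \<sigma> lam w f h (tuple m y)"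
        using AE_good[OF g, of m] AE_good[OF h, of m]
        by eventually_elim (use f g h in \<open>simp add: word_op_linear mem_fock_iff\<close>)
    qed
    show "sq_norm (\<lambda>ys. ennreal \<bar>word_op \<sigma> lam w f g ys\<bar>)
        \<le> (ennreal B)\<^sup>2 * growth ^ length w * sq_norm (modulus g)"
      if g: "levelwise_measurable g" for g
    proof -
      have "sq_norm (\<lambda>ys. ennreal \<bar>word_op \<sigma> lam w f g ys\<bar>)
          \<le> sq_norm (\<lambda>ys. ennreal B * majorants w (modulus g) ys)"
        by (intro sq_norm_mono word_op_le_majorants B le g)
      also have "\<dots> = (ennreal B)\<^sup>2 * sq_norm (majorants w (modulus g))"
        by (rule sq_norm_cmult[OF majorants_measurable[OF levelwise_measurable_abs[OF g]]])
      also have "\<dots> \<le> (ennreal B)\<^sup>2 * (growth ^ length w * sq_norm (modulus g))"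
        by (intro mult_left_mono sq_norm_majorants levelwise_measurable_abs g) simp
      finally show ?thesis
        by (simp add: mult.assoc)
    qed
  qed
qed

text \<open>
  An integral over a parameter of the kernel commutes with the annihilations in the word. This is
  Fubini, one annihilated variable after the other; absolute integrability holds because the two
  variables are confined to \<open>K\<close> and the list is good.
\<close>
lemma word_op_integral:
  assumes "kernel (Suc (length w)) h" "levelwise_measurable g" "good g ys"
  shows "(LINT t|\<sigma>. word_op \<sigma> lam w (\<lambda>ss. h (t # ss)) g ys)
       = word_op \<sigma> lam w (\<lambda>ss. LINT t|\<sigma>. h (t # ss)) g ys"
  using assms
proof (induction w arbitrary: h ys)
  case Nil
  then show ?case by (simp add: word_op_Nil)
next
  case (Cons x w)
  note g = Cons.prems(2)
  have h: "kernel (Suc (Suc (length w))) h"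
    using Cons.prems(1) by simp
  note hm = kernel_measurable[OF h]
  \<comment> \<open>the variable used by the first letter moves in front of the parameter, so that the induction hypothesis applies with it fixed\<close>
  define h' where "h' ts = h (hd (tl ts) # hd ts # tl (tl ts))" for ts
  have h'_Cons: "h' (s # t # ss) = h (t # s # ss)" for s t ss
    by (simp add: h'_def)
  have h': "kernel (Suc (Suc (length w))) h'"
  proof (rule kernelE[OF h])
    fix B assume B: "0 \<le> B"
      and le: "\<And>ts. length ts = Suc (Suc (length w)) \<Longrightarrow> \<bar>h ts\<bar> \<le> B * of_bool (set ts \<subseteq> K)"
    show ?thesis
    proof (rule kernelI[OF _ B])
      show "h' \<in> borel_measurable (lists_of (Suc (Suc (length w))))"
        unfolding h'_def by (rule measurable_compose[OF _ hm]) measurable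
      fix ts :: "'a list" assume "length ts = Suc (Suc (length w))"
      then obtain s t ss where "ts = s # t # ss" "length ss = length w"
        by (auto simp: length_Suc_conv)
      then show "\<bar>h' ts\<bar> \<le> B * of_bool (set ts \<subseteq> K)"
        using le[of "t # s # ss"] by (simp add: h'_Cons conj_left_commute)
    qed
  qed
  have step: "(LINT t|\<sigma>. word_op \<sigma> lam w (\<lambda>ss. h (t # s # ss)) g zs)
      = word_op \<sigma> lam w (\<lambda>ss. LINT t|\<sigma>. h (t # s # ss)) g zs"
    if "s \<in> K \<longrightarrow> good g zs" for s zs
  proof (cases "s \<in> K")
    case True
    have "(LINT t|\<sigma>. word_op \<sigma> lam w (\<lambda>ss. h' (s # t # ss)) g zs)
      = word_op \<sigma> lam w (\<lambda>ss. LINT t|\<sigma>. h' (s # t # ss)) g zs"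
      using that True by (intro Cons.IH kernel_Cons[OF h'] g) auto
    then show ?thesis
      by (simp add: h'_Cons)
  next
    case False
    have "h (t # s # ss) = 0" if "length ss = length w" for t ss
      using kernel_outside[OF h, of "t # s # ss"] False that by simp
    then have "word_op \<sigma> lam w (\<lambda>ss. h (t # s # ss)) g zs = 0" for t
      by (intro word_op_zero) simp
    moreover have "word_op \<sigma> lam w (\<lambda>ss. LINT t|\<sigma>. h (t # s # ss)) g zs = 0"
      using \<open>\<And>t ss. length ss = length w \<Longrightarrow> h (t # s # ss) = 0\<close> by (intro word_op_zero) simp
    ultimately show ?thesis by simp
  qed
  show ?case
  proof (cases x)
    case Cre
    show ?thesis
    proof (cases ys)
      case (Cons y zs)
      then show ?thesis
        using Cre step[of y zs] good_Cons_tail[of g y zs] Cons.prems by (simp add: word_op_Cons)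
    qed (simp add: Cre word_op_Cons)
  next
    case Num
    show ?thesis
    proof (cases ys)
      case (Cons y zs)
      then show ?thesis
        using Num step[of y ys] Cons.prems by (simp add: word_op_Cons)
    qed (simp add: Num word_op_Cons)
  next
    case Ann
    define \<Phi> where "\<Phi> s t = word_op \<sigma> lam w (\<lambda>ss. h (t # s # ss)) g (s # ys)" for s t
    have \<Phi>m: "(\<lambda>(s, t). \<Phi> s t) \<in> borel_measurable (\<sigma> \<Otimes>\<^sub>M \<sigma>)"
    proof -
      have "(\<lambda>p. word_op \<sigma> lam w (\<lambda>ss. h ([snd p, fst p] @ ss)) g (fst p # ys))
          \<in> borel_measurable (\<sigma> \<Otimes>\<^sub>M \<sigma>)"
      proof (rule word_op_measurable[OF _ g])
        show "h \<in> borel_measurable (lists_of (Suc (Suc 0) + length w))"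
          using hm by simp
        show "(\<lambda>p. fst p # ys) \<in> \<sigma> \<Otimes>\<^sub>M \<sigma> \<rightarrow>\<^sub>M lists_of (Suc (length ys))"
          by (rule measurable_compose[OF measurable_fst Cons_const_measurable])
      qed measurable
      then show ?thesis
        by (simp add: \<Phi>_def case_prod_beta)
    qed
    have int: "integrable (\<sigma> \<Otimes>\<^sub>M \<sigma>) (\<lambda>(s, t). \<Phi> s t)"
    proof (rule kernelE[OF h])
      fix B assume B: "0 \<le> B"
        and le: "\<And>ts. length ts = Suc (Suc (length w)) \<Longrightarrow> \<bar>h ts\<bar> \<le> B * of_bool (set ts \<subseteq> K)"
      let ?H = "majorants w (modulus g)"
      have bd: "ennreal \<bar>\<Phi> s t\<bar> \<le> ennreal B * (indicator K s * ?H (s # ys)) * indicator K t" for s t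
      proof (cases "s \<in> K \<and> t \<in> K")
        case True
        have "ennreal \<bar>\<Phi> s t\<bar> \<le> ennreal B * ?H (s # ys)"
          unfolding \<Phi>_def
        proof (rule word_op_le_majorants[OF B _ g])
          show "\<bar>h (t # s # ts)\<bar> \<le> B * of_bool (set ts \<subseteq> K)" if "length ts = length w" for ts
            using le[of "t # s # ts"] that True by simp
        qed
        then show ?thesis using True by simp
      next
        case False
        have "\<Phi> s t = 0"
          unfolding \<Phi>_def
          by (rule word_op_zero, rule kernel_outside[OF h]) (use False in auto)
        then show ?thesis by simp
      qed
      note majorants_Cons_measurable[OF g, of w ys, measurable]
      have "(\<integral>\<^sup>+ p. ennreal (norm (case p of (s, t) \<Rightarrow> \<Phi> s t)) \<partial>(\<sigma> \<Otimes>\<^sub>M \<sigma>))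
          \<le> (\<integral>\<^sup>+ p. ennreal B * (indicator K (fst p) * ?H (fst p # ys)) * indicator K (snd p) \<partial>(\<sigma> \<Otimes>\<^sub>M \<sigma>))"
        by (intro nn_integral_mono) (auto simp: bd split: prod.split)
      also have "\<dots> = (\<integral>\<^sup>+ s. \<integral>\<^sup>+ t. ennreal B * (indicator K s * ?H (s # ys)) * indicator K t \<partial>\<sigma> \<partial>\<sigma>)"
        by (subst nn_integral_fst[symmetric]) simp_all
      also have "\<dots> = ennreal B * majorants (Ann # w) (modulus g) ys * emeasure \<sigma> K"
        by (simp add: nn_integral_cmult nn_integral_multc)
      also have "\<dots> < \<infinity>"
        using Cons.prems(3)[unfolded good_def, rule_format, of "Ann # w"] K_finite
        by (simp add: ennreal_mult_less_top)
      finally show ?thesis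
        using \<Phi>m by (intro integrableI_bounded)
    qed
    have "(LINT t|\<sigma>. word_op \<sigma> lam (x # w) (\<lambda>ss. h (t # ss)) g ys) = (LINT t|\<sigma>. LINT s|\<sigma>. \<Phi> s t)"
      by (simp add: Ann word_op_Cons \<Phi>_def)
    also have "\<dots> = (LINT s|\<sigma>. LINT t|\<sigma>. \<Phi> s t)"
      by (rule pairs.Fubini_integral[OF int])
    also have "\<dots> = (LINT s|\<sigma>. word_op \<sigma> lam w (\<lambda>ss. LINT t|\<sigma>. h (t # s # ss)) g (s # ys))"
    proof (rule integral_cong_AE)
      show "(\<lambda>s. LINT t|\<sigma>. \<Phi> s t) \<in> borel_measurable \<sigma>"
        using \<Phi>m by (rule borel_measurable_lebesgue_integral)
      define k where "k ss = (LINT t|\<sigma>. h (t # ss))" for ss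
      have "k \<in> borel_measurable (lists_of (Suc (length w)))"
        unfolding k_def
        by (rule borel_measurable_lebesgue_integral, unfold case_prod_beta,
            rule measurable_compose[OF _ hm]) measurable
      from word_op_Cons_measurable[OF this g, of ys]
      show "(\<lambda>s. word_op \<sigma> lam w (\<lambda>ss. LINT t|\<sigma>. h (t # s # ss)) g (s # ys)) \<in> borel_measurable \<sigma>"
        by (simp add: k_def)
      show "AE s in \<sigma>. (LINT t|\<sigma>. \<Phi> s t) = word_op \<sigma> lam w (\<lambda>ss. LINT t|\<sigma>. h (t # s # ss)) g (s # ys)"
        using AE_good_Cons[OF g Cons.prems(3)] unfolding \<Phi>_def
        by eventually_elim (rule step)
    qed
    finally show ?thesis
      by (simp add: Ann word_op_Cons)
  qed
qed

end

section \<open>Marked partitions built by adding points on the left\<close>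

text \<open>
  For blocks that do not cross, nesting is already visible in a single point of the inner block that lies
  between two points of the outer one. Unlike minima and maxima, this form is stable under
  shifting and enlarging blocks.
\<close>
lemma nested_iff:
  assumes P: "finite A" "A \<noteq> {}" "finite B" "B \<noteq> {}" "A \<inter> B = {}"
    and nc: "\<And>a b c d. a < b \<Longrightarrow> b < c \<Longrightarrow> c < d \<Longrightarrow> a \<in> B \<Longrightarrow> c \<in> B \<Longrightarrow> b \<in> A \<Longrightarrow> d \<in> A \<Longrightarrow> False"
    "\<And>a b c d. a < b \<Longrightarrow> b < c \<Longrightarrow> c < d \<Longrightarrow> a \<in> A \<Longrightarrow> c \<in> A \<Longrightarrow> b \<in> B \<Longrightarrow> d \<in> B \<Longrightarrow> False"
  shows "Min A < Min B \<and> Max B < Max A \<longleftrightarrow> (\<exists>a\<in>A. \<exists>b\<in>B. \<exists>c\<in>A. a < b \<and> b < (c::nat))"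
proof
  assume "Min A < Min B \<and> Max B < Max A"
  moreover have "Min B \<le> Max B"
    using P by simp
  ultimately show "\<exists>a\<in>A. \<exists>b\<in>B. \<exists>c\<in>A. a < b \<and> b < c"
    using P by (intro bexI[of _ "Min A"] bexI[of _ "Min B"] bexI[of _ "Max A"]) auto
next
  assume "\<exists>a\<in>A. \<exists>b\<in>B. \<exists>c\<in>A. a < b \<and> b < c"
  then obtain a b c where abc: "a \<in> A" "b \<in> B" "c \<in> A" "a < b" "b < c" by blast
  have "a < d" if "d \<in> B" for d
  proof (rule ccontr)
    assume "\<not> a < d"
    moreover have "d \<noteq> a"
      using that abc(1) P(5) by blast
    ultimately have "d < a" by simp
    from nc(1)[OF this abc(4,5) that abc(2,1,3)] show False .
  qed
  then have "Min A < Min B"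
    using P abc(1) by (meson Min_in Min_le order_le_less_trans)
  moreover have "d < c" if "d \<in> B" for d
  proof (rule ccontr)
    assume "\<not> d < c"
    moreover have "d \<noteq> c"
      using that abc(3) P(5) by blast
    ultimately have "c < d" by simp
    from nc(2)[OF abc(4,5) this abc(1,3,2) that] show False .
  qed
  then have "Max B < Max A"
    using P abc(3) by (meson Max_in Max_ge order_less_le_trans)
  ultimately show "Min A < Min B \<and> Max B < Max A" ..
qed

text \<open>
  All conditions are expressed through the points of at most two blocks, so that they transfer one by one
  to shifted and enlarged blocks.
\<close>
lemma mem_G_iff:
  "\<kappa> \<in> G n \<longleftrightarrow>
     (\<forall>A m. (A, m) \<in> \<kappa> \<longrightarrow> A \<noteq> {} \<and> A \<subseteq> {..<n} \<and> (m = 1 \<or> m = -1) \<and> (card A = 1 \<longrightarrow> m = 1)) \<and>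
     (\<forall>i<n. \<exists>A m. (A, m) \<in> \<kappa> \<and> i \<in> A) \<and>
     (\<forall>A m B k i. (A, m) \<in> \<kappa> \<longrightarrow> (B, k) \<in> \<kappa> \<longrightarrow> i \<in> A \<longrightarrow> i \<in> B \<longrightarrow> A = B \<and> m = k) \<and>
     (\<forall>A m B k a b c d. (A, m) \<in> \<kappa> \<longrightarrow> (B, k) \<in> \<kappa> \<longrightarrow> a < b \<longrightarrow> b < c \<longrightarrow> c < d \<longrightarrow>
        a \<in> A \<longrightarrow> c \<in> A \<longrightarrow> b \<in> B \<longrightarrow> d \<in> B \<longrightarrow> A = B) \<and>
     (\<forall>A m B a b c. (A, m) \<in> \<kappa> \<longrightarrow> (B, 1) \<in> \<kappa> \<longrightarrow> a < b \<longrightarrow> b < c \<longrightarrow>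
        a \<in> A \<longrightarrow> c \<in> A \<longrightarrow> b \<in> B \<longrightarrow> A = B)"
  (is "_ \<longleftrightarrow> ?blocks \<and> ?cover \<and> ?unique \<and> ?nc \<and> ?exposed")
proof -
  have NC: "\<kappa> \<in> NC_marked n \<longleftrightarrow> ?blocks \<and> ?cover \<and> ?unique \<and> ?nc"
  proof
    assume k: "\<kappa> \<in> NC_marked n"
    then have inj: "inj_on fst \<kappa>" and part: "partition_on {..<n} (fst ` \<kappa>)"
      and nc: "noncrossing (fst ` \<kappa>)"
      and marks: "\<And>A m. (A, m) \<in> \<kappa> \<Longrightarrow> (m = 1 \<or> m = -1) \<and> (card A = 1 \<longrightarrow> m = 1)"
      by (auto simp: NC_marked_def)
    have U: "\<Union>(fst ` \<kappa>) = {..<n}" and D: "disjoint (fst ` \<kappa>)" and ne: "{} \<notin> fst ` \<kappa>"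
      using part by (auto simp: partition_on_def)
    have blk: "A \<in> fst ` \<kappa>" if "(A, m) \<in> \<kappa>" for A m
      using that by force
    have ?blocks
    proof (intro allI impI conjI)
      fix A m assume Am: "(A, m) \<in> \<kappa>"
      show "A \<noteq> {}" using blk[OF Am] ne by blast
      show "A \<subseteq> {..<n}" using blk[OF Am] U by blast
      show "m = 1 \<or> m = -1" "card A = 1 \<Longrightarrow> m = 1" using marks[OF Am] by blast+
    qed
    moreover have ?cover
    proof (intro allI impI)
      fix i assume "i < n"
      then have "i \<in> \<Union>(fst ` \<kappa>)" using U by blast
      then show "\<exists>A m. (A, m) \<in> \<kappa> \<and> i \<in> A" by force
    qed
    moreover have ?unique
    proof (intro allI impI)
      fix A m B k i assume h: "(A, m) \<in> \<kappa>" "(B, k) \<in> \<kappa>" and i: "i \<in> A" "i \<in> B"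
      have "A \<inter> B \<noteq> {}" using i by blast
      then have AB: "A = B"
        using disjointD[OF D blk[OF h(1)] blk[OF h(2)]] by metis
      then show "A = B \<and> m = k"
        using inj_onD[OF inj _ h] by simp
    qed
    moreover have ?nc
      using nc blk unfolding noncrossing_def by meson
    ultimately show "?blocks \<and> ?cover \<and> ?unique \<and> ?nc" by blast
  next
    assume H: "?blocks \<and> ?cover \<and> ?unique \<and> ?nc"
    note Hb = H[THEN conjunct1, rule_format]
    note Hc = H[THEN conjunct2, THEN conjunct1, rule_format]
    note Hu = H[THEN conjunct2, THEN conjunct2, THEN conjunct1, rule_format]
    note Hn = H[THEN conjunct2, THEN conjunct2, THEN conjunct2, rule_format]
    have "inj_on fst \<kappa>"
    proof (rule inj_onI)
      fix p q assume pq: "p \<in> \<kappa>" "q \<in> \<kappa>" "fst p = fst q"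
      obtain A m where p: "p = (A, m)" by (cases p)
      obtain B k where q: "q = (B, k)" by (cases q)
      have mem: "(A, m) \<in> \<kappa>" "(B, k) \<in> \<kappa>" "A = B"
        using pq p q by simp_all
      obtain i where "i \<in> A"
        using Hb[OF mem(1)] by blast
      then show "p = q"
        using Hu[OF mem(1,2), of i] mem(3) p q by simp
    qed
    moreover have "partition_on {..<n} (fst ` \<kappa>)"
    proof (rule partition_onI)
      show "\<Union>(fst ` \<kappa>) = {..<n}"
      proof (intro equalityI subsetI)
        fix i assume "i \<in> \<Union>(fst ` \<kappa>)"
        then obtain A m where "(A, m) \<in> \<kappa>" "i \<in> A" by auto
        then show "i \<in> {..<n}" using Hb[of A m] by blast
      next
        fix i assume "i \<in> {..<n}"
        then show "i \<in> \<Union>(fst ` \<kappa>)" using Hc[of i] by force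
      qed
      show "disjnt A B" if AB: "A \<in> fst ` \<kappa>" "B \<in> fst ` \<kappa>" "A \<noteq> B" for A B
      proof -
        obtain m k where "(A, m) \<in> \<kappa>" "(B, k) \<in> \<kappa>" using AB(1,2) by auto
        from Hu[OF this] show ?thesis using AB(3) unfolding disjnt_iff by blast
      qed
      show "{} \<notin> fst ` \<kappa>"
        using Hb by force
    qed
    moreover have "noncrossing (fst ` \<kappa>)"
      unfolding noncrossing_def
    proof (intro ballI impI notI, elim exE conjE)
      fix A B i j k l
      assume AB: "A \<in> fst ` \<kappa>" "B \<in> fst ` \<kappa>" "A \<noteq> B"
        and x: "i < j" "j < k" "k < l" "i \<in> A" "k \<in> A" "j \<in> B" "l \<in> B"
      obtain m m' where "(A, m) \<in> \<kappa>" "(B, m') \<in> \<kappa>" using AB(1,2) by auto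
      from Hn[OF this x] AB(3) show False by simp
    qed
    moreover have "\<forall>(A, m)\<in>\<kappa>. m \<in> {-1, 1} \<and> (card A = 1 \<longrightarrow> m = 1)"
      using Hb by fastforce
    ultimately show "\<kappa> \<in> NC_marked n"
      by (simp add: NC_marked_def)
  qed
  have "(\<exists>(A, a)\<in>\<kappa>. \<exists>(B, b)\<in>\<kappa>. Min A < Min B \<and> Max B < Max A \<and> b = 1) \<longleftrightarrow> \<not> ?exposed"
    if H: "?blocks \<and> ?cover \<and> ?unique \<and> ?nc"
  proof -
    note Hb = H[THEN conjunct1, rule_format]
    note Hu = H[THEN conjunct2, THEN conjunct2, THEN conjunct1, rule_format]
    note Hn = H[THEN conjunct2, THEN conjunct2, THEN conjunct2, rule_format]
    have fin: "finite A" "A \<noteq> {}" if "(A, a) \<in> \<kappa>" for A a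
      using Hb[OF that] finite_subset[of A "{..<n}"] by simp_all
    have ex: "Min A < Min B \<and> Max B < Max A \<longleftrightarrow> (\<exists>a\<in>A. \<exists>b\<in>B. \<exists>c\<in>A. a < b \<and> b < c)"
      if AB: "(A, a) \<in> \<kappa>" "(B, b) \<in> \<kappa>" "A \<noteq> B" for A a B b
    proof (rule nested_iff)
      show "finite A" "A \<noteq> {}" "finite B" "B \<noteq> {}"
        using fin[OF AB(1)] fin[OF AB(2)] by simp_all
      show "A \<inter> B = {}"
        using Hu[OF AB(1,2)] AB(3) by blast
      show False if "i < j" "j < k" "k < l" "i \<in> B" "k \<in> B" "j \<in> A" "l \<in> A" for i j k l
        using Hn[OF AB(2,1) that] AB(3) by simp
      show False if "i < j" "j < k" "k < l" "i \<in> A" "k \<in> A" "j \<in> B" "l \<in> B" for i j k l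
        using Hn[OF AB(1,2) that] AB(3) by simp
    qed
    have "\<not> ?exposed \<longleftrightarrow>
       (\<exists>A m B. (A, m) \<in> \<kappa> \<and> (B, 1) \<in> \<kappa> \<and> A \<noteq> B \<and> (\<exists>a\<in>A. \<exists>b\<in>B. \<exists>c\<in>A. a < b \<and> b < c))"
      by blast
    also have "\<dots> \<longleftrightarrow> (\<exists>A m B. (A, m) \<in> \<kappa> \<and> (B, 1) \<in> \<kappa> \<and> A \<noteq> B \<and> Min A < Min B \<and> Max B < Max A)"
      using ex by meson
    also have "\<dots> \<longleftrightarrow> (\<exists>(A, a)\<in>\<kappa>. \<exists>(B, b)\<in>\<kappa>. Min A < Min B \<and> Max B < Max A \<and> b = 1)"
      by fastforce
    finally show ?thesis by simp
  qed
  note exposed = this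
  have G: "\<kappa> \<in> G n \<longleftrightarrow> \<kappa> \<in> NC_marked n \<and>
      \<not> (\<exists>(A, a)\<in>\<kappa>. \<exists>(B, b)\<in>\<kappa>. Min A < Min B \<and> Max B < Max A \<and> b = 1)"
    by (simp add: G_def)
  have logic: "(p \<longleftrightarrow> q \<and> \<not> r) \<Longrightarrow> (q \<longleftrightarrow> a \<and> b \<and> c \<and> d) \<Longrightarrow> (a \<and> b \<and> c \<and> d \<Longrightarrow> (r \<longleftrightarrow> \<not> e)) \<Longrightarrow>
      (p \<longleftrightarrow> a \<and> b \<and> c \<and> d \<and> e)" for p q r a b c d e :: bool
    by blast
  show ?thesis
    by (rule logic[OF G NC exposed])
qed

lemma
  assumes "\<kappa> \<in> G n" "(A, m) \<in> \<kappa>"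
  shows G_block_nonempty: "A \<noteq> {}" and G_block_subset: "A \<subseteq> {..<n}" and G_block_finite: "finite A"
    and G_mark: "m = 1 \<or> m = -1" and G_singleton: "card A = 1 \<Longrightarrow> m = 1"
proof -
  note * = assms(1)[unfolded mem_G_iff, THEN conjunct1, rule_format, OF assms(2)]
  show "A \<noteq> {}" "A \<subseteq> {..<n}" "m = 1 \<or> m = -1" "card A = 1 \<Longrightarrow> m = 1"
    using * by simp_all
  then show "finite A"
    using finite_subset by blast
qed

lemma G_cover:
  assumes "\<kappa> \<in> G n" "i < n"
  obtains A m where "(A, m) \<in> \<kappa>" "i \<in> A"
  using assms(1)[unfolded mem_G_iff, THEN conjunct2, THEN conjunct1, rule_format, OF assms(2)] by blast

lemma G_unique:
  assumes "\<kappa> \<in> G n" "(A, m) \<in> \<kappa>" "(B, k) \<in> \<kappa>" "i \<in> A" "i \<in> B"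
  shows "A = B" "m = k"
  using assms(1)[unfolded mem_G_iff, THEN conjunct2, THEN conjunct2, THEN conjunct1, rule_format, OF assms(2-5)] by simp_all

lemma G_noncrossing:
  assumes "\<kappa> \<in> G n" "(A, m) \<in> \<kappa>" "(B, k) \<in> \<kappa>" "a < b" "b < c" "c < d" "a \<in> A" "c \<in> A" "b \<in> B" "d \<in> B"
  shows "A = B"
  using assms(1)[unfolded mem_G_iff, THEN conjunct2, THEN conjunct2, THEN conjunct2, THEN conjunct1, rule_format, OF assms(2-10)] .

lemma G_exposed:
  assumes "\<kappa> \<in> G n" "(A, m) \<in> \<kappa>" "(B, 1) \<in> \<kappa>" "a < b" "b < c" "a \<in> A" "c \<in> A" "b \<in> B"
  shows "A = B"
  using assms(1)[unfolded mem_G_iff, THEN conjunct2, THEN conjunct2, THEN conjunct2, THEN conjunct2, rule_format, OF assms(2-8)] .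

lemma G_same_mark: "\<kappa> \<in> G n \<Longrightarrow> (A, m) \<in> \<kappa> \<Longrightarrow> (A, k) \<in> \<kappa> \<Longrightarrow> m = k"
  using G_block_nonempty G_unique(2) by blast

lemma finite_G: "finite (G n)"
proof (rule finite_subset)
  show "G n \<subseteq> Pow (Pow {..<n} \<times> {-1, 1})"
    unfolding mem_G_iff[abs_def] by (auto simp: mem_G_iff subset_iff)
qed simp

lemma G_0: "G 0 = {{}}"
proof
  have False if "\<kappa> \<in> G 0" "(A, m) \<in> \<kappa>" for \<kappa> A m
    using G_block_nonempty[OF that] G_block_subset[OF that] by simp
  then show "G 0 \<subseteq> {{}}"
    by fastforce
  show "{{}} \<subseteq> G 0"
    by (simp add: mem_G_iff)
qed

lemma finite_member_G: "\<kappa> \<in> G n \<Longrightarrow> finite \<kappa>"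
  by (rule finite_subset[of _ "Pow {..<n} \<times> {-1, 1}"]) (auto simp: mem_G_iff)

lemma finite_pos_blocks: "\<kappa> \<in> G n \<Longrightarrow> finite (pos_blocks \<kappa>)"
  by (rule finite_subset[of _ "fst ` \<kappa>"]) (force simp: pos_blocks_def finite_member_G)+

lemma finite_neg_blocks: "\<kappa> \<in> G n \<Longrightarrow> finite (neg_blocks \<kappa>)"
  by (rule finite_subset[of _ "fst ` \<kappa>"]) (force simp: neg_blocks_def finite_member_G)+

text \<open>
  Meaningful only if there is a \<open>+1\<close> block.
\<close>
definition first_block :: "(nat set \<times> int) set \<Rightarrow> nat set" where
  "first_block \<kappa> = (THE A. A \<in> pos_blocks \<kappa> \<and> (\<forall>B\<in>pos_blocks \<kappa>. Min A \<le> Min B))"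

lemma Min_inj:
  assumes "\<kappa> \<in> G n" "(A, m) \<in> \<kappa>" "(B, k) \<in> \<kappa>" "Min A = Min B"
  shows "A = B"
proof (rule G_unique(1)[OF assms(1-3)])
  show "Min A \<in> A"
    using G_block_finite[OF assms(1,2)] G_block_nonempty[OF assms(1,2)] by simp
  show "Min A \<in> B"
    using G_block_finite[OF assms(1,3)] G_block_nonempty[OF assms(1,3)] assms(4) by simp
qed

lemma first_block_eqI:
  assumes G: "\<kappa> \<in> G n" and A: "A \<in> pos_blocks \<kappa>" and le: "\<And>B. B \<in> pos_blocks \<kappa> \<Longrightarrow> Min A \<le> Min B"
  shows "first_block \<kappa> = A"
  unfolding first_block_def
proof (rule the_equality)
  show "A \<in> pos_blocks \<kappa> \<and> (\<forall>B\<in>pos_blocks \<kappa>. Min A \<le> Min B)"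
    using A le by blast
  fix B assume "B \<in> pos_blocks \<kappa> \<and> (\<forall>C\<in>pos_blocks \<kappa>. Min B \<le> Min C)"
  then have B: "B \<in> pos_blocks \<kappa>" "Min B \<le> Min A"
    using A by auto
  then have "Min B = Min A"
    using le by (simp add: le_antisym)
  then show "B = A"
    using Min_inj[OF G] A B(1) by (auto simp: pos_blocks_def)
qed

lemma
  assumes G: "\<kappa> \<in> G n" and ne: "pos_blocks \<kappa> \<noteq> {}"
  shows first_block_pos: "(first_block \<kappa>, 1) \<in> \<kappa>"
    and first_block_least: "(B, 1) \<in> \<kappa> \<Longrightarrow> Min (first_block \<kappa>) \<le> Min B"
proof -
  define A where "A = arg_min_on Min (pos_blocks \<kappa>)"
  have A: "A \<in> pos_blocks \<kappa>" "\<And>B. B \<in> pos_blocks \<kappa> \<Longrightarrow> Min A \<le> Min B"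
    using arg_min_if_finite[OF finite_pos_blocks[OF G] ne, of Min]
    unfolding A_def by (auto simp: not_less)
  have "first_block \<kappa> = A"
    using A by (rule first_block_eqI[OF G])
  with A show "(first_block \<kappa>, 1) \<in> \<kappa>" "(B, 1) \<in> \<kappa> \<Longrightarrow> Min (first_block \<kappa>) \<le> Min B"
    by (auto simp: pos_blocks_def)
qed

text \<open>
  A letter that is prepended without contraction leaves its argument free, whence the mark \<open>+1\<close>.
\<close>
definition new_block :: "(nat set \<times> int) set \<Rightarrow> (nat set \<times> int) set" where
  "new_block \<kappa> = insert ({0}, 1) ((\<lambda>(A, k). (Suc ` A, k)) ` \<kappa>)"

text \<open>
  A letter that contracts with the first letter of a Wick ordered word acts on the variable of the first \<open>+1\<close>
  block. The mark is \<open>m = 1\<close> if one of the two letters survives and \<open>m = -1\<close> if none does.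
\<close>
definition join_block :: "int \<Rightarrow> (nat set \<times> int) set \<Rightarrow> (nat set \<times> int) set" where
  "join_block m \<kappa> = insert (insert 0 (Suc ` first_block \<kappa>), m)
     ((\<lambda>(A, k). (Suc ` A, k)) ` {(A, k) \<in> \<kappa>. A \<noteq> first_block \<kappa>})"

lemma mem_new_block:
  "(X, k) \<in> new_block \<kappa> \<longleftrightarrow> X = {0} \<and> k = 1 \<or> (\<exists>A. X = Suc ` A \<and> (A, k) \<in> \<kappa>)"
  by (auto simp: new_block_def)

lemma mem_join_block:
  "(X, k) \<in> join_block m \<kappa> \<longleftrightarrow> X = insert 0 (Suc ` first_block \<kappa>) \<and> k = m \<or>
     (\<exists>A. X = Suc ` A \<and> (A, k) \<in> \<kappa> \<and> A \<noteq> first_block \<kappa>)"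
  by (auto simp: join_block_def)

lemma Suc_image_eq_iff: "Suc ` A = Suc ` B \<longleftrightarrow> A = B"
  by (simp add: inj_image_eq_iff)

lemma Suc_vimage_image: "0 \<notin> A \<Longrightarrow> Suc ` (Suc -` A) = A"
  by (auto simp: image_iff) (metis not0_implies_Suc)

lemma insert_0_Suc_eq_iff: "insert 0 (Suc ` A) = insert 0 (Suc ` B) \<longleftrightarrow> A = B"
  by (metis Diff_insert_absorb Suc_image_eq_iff imageE nat.distinct(1))

lemma insert_0_neq_Suc: "insert 0 X \<noteq> Suc ` A" "Suc ` A \<noteq> insert 0 X"
  by auto

lemma mem_new_block_Suc: "(Suc ` A, k) \<in> new_block \<kappa> \<longleftrightarrow> (A, k) \<in> \<kappa>"
  by (auto simp: mem_new_block Suc_image_eq_iff insert_0_neq_Suc)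

lemma mem_join_block_Suc: "(Suc ` A, k) \<in> join_block m \<kappa> \<longleftrightarrow> (A, k) \<in> \<kappa> \<and> A \<noteq> first_block \<kappa>"
  by (auto simp: mem_join_block Suc_image_eq_iff insert_0_neq_Suc)

lemma shifted_unique:
  assumes "\<kappa> \<in> G n" "(A, m) \<in> \<kappa>" "(B, k) \<in> \<kappa>" "i \<in> Suc ` A" "i \<in> Suc ` B"
  shows "A = B \<and> m = k"
  using G_unique[OF assms(1-3)] assms(4,5) by auto

lemma shifted_noncrossing:
  assumes "\<kappa> \<in> G n" "(A, m) \<in> \<kappa>" "(B, k) \<in> \<kappa>" "a < b" "b < c" "c < d"
    "a \<in> Suc ` A" "c \<in> Suc ` A" "b \<in> Suc ` B" "d \<in> Suc ` B"
  shows "A = B"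
  using G_noncrossing[OF assms(1-3)] assms(4-) by auto

lemma shifted_exposed:
  assumes "\<kappa> \<in> G n" "(A, m) \<in> \<kappa>" "(B, 1) \<in> \<kappa>" "a < b" "b < c"
    "a \<in> Suc ` A" "c \<in> Suc ` A" "b \<in> Suc ` B"
  shows "A = B"
  using G_exposed[OF assms(1-3)] assms(4-) by auto

lemma shifted_block:
  assumes "\<kappa> \<in> G n" "(A, k) \<in> \<kappa>"
  shows "Suc ` A \<noteq> {} \<and> Suc ` A \<subseteq> {..<Suc n} \<and> (k = 1 \<or> k = -1) \<and> (card (Suc ` A) = 1 \<longrightarrow> k = 1)"
  using G_block_nonempty[OF assms] G_block_subset[OF assms] G_mark[OF assms] G_singleton[OF assms]
  by (auto simp: card_image)

lemma new_block_in_G: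
  assumes "\<kappa> \<in> G n"
  shows "new_block \<kappa> \<in> G (Suc n)"
  unfolding mem_G_iff
proof (intro conjI allI impI)
  fix A m assume "(A, m) \<in> new_block \<kappa>"
  then consider "A = {0}" "m = 1" | A' where "A = Suc ` A'" "(A', m) \<in> \<kappa>"
    unfolding mem_new_block by blast
  then have "A \<noteq> {} \<and> A \<subseteq> {..<Suc n} \<and> (m = 1 \<or> m = -1) \<and> (card A = 1 \<longrightarrow> m = 1)"
  proof cases
    case 2
    then show ?thesis using shifted_block[OF assms 2(2)] by simp
  qed simp
  then show "A \<noteq> {}" "A \<subseteq> {..<Suc n}" "m = 1 \<or> m = -1" "card A = 1 \<Longrightarrow> m = 1"
    by blast+
next
  fix i assume "i < Suc n"
  then show "\<exists>A m. (A, m) \<in> new_block \<kappa> \<and> i \<in> A"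
  proof (cases i)
    case (Suc j)
    then obtain A m where "(A, m) \<in> \<kappa>" "j \<in> A"
      using G_cover[OF assms, of j] \<open>i < Suc n\<close> by auto
    then show ?thesis
      using Suc by (intro exI[of _ "Suc ` A"] exI[of _ m]) (simp add: mem_new_block_Suc)
  qed (auto simp: mem_new_block)
next
  fix A m B k i assume AB: "(A, m) \<in> new_block \<kappa>" "(B, k) \<in> new_block \<kappa>" and i: "i \<in> A" "i \<in> B"
  have "A = B \<and> m = k"
    using AB unfolding mem_new_block
  proof (elim disjE exE conjE)
    fix A' B' assume "A = Suc ` A'" "(A', m) \<in> \<kappa>" "B = Suc ` B'" "(B', k) \<in> \<kappa>"
    then show ?thesis
      using shifted_unique[OF assms, of A' m B' k i] i by simp
  qed (use i in auto)
  then show "A = B" "m = k" by simp_all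
next
  fix A m B k a b c d
  assume AB: "(A, m) \<in> new_block \<kappa>" "(B, k) \<in> new_block \<kappa>"
    and x: "a < b" "b < c" "c < d" "a \<in> A" "c \<in> A" "b \<in> B" "d \<in> B"
  show "A = B"
    using AB unfolding mem_new_block
  proof (elim disjE exE conjE)
    fix A' B' assume "A = Suc ` A'" "(A', m) \<in> \<kappa>" "B = Suc ` B'" "(B', k) \<in> \<kappa>"
    then show ?thesis
      using shifted_noncrossing[OF assms, of A' m B' k a b c d] x by simp
  qed (use x in auto)
next
  fix A m B a b c
  assume AB: "(A, m) \<in> new_block \<kappa>" "(B, 1) \<in> new_block \<kappa>"
    and x: "a < b" "b < c" "a \<in> A" "c \<in> A" "b \<in> B"
  show "A = B"
    using AB unfolding mem_new_block
  proof (elim disjE exE conjE)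
    fix A' B' assume "A = Suc ` A'" "(A', m) \<in> \<kappa>" "B = Suc ` B'" "(B', 1) \<in> \<kappa>"
    then show ?thesis
      using shifted_exposed[OF assms, of A' m B' a b c] x by simp
  qed (use x in auto)
qed

text \<open>
  The interval from 0 to a point \<open>x\<close> of the first \<open>+1\<close> block \<open>F\<close> is crossed by no block, as such a block would have
  \<open>F\<close> nested in it. It covers no \<open>+1\<close> block either, as that block would begin before \<open>x\<close>; it begins after
  the minimum of \<open>F\<close>, so that it would be nested in \<open>F\<close> already.
\<close>
lemma join_block_in_G:
  assumes G: "\<kappa> \<in> G n" and ne: "pos_blocks \<kappa> \<noteq> {}" and m: "m = 1 \<or> m = -1"
  shows "join_block m \<kappa> \<in> G (Suc n)"
proof -
  let ?F = "first_block \<kappa>"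
  note F = first_block_pos[OF G ne]
  have Ffin: "finite ?F" "?F \<noteq> {}" "?F \<subseteq> {..<n}"
    using G_block_finite[OF G F] G_block_nonempty[OF G F] G_block_subset[OF G F] .
  have unnested: False if "(B, 1) \<in> \<kappa>" "B \<noteq> ?F" "b \<in> B" "x \<in> ?F" "b < x" for B b x
  proof -
    have "Min ?F \<noteq> Min B"
      using Min_inj[OF G F that(1)] that(2) by metis
    then have "Min ?F < Min B"
      using first_block_least[OF G ne that(1)] by simp
    also have "Min B \<le> b"
      using G_block_finite[OF G that(1)] that(3) by simp
    finally show False
      using G_exposed[OF G F that(1), of "Min ?F" b x] Ffin that by auto
  qed
  have cover: "\<exists>A k. (A, k) \<in> join_block m \<kappa> \<and> i \<in> A" if i: "i < Suc n" for i
  proof (cases i)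
    case (Suc j)
    then obtain A k where A: "(A, k) \<in> \<kappa>" "j \<in> A"
      using G_cover[OF G, of j] i by auto
    show ?thesis
    proof (cases "A = ?F")
      case True
      then show ?thesis
        using A Suc by (intro exI[of _ "insert 0 (Suc ` ?F)"] exI[of _ m]) (simp add: mem_join_block)
    next
      case False
      then show ?thesis
        using A Suc by (intro exI[of _ "Suc ` A"] exI[of _ k]) (simp add: mem_join_block_Suc)
    qed
  qed (auto simp: mem_join_block)
  have blocks: "A \<noteq> {} \<and> A \<subseteq> {..<Suc n} \<and> (k = 1 \<or> k = -1) \<and> (card A = 1 \<longrightarrow> k = 1)"
    if "(A, k) \<in> join_block m \<kappa>" for A k
    using that unfolding mem_join_block
  proof (elim disjE exE conjE)
    assume A: "A = insert 0 (Suc ` ?F)" "k = m"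
    have "card A = Suc (card ?F)" "card ?F \<noteq> 0"
      using Ffin by (auto simp: A(1) card_insert_if card_image)
    then show ?thesis
      using A m Ffin(3) by auto
  next
    fix A' assume "A = Suc ` A'" "(A', k) \<in> \<kappa>"
    then show ?thesis
      using shifted_block[OF G, of A' k] by simp
  qed
  have unique: "A = B \<and> j = k"
    if "(A, j) \<in> join_block m \<kappa>" "(B, k) \<in> join_block m \<kappa>" "i \<in> A" "i \<in> B" for A j B k i
    using that(1,2) unfolding mem_join_block
  proof (elim disjE exE conjE)
    fix B' assume "A = insert 0 (Suc ` ?F)" "B = Suc ` B'" "(B', k) \<in> \<kappa>" "B' \<noteq> ?F"
    then show ?thesis
      using shifted_unique[OF G F, of B' k i] that(3,4) by auto
  next
    fix A' assume "B = insert 0 (Suc ` ?F)" "A = Suc ` A'" "(A', j) \<in> \<kappa>" "A' \<noteq> ?F"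
    then show ?thesis
      using shifted_unique[OF G _ F, of A' j i] that(3,4) by auto
  next
    fix A' B' assume "A = Suc ` A'" "(A', j) \<in> \<kappa>" "B = Suc ` B'" "(B', k) \<in> \<kappa>"
    then show ?thesis
      using shifted_unique[OF G, of A' j B' k i] that(3,4) by simp
  qed simp
  have nc: "A = B" if h: "(A, j) \<in> join_block m \<kappa>" "(B, k) \<in> join_block m \<kappa>"
      "a < b" "b < c" "c < d" "a \<in> A" "c \<in> A" "b \<in> B" "d \<in> B" for A j B k a b c d
    using h(1,2) unfolding mem_join_block
  proof (elim disjE exE conjE)
    fix B' assume A: "A = insert 0 (Suc ` ?F)" and B: "B = Suc ` B'" "(B', k) \<in> \<kappa>" "B' \<noteq> ?F"
    obtain b' c' d' where "b = Suc b'" "c = Suc c'" "d = Suc d'" "b' \<in> B'" "c' \<in> ?F" "d' \<in> B'"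
      using h(3-9) A B(1) by auto
    then show ?thesis
      using G_exposed[OF G B(2) F, of b' c' d'] h(4,5) B(3) by simp
  next
    fix A' assume B: "B = insert 0 (Suc ` ?F)" and A: "A = Suc ` A'" "(A', j) \<in> \<kappa>" "A' \<noteq> ?F"
    obtain a' b' c' d' where "a = Suc a'" "b = Suc b'" "c = Suc c'" "d = Suc d'"
        "a' \<in> A'" "b' \<in> ?F" "c' \<in> A'" "d' \<in> ?F"
      using h(3-9) A(1) B by auto
    then show ?thesis
      using G_noncrossing[OF G A(2) F, of a' b' c' d'] h(3-5) A(3) by simp
  next
    fix A' B' assume "A = Suc ` A'" "(A', j) \<in> \<kappa>" "B = Suc ` B'" "(B', k) \<in> \<kappa>"
    then show ?thesis
      using shifted_noncrossing[OF G, of A' j B' k a b c d] h(3-9) by simp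
  qed simp
  have exposed: "A = B" if h: "(A, j) \<in> join_block m \<kappa>" "(B, 1) \<in> join_block m \<kappa>"
      "a < b" "b < c" "a \<in> A" "c \<in> A" "b \<in> B" for A j B a b c
    using h(1,2) unfolding mem_join_block
  proof (elim disjE exE conjE)
    fix B' assume A: "A = insert 0 (Suc ` ?F)" and B: "B = Suc ` B'" "(B', 1) \<in> \<kappa>" "B' \<noteq> ?F"
    obtain b' c' where "b = Suc b'" "c = Suc c'" "b' \<in> B'" "c' \<in> ?F"
      using h(3-7) A B(1) by auto
    then show ?thesis
      using unnested[OF B(2,3), of b' c'] h(4) by simp
  next
    fix A' assume B: "B = insert 0 (Suc ` ?F)" and A: "A = Suc ` A'" "(A', j) \<in> \<kappa>" "A' \<noteq> ?F"
    obtain a' b' c' where "a = Suc a'" "b = Suc b'" "c = Suc c'" "a' \<in> A'" "b' \<in> ?F" "c' \<in> A'"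
      using h(3-7) A(1) B by auto
    then show ?thesis
      using G_exposed[OF G A(2) F, of a' b' c'] h(3,4) A(3) by simp
  next
    fix A' B' assume "A = Suc ` A'" "(A', j) \<in> \<kappa>" "B = Suc ` B'" "(B', 1) \<in> \<kappa>"
    then show ?thesis
      using shifted_exposed[OF G, of A' j B' a b c] h(3-7) by simp
  qed simp
  show ?thesis
    unfolding mem_G_iff using blocks cover unique nc exposed by blast
qed

text \<open>
  Remove the point 0. If its block \<open>Z\<close> was larger than \<open>{0}\<close>, what remains of \<open>Z\<close> gets the mark \<open>+1\<close>. It is not
  nested, because a block around it would cross \<open>Z\<close>, and it comes first, because a \<open>+1\<close> block
  before it would be nested in \<open>Z\<close>.
\<close>
lemma G_Suc_cases:
  assumes G: "\<kappa>' \<in> G (Suc n)"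
  shows "\<exists>\<kappa>\<in>G n. \<kappa>' = new_block \<kappa> \<or> pos_blocks \<kappa> \<noteq> {} \<and> (\<kappa>' = join_block 1 \<kappa> \<or> \<kappa>' = join_block (-1) \<kappa>)"
proof -
  obtain Z m where Z: "(Z, m) \<in> \<kappa>'" "0 \<in> Z"
    using G_cover[OF G, of 0] by auto
  have other: "0 \<notin> A" if "(A, k) \<in> \<kappa>'" "(A, k) \<noteq> (Z, m)" for A k
    using G_unique[OF G that(1) Z(1) _ Z(2)] that(2) by auto
  define \<rho> where "\<rho> = {(A, k). (Suc ` A, k) \<in> \<kappa>'}"
  have \<rho>: "(A, k) \<in> \<rho> \<longleftrightarrow> (Suc ` A, k) \<in> \<kappa>'" for A k
    by (simp add: \<rho>_def)
  have \<rho>_block: "A \<noteq> {} \<and> A \<subseteq> {..<n} \<and> (k = 1 \<or> k = -1) \<and> (card A = 1 \<longrightarrow> k = 1)"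
    if "(A, k) \<in> \<rho>" for A k
    using G_block_nonempty[OF G that[unfolded \<rho>]] G_block_subset[OF G that[unfolded \<rho>]]
      G_mark[OF G that[unfolded \<rho>]] G_singleton[OF G that[unfolded \<rho>]]
    by (auto simp: card_image)
  have \<rho>_unique: "A = B \<and> j = k" if "(A, j) \<in> \<rho>" "(B, k) \<in> \<rho>" "i \<in> A" "i \<in> B" for A j B k i
    using G_unique[OF G that(1,2)[unfolded \<rho>], of "Suc i"] that(3,4) by (auto simp: Suc_image_eq_iff)
  have \<rho>_nc: "A = B" if "(A, j) \<in> \<rho>" "(B, k) \<in> \<rho>" "a < b" "b < c" "c < d" "a \<in> A" "c \<in> A" "b \<in> B" "d \<in> B"
    for A j B k a b c d
    using G_noncrossing[OF G that(1,2)[unfolded \<rho>], of "Suc a" "Suc b" "Suc c" "Suc d"] that(3-9)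
    by (auto simp: Suc_image_eq_iff)
  have \<rho>_exposed: "A = B" if "(A, j) \<in> \<rho>" "(B, 1) \<in> \<rho>" "a < b" "b < c" "a \<in> A" "c \<in> A" "b \<in> B"
    for A j B a b c
    using G_exposed[OF G that(1,2)[unfolded \<rho>], of "Suc a" "Suc b" "Suc c"] that(3-7)
    by (auto simp: Suc_image_eq_iff)
  have \<kappa>'_eq: "(X, k) \<in> \<kappa>' \<longleftrightarrow> X = Z \<and> k = m \<or> (\<exists>A. X = Suc ` A \<and> (A, k) \<in> \<rho>)" for X k
  proof
    assume X: "(X, k) \<in> \<kappa>'"
    show "X = Z \<and> k = m \<or> (\<exists>A. X = Suc ` A \<and> (A, k) \<in> \<rho>)"
    proof (cases "(X, k) = (Z, m)")
      case False
      then have "Suc ` (Suc -` X) = X"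
        using other[OF X] by (intro Suc_vimage_image) blast
      then show ?thesis
        using X by (intro disjI2 exI[of _ "Suc -` X"]) (simp only: \<rho>)
    qed simp
  qed (use Z(1) in \<open>auto simp: \<rho>\<close>)
  show ?thesis
  proof (cases "Z = {0}")
    case True
    have m: "m = 1"
      using G_singleton[OF G Z(1)] True by simp
    have "\<kappa>' = new_block \<rho>"
      by (auto simp: set_eq_iff \<kappa>'_eq mem_new_block True m)
    moreover have "\<rho> \<in> G n"
    proof -
      have "\<exists>A k. (A, k) \<in> \<rho> \<and> i \<in> A" if i: "i < n" for i
      proof -
        obtain X k where "(X, k) \<in> \<kappa>'" "Suc i \<in> X"
          using G_cover[OF G, of "Suc i"] i by auto
        then show ?thesis
          unfolding \<kappa>'_eq using True by auto
      qed
      then show ?thesis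
        unfolding mem_G_iff using \<rho>_block \<rho>_unique \<rho>_nc \<rho>_exposed by blast
    qed
    ultimately show ?thesis by blast
  next
    case False
    define F where "F = Suc -` Z"
    have ZF: "Z = insert 0 (Suc ` F)"
      using Z(2) Suc_vimage_image[of "Z - {0}"] unfolding F_def
      by (auto simp: image_iff)
    have F: "F \<noteq> {}" "F \<subseteq> {..<n}"
      using False ZF G_block_subset[OF G Z(1)] by auto
    have disj: False if "(A, k) \<in> \<rho>" "i \<in> A" "i \<in> F" for A k i
    proof -
      have "Suc ` A = Z"
        using G_unique(1)[OF G that(1)[unfolded \<rho>] Z(1), of "Suc i"] that(2,3) by (simp add: ZF)
      then show False
        using ZF by auto
    qed
    define \<kappa> where "\<kappa> = insert (F, 1) \<rho>"
    have \<kappa>: "(A, k) \<in> \<kappa> \<longleftrightarrow> A = F \<and> k = 1 \<or> (A, k) \<in> \<rho>" for A k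
      by (auto simp: \<kappa>_def)
    have blocks: "A \<noteq> {} \<and> A \<subseteq> {..<n} \<and> (k = 1 \<or> k = -1) \<and> (card A = 1 \<longrightarrow> k = 1)"
      if "(A, k) \<in> \<kappa>" for A k
      using that F \<rho>_block unfolding \<kappa> by blast
    have cover: "\<exists>A k. (A, k) \<in> \<kappa> \<and> i \<in> A" if i: "i < n" for i
    proof -
      obtain X k where "(X, k) \<in> \<kappa>'" "Suc i \<in> X"
        using G_cover[OF G, of "Suc i"] i by auto
      then show ?thesis
        unfolding \<kappa>'_eq \<kappa> ZF by auto
    qed
    have unique: "A = B \<and> j = k" if "(A, j) \<in> \<kappa>" "(B, k) \<in> \<kappa>" "i \<in> A" "i \<in> B" for A j B k i
      using that \<rho>_unique disj unfolding \<kappa> by blast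
    have nc: "A = B" if h: "(A, j) \<in> \<kappa>" "(B, k) \<in> \<kappa>"
        "a < b" "b < c" "c < d" "a \<in> A" "c \<in> A" "b \<in> B" "d \<in> B" for A j B k a b c d
    proof (rule ccontr)
      assume "A \<noteq> B"
      then consider "A = F" "(B, k) \<in> \<rho>" | "B = F" "(A, j) \<in> \<rho>" | "(A, j) \<in> \<rho>" "(B, k) \<in> \<rho>"
        using h(1,2) unfolding \<kappa> by blast
      then show False
      proof cases
        case 1
        have "Suc ` B = Z"
          using G_noncrossing[OF G Z(1) 1(2)[unfolded \<rho>], of "Suc a" "Suc b" "Suc c" "Suc d"] h 1(1)
          by (simp add: ZF)
        then show False using Z(2) by auto
      next
        case 2
        have "Suc ` A = Z"
          using G_noncrossing[OF G 2(2)[unfolded \<rho>] Z(1), of "Suc a" "Suc b" "Suc c" "Suc d"] h 2(1)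
          by (simp add: ZF)
        then show False using Z(2) by auto
      next
        case 3
        then show False using \<rho>_nc[OF 3 h(3-9)] \<open>A \<noteq> B\<close> by blast
      qed
    qed
    have before: False if "(B, 1) \<in> \<rho>" "b \<in> B" "x \<in> F" "b < x" for B b x
    proof -
      have "Z = Suc ` B"
        using G_exposed[OF G Z(1) that(1)[unfolded \<rho>], of 0 "Suc b" "Suc x"] that(2-4) Z(2)
        by (simp add: ZF)
      then show False using Z(2) by auto
    qed
    have exposed: "A = B" if h: "(A, j) \<in> \<kappa>" "(B, 1) \<in> \<kappa>"
        "a < b" "b < c" "a \<in> A" "c \<in> A" "b \<in> B" for A j B a b c
    proof (rule ccontr)
      assume "A \<noteq> B"
      then consider "A = F" "(B, 1) \<in> \<rho>" | "B = F" "(A, j) \<in> \<rho>" | "(A, j) \<in> \<rho>" "(B, 1) \<in> \<rho>"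
        using h(1,2) unfolding \<kappa> by blast
      then show False
      proof cases
        case 1
        then show False using before[OF 1(2), of b c] h by simp
      next
        case 2
        have "Z = Suc ` A"
          using G_noncrossing[OF G Z(1) 2(2)[unfolded \<rho>], of 0 "Suc a" "Suc b" "Suc c"] h 2(1) Z(2)
          by (simp add: ZF)
        then show False using Z(2) by auto
      next
        case 3
        then show False using \<rho>_exposed[OF 3 h(3-7)] \<open>A \<noteq> B\<close> by blast
      qed
    qed
    have \<kappa>G: "\<kappa> \<in> G n"
      unfolding mem_G_iff using blocks cover unique nc exposed by blast
    have F_pos: "F \<in> pos_blocks \<kappa>"
      by (simp add: pos_blocks_def \<kappa>)
    have finF: "finite F"
      using F(2) finite_subset by blast
    have first: "first_block \<kappa> = F"
    proof (rule first_block_eqI[OF \<kappa>G F_pos])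
      fix B assume "B \<in> pos_blocks \<kappa>"
      then consider "B = F" | "(B, 1) \<in> \<rho>"
        by (auto simp: pos_blocks_def \<kappa>)
      then show "Min F \<le> Min B"
      proof cases
        case 2
        then have "(B, 1) \<in> \<kappa>" by (simp add: \<kappa>)
        then have "Min B \<in> B"
          using G_block_finite[OF \<kappa>G] G_block_nonempty[OF \<kappa>G] by simp
        then show ?thesis
          using before[OF 2, of "Min B" "Min F"] finF F(1) by (meson Min_in not_less)
      qed simp
    qed
    have notF: "(A, k) \<in> \<rho> \<Longrightarrow> A \<noteq> F" for A k
      using disj F(1) by blast
    have "(X, k) \<in> \<kappa>' \<longleftrightarrow> (X, k) \<in> join_block m \<kappa>" for X k
      unfolding \<kappa>'_eq mem_join_block first \<kappa> ZF using notF by blast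
    then have "\<kappa>' = join_block m \<kappa>"
      by (simp add: set_eq_iff split_paired_all)
    then show ?thesis
      using \<kappa>G F_pos G_mark[OF G Z(1)] by blast
  qed
qed

lemma inj_new_block: "inj_on new_block X"
proof (rule inj_onI)
  fix \<kappa> \<kappa>' assume "new_block \<kappa> = new_block \<kappa>'"
  then have "(A, k) \<in> \<kappa> \<longleftrightarrow> (A, k) \<in> \<kappa>'" for A k
    by (metis mem_new_block_Suc)
  then show "\<kappa> = \<kappa>'" by auto
qed

lemma inj_join_block: "inj_on (join_block m) {\<kappa> \<in> G n. pos_blocks \<kappa> \<noteq> {}}"
proof (rule inj_onI)
  fix \<kappa> \<kappa>' assume k: "\<kappa> \<in> {\<kappa> \<in> G n. pos_blocks \<kappa> \<noteq> {}}" "\<kappa>' \<in> {\<kappa> \<in> G n. pos_blocks \<kappa> \<noteq> {}}"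
    and eq: "join_block m \<kappa> = join_block m \<kappa>'"
  have "(insert 0 (Suc ` first_block \<kappa>), m) \<in> join_block m \<kappa>'"
    unfolding eq[symmetric] by (simp add: mem_join_block)
  then have F: "first_block \<kappa> = first_block \<kappa>'"
    by (simp add: mem_join_block insert_0_Suc_eq_iff insert_0_neq_Suc)
  have *: "(A, k) \<in> \<kappa> \<longleftrightarrow> (if A = first_block \<kappa> then k = 1 else (Suc ` A, k) \<in> join_block m \<kappa>)"
    if "\<kappa> \<in> {\<kappa> \<in> G n. pos_blocks \<kappa> \<noteq> {}}" for \<kappa> A k
    using that first_block_pos[of \<kappa> n] G_same_mark[of \<kappa> n A k 1] by (auto simp: mem_join_block_Suc)
  have "(A, k) \<in> \<kappa> \<longleftrightarrow> (A, k) \<in> \<kappa>'" for A k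
    unfolding *[OF k(1)] *[OF k(2)] F eq ..
  then show "\<kappa> = \<kappa>'" by auto
qed

lemma sum_G_Suc:
  fixes Q :: "(nat set \<times> int) set \<Rightarrow> real"
  shows "(\<Sum>\<kappa>\<in>G (Suc n). Q \<kappa>) = (\<Sum>\<kappa>\<in>G n. Q (new_block \<kappa>) +
     (if pos_blocks \<kappa> \<noteq> {} then Q (join_block 1 \<kappa>) + Q (join_block (-1) \<kappa>) else 0))"
proof -
  let ?P = "{\<kappa> \<in> G n. pos_blocks \<kappa> \<noteq> {}}"
  have eq: "G (Suc n) = new_block ` G n \<union> (join_block 1 ` ?P \<union> join_block (-1) ` ?P)"
  proof (intro equalityI subsetI)
    fix \<kappa>' assume "\<kappa>' \<in> G (Suc n)"
    then show "\<kappa>' \<in> new_block ` G n \<union> (join_block 1 ` ?P \<union> join_block (-1) ` ?P)"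
      using G_Suc_cases by blast
  next
    fix \<kappa>' assume "\<kappa>' \<in> new_block ` G n \<union> (join_block 1 ` ?P \<union> join_block (-1) ` ?P)"
    then show "\<kappa>' \<in> G (Suc n)"
      by (auto intro: new_block_in_G join_block_in_G)
  qed
  have d1: "join_block 1 \<kappa> \<noteq> join_block (-1) \<kappa>'" for \<kappa> \<kappa>'
  proof
    assume eq: "join_block 1 \<kappa> = join_block (-1) \<kappa>'"
    have "(insert 0 (Suc ` first_block \<kappa>), 1) \<in> join_block (-1) \<kappa>'"
      unfolding eq[symmetric] by (simp add: mem_join_block)
    then show False
      by (simp add: mem_join_block insert_0_neq_Suc)
  qed
  have d2: "new_block \<kappa> \<noteq> join_block m \<kappa>'" if "\<kappa>' \<in> ?P" for \<kappa> \<kappa>' m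
  proof
    assume eq: "new_block \<kappa> = join_block m \<kappa>'"
    have "({0}, 1) \<in> join_block m \<kappa>'"
      unfolding eq[symmetric] by (simp add: mem_new_block)
    then have "first_block \<kappa>' = {}"
      by (auto simp: mem_join_block)
    then show False
      using that first_block_pos[of \<kappa>' n] G_block_nonempty by blast
  qed
  have fin: "finite (G n)" "finite ?P"
    by (simp_all add: finite_G)
  have "(\<Sum>\<kappa>\<in>G (Suc n). Q \<kappa>) = (\<Sum>\<kappa>\<in>new_block ` G n. Q \<kappa>)
      + ((\<Sum>\<kappa>\<in>join_block 1 ` ?P. Q \<kappa>) + (\<Sum>\<kappa>\<in>join_block (-1) ` ?P. Q \<kappa>))"
    unfolding eq using fin d1 d2 by (subst sum.union_disjoint; blast?) (subst sum.union_disjoint; blast?)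
  also have "\<dots> = (\<Sum>\<kappa>\<in>G n. Q (new_block \<kappa>))
      + ((\<Sum>\<kappa>\<in>?P. Q (join_block 1 \<kappa>)) + (\<Sum>\<kappa>\<in>?P. Q (join_block (-1) \<kappa>)))"
    by (simp add: sum.reindex inj_new_block inj_join_block)
  also have "\<dots> = (\<Sum>\<kappa>\<in>G n. Q (new_block \<kappa>)) + (\<Sum>\<kappa>\<in>?P. Q (join_block 1 \<kappa>) + Q (join_block (-1) \<kappa>))"
    by (simp add: sum.distrib)
  also have "\<dots> = (\<Sum>\<kappa>\<in>G n. Q (new_block \<kappa>) +
     (if pos_blocks \<kappa> \<noteq> {} then Q (join_block 1 \<kappa>) + Q (join_block (-1) \<kappa>) else 0))"
    using fin by (simp add: sum.distrib sum.inter_filter[symmetric])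
  finally show ?thesis .
qed

section \<open>Contraction along an enlarged partition\<close>

lemma block_of_eq:
  assumes "\<kappa> \<in> G n" "(A, m) \<in> \<kappa>" "i \<in> A"
  shows "block_of \<kappa> i = A"
  unfolding block_of_def
proof (rule the_equality)
  show "A \<in> fst ` \<kappa> \<and> i \<in> A"
    using assms(2,3) by force
  show "B = A" if "B \<in> fst ` \<kappa> \<and> i \<in> B" for B
    using that G_unique(1)[OF assms(1) _ assms(2) _ assms(3)] by auto
qed

lemma pos_blocks_new: "pos_blocks (new_block \<kappa>) = insert {0} ((`) Suc ` pos_blocks \<kappa>)"
  by (auto simp: pos_blocks_def mem_new_block)

lemma neg_blocks_new: "neg_blocks (new_block \<kappa>) = (`) Suc ` neg_blocks \<kappa>"
  by (auto simp: neg_blocks_def mem_new_block)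

lemma pos_blocks_join_pos:
  "pos_blocks (join_block 1 \<kappa>) =
     insert (insert 0 (Suc ` first_block \<kappa>)) ((`) Suc ` (pos_blocks \<kappa> - {first_block \<kappa>}))"
  by (auto simp: pos_blocks_def mem_join_block)

lemma pos_blocks_join_neg:
  "pos_blocks (join_block (-1) \<kappa>) = (`) Suc ` (pos_blocks \<kappa> - {first_block \<kappa>})"
  by (auto simp: pos_blocks_def mem_join_block)

lemma first_block_not_neg:
  assumes "\<kappa> \<in> G n" "pos_blocks \<kappa> \<noteq> {}"
  shows "first_block \<kappa> \<notin> neg_blocks \<kappa>"
  using G_same_mark[OF assms(1) first_block_pos[OF assms], of "-1"] by (auto simp: neg_blocks_def)

lemma neg_blocks_join_pos:
  assumes "\<kappa> \<in> G n" "pos_blocks \<kappa> \<noteq> {}"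
  shows "neg_blocks (join_block 1 \<kappa>) = (`) Suc ` neg_blocks \<kappa>"
  using first_block_not_neg[OF assms] by (auto simp: neg_blocks_def mem_join_block)

lemma neg_blocks_join_neg:
  assumes "\<kappa> \<in> G n" "pos_blocks \<kappa> \<noteq> {}"
  shows "neg_blocks (join_block (-1) \<kappa>) = insert (insert 0 (Suc ` first_block \<kappa>)) ((`) Suc ` neg_blocks \<kappa>)"
  using first_block_not_neg[OF assms] by (auto simp: neg_blocks_def mem_join_block)

lemma inj_image_Suc: "inj_on ((`) Suc) X"
  by (rule inj_onI) (simp add: Suc_image_eq_iff)

lemma Min_Suc_image:
  assumes "\<kappa> \<in> G n" "(A, m) \<in> \<kappa>"
  shows "Min (Suc ` A) = Suc (Min A)"
  using mono_Min_commute[of Suc A] G_block_finite[OF assms] G_block_nonempty[OF assms]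
  by (simp add: mono_Suc)

lemma card_pos_blocks_new: "\<kappa> \<in> G n \<Longrightarrow> card (pos_blocks (new_block \<kappa>)) = Suc (card (pos_blocks \<kappa>))"
  unfolding pos_blocks_new
  by (subst card_insert_disjoint) (auto simp: finite_pos_blocks card_image[OF inj_image_Suc])

lemma
  assumes G: "\<kappa> \<in> G n" and ne: "pos_blocks \<kappa> \<noteq> {}"
  shows card_pos_blocks_join_pos: "card (pos_blocks (join_block 1 \<kappa>)) = card (pos_blocks \<kappa>)"
    and card_pos_blocks_join_neg: "Suc (card (pos_blocks (join_block (-1) \<kappa>))) = card (pos_blocks \<kappa>)"
proof -
  have F: "first_block \<kappa> \<in> pos_blocks \<kappa>"
    using first_block_pos[OF G ne] by (simp add: pos_blocks_def)
  show neg: "Suc (card (pos_blocks (join_block (-1) \<kappa>))) = card (pos_blocks \<kappa>)"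
    unfolding pos_blocks_join_neg card_image[OF inj_image_Suc]
    using card_Suc_Diff1[OF finite_pos_blocks[OF G] F] .
  show "card (pos_blocks (join_block 1 \<kappa>)) = card (pos_blocks \<kappa>)"
    unfolding pos_blocks_join_pos neg[symmetric] pos_blocks_join_neg
    by (subst card_insert_disjoint) (auto simp: finite_pos_blocks[OF G])
qed

lemma pos_index_Min_0: "Min A = 0 \<Longrightarrow> pos_index \<kappa> A = 0"
  by (simp add: pos_index_def)

lemma Min_insert_0_Suc: "finite A \<Longrightarrow> Min (insert 0 (Suc ` A)) = 0"
  by (intro Min_eqI) auto

lemma pos_index_new:
  assumes G: "\<kappa> \<in> G n" and B: "(B, 1) \<in> \<kappa>"
  shows "pos_index (new_block \<kappa>) (Suc ` B) = Suc (pos_index \<kappa> B)"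
proof -
  have "{C \<in> pos_blocks (new_block \<kappa>). Min C < Min (Suc ` B)} =
      insert {0} ((`) Suc ` {C \<in> pos_blocks \<kappa>. Min C < Min B})"
    unfolding pos_blocks_new Min_Suc_image[OF G B]
    by (auto simp: pos_blocks_def Min_Suc_image[OF G])
  then have "pos_index (new_block \<kappa>) (Suc ` B) =
      card (insert {0} ((`) Suc ` {C \<in> pos_blocks \<kappa>. Min C < Min B}))"
    by (simp add: pos_index_def)
  also have "\<dots> = Suc (pos_index \<kappa> B)"
    by (subst card_insert_disjoint)
      (auto simp: finite_pos_blocks[OF G] card_image[OF inj_image_Suc] pos_index_def)
  finally show ?thesis .
qed

lemma
  assumes G: "\<kappa> \<in> G n" and ne: "pos_blocks \<kappa> \<noteq> {}"
  shows pos_index_first: "pos_index \<kappa> (first_block \<kappa>) = 0"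
    and pos_index_join_pos: "(B, 1) \<in> \<kappa> \<Longrightarrow> B \<noteq> first_block \<kappa> \<Longrightarrow>
      pos_index (join_block 1 \<kappa>) (Suc ` B) = pos_index \<kappa> B"
    and pos_index_join_neg: "(B, 1) \<in> \<kappa> \<Longrightarrow> B \<noteq> first_block \<kappa> \<Longrightarrow>
      pos_index \<kappa> B = Suc (pos_index (join_block (-1) \<kappa>) (Suc ` B))"
proof -
  let ?F = "first_block \<kappa>"
  note F = first_block_pos[OF G ne] and least = first_block_least[OF G ne]
  have "{B \<in> pos_blocks \<kappa>. Min B < Min ?F} = {}"
    using least by (auto simp: pos_blocks_def not_less)
  then show "pos_index \<kappa> ?F = 0"
    unfolding pos_index_def by (simp only: card.empty)
  assume B: "(B, 1) \<in> \<kappa>" "B \<noteq> ?F"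
  define X where "X = {C \<in> pos_blocks \<kappa> - {?F}. Min C < Min B}"
  have X: "finite X" "?F \<notin> X"
    using finite_pos_blocks[OF G] by (auto simp: X_def)
  have "Min ?F \<noteq> Min B"
    using Min_inj[OF G F B(1)] B(2) by metis
  then have "Min ?F < Min B"
    using least[OF B(1)] by simp
  then have "{C \<in> pos_blocks \<kappa>. Min C < Min B} = insert ?F X"
    using F by (auto simp: X_def pos_blocks_def)
  then have idx: "pos_index \<kappa> B = Suc (card X)"
    using X by (simp add: pos_index_def)
  have shift: "{C \<in> (`) Suc ` (pos_blocks \<kappa> - {?F}). Min C < Min (Suc ` B)} = (`) Suc ` X"
    unfolding Min_Suc_image[OF G B(1)] X_def
    by (auto simp: pos_blocks_def Min_Suc_image[OF G])
  show "pos_index \<kappa> B = Suc (pos_index (join_block (-1) \<kappa>) (Suc ` B))"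
    unfolding idx by (simp add: pos_index_def pos_blocks_join_neg shift card_image[OF inj_image_Suc])
  have "{C \<in> pos_blocks (join_block 1 \<kappa>). Min C < Min (Suc ` B)} =
      insert (insert 0 (Suc ` ?F)) ((`) Suc ` X)"
    unfolding shift[symmetric] pos_blocks_join_pos
    using Min_insert_0_Suc[OF G_block_finite[OF G F]] Min_Suc_image[OF G B(1)]
    by auto
  moreover have "insert 0 (Suc ` ?F) \<notin> (`) Suc ` X"
    by auto
  ultimately show "pos_index (join_block 1 \<kappa>) (Suc ` B) = pos_index \<kappa> B"
    unfolding idx using X by (simp add: pos_index_def card_image[OF inj_image_Suc])
qed

text \<open>
  The arguments \<open>(t\<^sub>1, \<dots>, t\<^sub>n)\<close> at which \<open>contracted\<close> evaluates, for given values of the \<open>+1\<close> blocks (\<open>us\<close>)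
  and of the \<open>-1\<close> blocks (\<open>v\<close>).
\<close>
definition diagonal_args :: "nat \<Rightarrow> (nat set \<times> int) set \<Rightarrow> 'a list \<Rightarrow> (nat set \<Rightarrow> 'a) \<Rightarrow> 'a list" where
  "diagonal_args n \<kappa> us v =
     map (\<lambda>i. if block_of \<kappa> i \<in> pos_blocks \<kappa> then us ! pos_index \<kappa> (block_of \<kappa> i)
              else v (block_of \<kappa> i)) [0..<n]"

definition pos_weight :: "('a \<Rightarrow> real) \<Rightarrow> (nat set \<times> int) set \<Rightarrow> 'a list \<Rightarrow> real" where
  "pos_weight lam \<kappa> us = (\<Prod>B\<in>pos_blocks \<kappa>. lam (us ! pos_index \<kappa> B) ^ (card B - 1))"

definition neg_weight :: "('a \<Rightarrow> real) \<Rightarrow> (nat set \<times> int) set \<Rightarrow> (nat set \<Rightarrow> 'a) \<Rightarrow> real" where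
  "neg_weight lam \<kappa> v = (\<Prod>D\<in>neg_blocks \<kappa>. lam (v D) ^ (card D - 2))"

lemma contracted_eq:
  "contracted \<sigma> lam n \<kappa> f us = (LINT v|PiM (neg_blocks \<kappa>) (\<lambda>_. \<sigma>).
     f (diagonal_args n \<kappa> us v) * pos_weight lam \<kappa> us * neg_weight lam \<kappa> v)"
  by (simp add: contracted_def diagonal_args_def pos_weight_def neg_weight_def)

lemma length_diagonal_args [simp]: "length (diagonal_args n \<kappa> us v) = n"
  by (simp add: diagonal_args_def)

lemma diagonal_args_nth:
  assumes G: "\<kappa> \<in> G n" and A: "(A, m) \<in> \<kappa>" "i \<in> A"
  shows "diagonal_args n \<kappa> us v ! i = (if m = 1 then us ! pos_index \<kappa> A else v A)"
proof -
  have "i < n"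
    using G_block_subset[OF G A(1)] A(2) by auto
  moreover have "A \<in> pos_blocks \<kappa> \<longleftrightarrow> m = 1"
    using G_same_mark[OF G A(1), of 1] A(1) unfolding pos_blocks_def by blast
  ultimately show ?thesis
    by (simp add: diagonal_args_def block_of_eq[OF G A])
qed

lemma neg_block_mark: "D \<in> neg_blocks \<kappa> \<longleftrightarrow> (D, -1) \<in> \<kappa>"
  by (simp add: neg_blocks_def)

lemma diagonal_args_new:
  assumes G: "\<kappa> \<in> G n"
  shows "diagonal_args (Suc n) (new_block \<kappa>) (u # us) v =
    u # diagonal_args n \<kappa> us (\<lambda>D\<in>neg_blocks \<kappa>. v (Suc ` D))"
proof (rule nth_equalityI)
  note G' = new_block_in_G[OF G]
  fix i assume "i < length (diagonal_args (Suc n) (new_block \<kappa>) (u # us) v)"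
  then have i: "i < Suc n" by simp
  show "diagonal_args (Suc n) (new_block \<kappa>) (u # us) v ! i =
    (u # diagonal_args n \<kappa> us (\<lambda>D\<in>neg_blocks \<kappa>. v (Suc ` D))) ! i"
  proof (cases i)
    case 0
    have new: "({0}, 1) \<in> new_block \<kappa>" by (simp add: mem_new_block)
    show ?thesis
      by (simp add: 0 pos_index_Min_0 diagonal_args_nth[OF G' new])
  next
    case (Suc j)
    then obtain A m where A: "(A, m) \<in> \<kappa>" "j \<in> A"
      using G_cover[OF G, of j] i by auto
    have A': "(Suc ` A, m) \<in> new_block \<kappa>" "Suc j \<in> Suc ` A"
      using A by (simp_all add: mem_new_block_Suc)
    show ?thesis
      using pos_index_new[OF G, of A]
        G_mark[OF G A(1)] A(1) by (auto simp: Suc neg_block_mark diagonal_args_nth[OF G' A'] diagonal_args_nth[OF G A])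
  qed
qed simp

lemma diagonal_args_join_pos:
  assumes G: "\<kappa> \<in> G n" and ne: "pos_blocks \<kappa> \<noteq> {}"
  shows "diagonal_args (Suc n) (join_block 1 \<kappa>) (u # us) v =
    u # diagonal_args n \<kappa> (u # us) (\<lambda>D\<in>neg_blocks \<kappa>. v (Suc ` D))"
proof (rule nth_equalityI)
  let ?F = "first_block \<kappa>"
  note F = first_block_pos[OF G ne]
  have G': "join_block 1 \<kappa> \<in> G (Suc n)"
    using join_block_in_G[OF G ne] by simp
  have F': "(insert 0 (Suc ` ?F), 1) \<in> join_block 1 \<kappa>" by (simp add: mem_join_block)
  have idxF: "pos_index (join_block 1 \<kappa>) (insert 0 (Suc ` ?F)) = 0"
    by (rule pos_index_Min_0[OF Min_insert_0_Suc[OF G_block_finite[OF G F]]])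
  fix i assume "i < length (diagonal_args (Suc n) (join_block 1 \<kappa>) (u # us) v)"
  then have i: "i < Suc n" by simp
  show "diagonal_args (Suc n) (join_block 1 \<kappa>) (u # us) v ! i =
    (u # diagonal_args n \<kappa> (u # us) (\<lambda>D\<in>neg_blocks \<kappa>. v (Suc ` D))) ! i"
  proof (cases i)
    case 0
    then show ?thesis
      by (simp add: idxF diagonal_args_nth[OF G' F'])
  next
    case (Suc j)
    then obtain A m where A: "(A, m) \<in> \<kappa>" "j \<in> A"
      using G_cover[OF G, of j] i by auto
    show ?thesis
    proof (cases "A = ?F")
      case True
      then have "m = 1"
        using G_same_mark[OF G A(1)] F by simp
      then show ?thesis
        using A(2) True
        by (simp add: Suc idxF pos_index_first[OF G ne] diagonal_args_nth[OF G' F'] diagonal_args_nth[OF G A])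
    next
      case False
      have A': "(Suc ` A, m) \<in> join_block 1 \<kappa>" "Suc j \<in> Suc ` A"
        using A False by (simp_all add: mem_join_block_Suc)
      show ?thesis
        using pos_index_join_pos[OF G ne, of A]
          G_mark[OF G A(1)] A(1) False by (auto simp: Suc neg_block_mark diagonal_args_nth[OF G' A'] diagonal_args_nth[OF G A])
    qed
  qed
qed simp

lemma diagonal_args_join_neg:
  assumes G: "\<kappa> \<in> G n" and ne: "pos_blocks \<kappa> \<noteq> {}"
  defines "Z \<equiv> insert 0 (Suc ` first_block \<kappa>)"
  shows "diagonal_args (Suc n) (join_block (-1) \<kappa>) us v =
    v Z # diagonal_args n \<kappa> (v Z # us) (\<lambda>D\<in>neg_blocks \<kappa>. v (Suc ` D))"
proof (rule nth_equalityI)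
  let ?F = "first_block \<kappa>"
  note F = first_block_pos[OF G ne]
  have G': "join_block (-1) \<kappa> \<in> G (Suc n)"
    using join_block_in_G[OF G ne] by simp
  have F': "(Z, -1) \<in> join_block (-1) \<kappa>" by (simp add: mem_join_block Z_def)
  fix i assume "i < length (diagonal_args (Suc n) (join_block (-1) \<kappa>) us v)"
  then have i: "i < Suc n" by simp
  show "diagonal_args (Suc n) (join_block (-1) \<kappa>) us v ! i =
    (v Z # diagonal_args n \<kappa> (v Z # us) (\<lambda>D\<in>neg_blocks \<kappa>. v (Suc ` D))) ! i"
  proof (cases i)
    case 0
    then show ?thesis
      by (simp add: diagonal_args_nth[OF G' F'] Z_def)
  next
    case (Suc j)
    then obtain A m where A: "(A, m) \<in> \<kappa>" "j \<in> A"
      using G_cover[OF G, of j] i by auto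
    show ?thesis
    proof (cases "A = ?F")
      case True
      then have "m = 1"
        using G_same_mark[OF G A(1)] F by simp
      then show ?thesis
        using A(2) True
        by (simp add: Suc pos_index_first[OF G ne] Z_def diagonal_args_nth[OF G' F'] diagonal_args_nth[OF G A])
    next
      case False
      have A': "(Suc ` A, m) \<in> join_block (-1) \<kappa>" "Suc j \<in> Suc ` A"
        using A False by (simp_all add: mem_join_block_Suc)
      show ?thesis
        using pos_index_join_neg[OF G ne, of A]
          G_mark[OF G A(1)] A(1) False by (auto simp: Suc neg_block_mark diagonal_args_nth[OF G' A'] diagonal_args_nth[OF G A])
    qed
  qed
qed simp

lemma pos_weight_new:
  assumes G: "\<kappa> \<in> G n"
  shows "pos_weight lam (new_block \<kappa>) (u # us) = pos_weight lam \<kappa> us"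
proof -
  have "pos_weight lam (new_block \<kappa>) (u # us) =
      (\<Prod>B\<in>(`) Suc ` pos_blocks \<kappa>. lam ((u # us) ! pos_index (new_block \<kappa>) B) ^ (card B - 1))"
    unfolding pos_weight_def pos_blocks_new
    by (subst prod.insert) (auto simp: finite_pos_blocks[OF G])
  also have "\<dots> = pos_weight lam \<kappa> us"
    unfolding pos_weight_def prod.reindex[OF inj_image_Suc] o_def
    by (intro prod.cong) (auto simp: card_image pos_blocks_def pos_index_new[OF G])
  finally show ?thesis .
qed

lemma card_insert_0_Suc: "finite A \<Longrightarrow> card (insert 0 (Suc ` A)) = Suc (card A)"
  by (subst card_insert_disjoint) (auto simp: card_image)

lemma pos_weight_split:
  assumes G: "\<kappa> \<in> G n" and ne: "pos_blocks \<kappa> \<noteq> {}"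
  shows "pos_weight lam \<kappa> (u # us) = lam u ^ (card (first_block \<kappa>) - 1) *
    (\<Prod>B\<in>pos_blocks \<kappa> - {first_block \<kappa>}. lam ((u # us) ! pos_index \<kappa> B) ^ (card B - 1))"
proof -
  have "first_block \<kappa> \<in> pos_blocks \<kappa>"
    using first_block_pos[OF G ne] by (simp add: pos_blocks_def)
  then show ?thesis
    unfolding pos_weight_def prod.remove[OF finite_pos_blocks[OF G] \<open>first_block \<kappa> \<in> pos_blocks \<kappa>\<close>]
      pos_index_first[OF G ne] by simp
qed

lemma pos_weight_join_pos:
  assumes G: "\<kappa> \<in> G n" and ne: "pos_blocks \<kappa> \<noteq> {}"
  shows "pos_weight lam (join_block 1 \<kappa>) (u # us) = lam u * pos_weight lam \<kappa> (u # us)"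
proof -
  let ?F = "first_block \<kappa>"
  let ?Z = "insert 0 (Suc ` ?F)"
  note F = first_block_pos[OF G ne]
  have fin: "finite ?F" and pos: "0 < card ?F"
    using G_block_finite[OF G F] G_block_nonempty[OF G F] by (simp_all add: card_gt_0_iff)
  have idx: "pos_index (join_block 1 \<kappa>) ?Z = 0"
    by (rule pos_index_Min_0[OF Min_insert_0_Suc[OF fin]])
  have "?Z \<notin> (`) Suc ` (pos_blocks \<kappa> - {?F})"
    by auto
  then have "pos_weight lam (join_block 1 \<kappa>) (u # us) = lam u ^ (card ?Z - 1) *
     (\<Prod>B\<in>(`) Suc ` (pos_blocks \<kappa> - {?F}). lam ((u # us) ! pos_index (join_block 1 \<kappa>) B) ^ (card B - 1))"
    unfolding pos_weight_def pos_blocks_join_pos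
    using finite_pos_blocks[OF G] by (subst prod.insert) (auto simp: idx)
  also have "(\<Prod>B\<in>(`) Suc ` (pos_blocks \<kappa> - {?F}). lam ((u # us) ! pos_index (join_block 1 \<kappa>) B) ^ (card B - 1))
     = (\<Prod>B\<in>pos_blocks \<kappa> - {?F}. lam ((u # us) ! pos_index \<kappa> B) ^ (card B - 1))"
    unfolding prod.reindex[OF inj_image_Suc] o_def
    by (intro prod.cong) (auto simp: card_image pos_blocks_def pos_index_join_pos[OF G ne])
  also have "lam u ^ (card ?Z - 1) = lam u * lam u ^ (card ?F - 1)"
    using pos unfolding card_insert_0_Suc[OF fin] by (cases "card ?F") auto
  finally show ?thesis
    by (simp add: pos_weight_split[OF G ne] mult.assoc)
qed

lemma neg_weight_shift:
  assumes "neg_blocks \<kappa>' = (`) Suc ` neg_blocks \<kappa>"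
  shows "neg_weight lam \<kappa>' v = neg_weight lam \<kappa> (\<lambda>D\<in>neg_blocks \<kappa>. v (Suc ` D))"
  unfolding neg_weight_def assms prod.reindex[OF inj_image_Suc] o_def
  by (intro prod.cong) (auto simp: card_image)

text \<open>
  The first \<open>+1\<close> block \<open>F\<close> carried \<open>\<lambda>\<close> to the power \<open>|F| - 1\<close>. With one more point and mark \<open>-1\<close> it carries \<open>\<lambda>\<close>
  to the power \<open>(|F| + 1) - 2\<close>, which is the same.
\<close>
lemma weight_join_neg:
  assumes G: "\<kappa> \<in> G n" and ne: "pos_blocks \<kappa> \<noteq> {}"
  defines "Z \<equiv> insert 0 (Suc ` first_block \<kappa>)"
  shows "pos_weight lam (join_block (-1) \<kappa>) us * neg_weight lam (join_block (-1) \<kappa>) v =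
    pos_weight lam \<kappa> (v Z # us) * neg_weight lam \<kappa> (\<lambda>D\<in>neg_blocks \<kappa>. v (Suc ` D))"
proof -
  let ?F = "first_block \<kappa>"
  note F = first_block_pos[OF G ne]
  have fin: "finite ?F"
    using G_block_finite[OF G F] .
  have "pos_weight lam (join_block (-1) \<kappa>) us =
      (\<Prod>B\<in>pos_blocks \<kappa> - {?F}. lam ((v Z # us) ! pos_index \<kappa> B) ^ (card B - 1))"
    unfolding pos_weight_def pos_blocks_join_neg prod.reindex[OF inj_image_Suc] o_def
    by (intro prod.cong) (auto simp: card_image pos_blocks_def pos_index_join_neg[OF G ne])
  moreover have "neg_weight lam (join_block (-1) \<kappa>) v =
      lam (v Z) ^ (card ?F - 1) * neg_weight lam \<kappa> (\<lambda>D\<in>neg_blocks \<kappa>. v (Suc ` D))"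
  proof -
    have "Z \<notin> (`) Suc ` neg_blocks \<kappa>"
      by (auto simp: Z_def)
    then have "neg_weight lam (join_block (-1) \<kappa>) v =
        lam (v Z) ^ (card Z - 2) * (\<Prod>D\<in>(`) Suc ` neg_blocks \<kappa>. lam (v D) ^ (card D - 2))"
      unfolding neg_weight_def neg_blocks_join_neg[OF G ne] Z_def[symmetric]
      using finite_neg_blocks[OF G] by (subst prod.insert) auto
    moreover have "(\<Prod>D\<in>(`) Suc ` neg_blocks \<kappa>. lam (v D) ^ (card D - 2)) =
        neg_weight lam \<kappa> (\<lambda>D\<in>neg_blocks \<kappa>. v (Suc ` D))"
      unfolding neg_weight_def prod.reindex[OF inj_image_Suc] o_def
      by (intro prod.cong) (auto simp: card_image)
    moreover have "card Z - 2 = card ?F - 1"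
      unfolding Z_def card_insert_0_Suc[OF fin] by simp
    ultimately show ?thesis by simp
  qed
  ultimately show ?thesis
    by (simp add: pos_weight_split[OF G ne])
qed

context noise_space
begin

lemma diagonal_args_measurable:
  assumes G: "\<kappa> \<in> G n"
  shows "diagonal_args n \<kappa> us \<in> PiM (neg_blocks \<kappa>) (\<lambda>_. \<sigma>) \<rightarrow>\<^sub>M lists_of n"
proof (rule measurable_into_lists)
  fix i assume i: "i < n"
  obtain A m where A: "(A, m) \<in> \<kappa>" "i \<in> A"
    using G_cover[OF G i] by blast
  show "(\<lambda>v. diagonal_args n \<kappa> us v ! i) \<in> PiM (neg_blocks \<kappa>) (\<lambda>_. \<sigma>) \<rightarrow>\<^sub>M \<sigma>"
    unfolding diagonal_args_nth[OF G A]
    using G_mark[OF G A(1)] A(1) by (auto simp: neg_block_mark intro: measurable_component_singleton)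
qed simp

lemma neg_weight_measurable:
  "neg_weight lam \<kappa> \<in> borel_measurable (PiM (neg_blocks \<kappa>) (\<lambda>_. \<sigma>))"
proof -
  have "(\<lambda>v. \<Prod>D\<in>neg_blocks \<kappa>. lam (v D) ^ (card D - 2)) \<in> borel_measurable (PiM (neg_blocks \<kappa>) (\<lambda>_. \<sigma>))"
    by (intro borel_measurable_prod borel_measurable_power)
      (rule measurable_compose[OF measurable_component_singleton[where M = "\<lambda>_. \<sigma>"] lam_measurable])
  then show ?thesis
    by (simp add: neg_weight_def[abs_def])
qed

lemma integrand_measurable:
  assumes "\<kappa> \<in> G n" "kernel n f"
  shows "(\<lambda>v. f (diagonal_args n \<kappa> us v) * c * neg_weight lam \<kappa> v)
    \<in> borel_measurable (PiM (neg_blocks \<kappa>) (\<lambda>_. \<sigma>))"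
  by (intro borel_measurable_times borel_measurable_const neg_weight_measurable
      measurable_compose[OF diagonal_args_measurable[OF assms(1)] kernel_measurable[OF assms(2)]])

lemma integrand_integrable:
  assumes G: "\<kappa> \<in> G n" and f: "kernel n f"
  shows "integrable (PiM (neg_blocks \<kappa>) (\<lambda>_. \<sigma>))
    (\<lambda>v. f (diagonal_args n \<kappa> us v) * c * neg_weight lam \<kappa> v)"
proof (rule kernelE[OF f])
  fix B assume B: "0 \<le> B"
    and le: "\<And>ts. length ts = n \<Longrightarrow> \<bar>f ts\<bar> \<le> B * of_bool (set ts \<subseteq> K)"
  let ?M = "PiM (neg_blocks \<kappa>) (\<lambda>_. \<sigma>)"
  define C where "C = B * \<bar>c\<bar> * (\<Prod>D\<in>neg_blocks \<kappa>. L ^ (card D - 2))"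
  have C: "0 \<le> C"
    using B L_nonneg by (simp add: C_def prod_nonneg)
  have bd: "\<bar>f (diagonal_args n \<kappa> us v) * c * neg_weight lam \<kappa> v\<bar> \<le> C * indicator (PiE (neg_blocks \<kappa>) (\<lambda>_. K)) v"
    if v: "v \<in> space ?M" for v
  proof (cases "\<forall>D\<in>neg_blocks \<kappa>. v D \<in> K")
    case True
    have "\<bar>neg_weight lam \<kappa> v\<bar> \<le> (\<Prod>D\<in>neg_blocks \<kappa>. L ^ (card D - 2))"
      unfolding neg_weight_def abs_prod
      using True by (intro prod_mono) (auto simp: power_abs intro!: power_mono lam_bounded)
    moreover have "\<bar>f (diagonal_args n \<kappa> us v)\<bar> \<le> B"
      using le[of "diagonal_args n \<kappa> us v"] B
      by (cases "set (diagonal_args n \<kappa> us v) \<subseteq> K") auto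
    ultimately have "\<bar>f (diagonal_args n \<kappa> us v) * c * neg_weight lam \<kappa> v\<bar> \<le> C"
      unfolding C_def abs_mult using B by (intro mult_mono) auto
    moreover have "v \<in> PiE (neg_blocks \<kappa>) (\<lambda>_. K)"
      using v True by (auto simp: space_PiM PiE_def)
    ultimately show ?thesis by simp
  next
    case False
    then obtain D where D: "(D, -1) \<in> \<kappa>" "v D \<notin> K"
      by (auto simp: neg_block_mark)
    obtain i where i: "i \<in> D"
      using G_block_nonempty[OF G D(1)] by blast
    have "i < n"
      using G_block_subset[OF G D(1)] i by auto
    then have "diagonal_args n \<kappa> us v ! i \<in> set (diagonal_args n \<kappa> us v)"
      by (intro nth_mem) simp
    then have "v D \<in> set (diagonal_args n \<kappa> us v)"
      using diagonal_args_nth[OF G D(1) i, of us v] by simp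
    then have "f (diagonal_args n \<kappa> us v) = 0"
      using D(2) by (intro kernel_outside[OF f]) auto
    then show ?thesis using C by simp
  qed
  show ?thesis
  proof (rule integrableI_bounded)
    show "(\<lambda>v. f (diagonal_args n \<kappa> us v) * c * neg_weight lam \<kappa> v) \<in> borel_measurable ?M"
      by (rule integrand_measurable[OF G f])
    have sets: "PiE (neg_blocks \<kappa>) (\<lambda>_. K) \<in> sets ?M"
      by (rule sets_PiM_I_finite) (auto simp: finite_neg_blocks[OF G])
    have "(\<integral>\<^sup>+ v. ennreal (norm (f (diagonal_args n \<kappa> us v) * c * neg_weight lam \<kappa> v)) \<partial>?M)
        \<le> (\<integral>\<^sup>+ v. ennreal C * indicator (PiE (neg_blocks \<kappa>) (\<lambda>_. K)) v \<partial>?M)"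
      using bd C by (intro nn_integral_mono) (auto simp: ennreal_mult[symmetric] ennreal_indicator[symmetric] intro!: ennreal_leI simp del: ennreal_indicator)
    also have "\<dots> = ennreal C * (\<Prod>D\<in>neg_blocks \<kappa>. emeasure \<sigma> K)"
      using sets by (simp add: nn_integral_cmult_indicator emeasure_PiM finite_neg_blocks[OF G])
    also have "\<dots> < \<infinity>"
      using K_finite by (simp add: ennreal_mult_less_top power_less_top_ennreal)
    finally show "(\<integral>\<^sup>+ v. ennreal (norm (f (diagonal_args n \<kappa> us v) * c * neg_weight lam \<kappa> v)) \<partial>?M) < \<infinity>" .
  qed
qed

lemma bij_image_Suc: "bij_betw ((`) Suc) X ((`) Suc ` X)"
  by (simp add: bij_betw_def inj_image_Suc)

lemma contracted_new:
  assumes G: "\<kappa> \<in> G n" and f: "kernel (Suc n) f"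
  shows "contracted \<sigma> lam (Suc n) (new_block \<kappa>) f (u # us) = contracted \<sigma> lam n \<kappa> (\<lambda>ts. f (u # ts)) us"
  unfolding contracted_eq neg_blocks_new diagonal_args_new[OF G] pos_weight_new[OF G]
    neg_weight_shift[OF neg_blocks_new]
  by (rule integral_PiM_bij[OF _ bij_image_Suc integrand_measurable[OF G kernel_Cons[OF f]]])
    (simp add: finite_neg_blocks[OF G])

lemma contracted_join_pos:
  assumes G: "\<kappa> \<in> G n" and ne: "pos_blocks \<kappa> \<noteq> {}" and f: "kernel (Suc n) f"
  shows "contracted \<sigma> lam (Suc n) (join_block 1 \<kappa>) f (u # us) =
    lam u * contracted \<sigma> lam n \<kappa> (\<lambda>ts. f (u # ts)) (u # us)"
proof -
  note neg = neg_blocks_join_pos[OF G ne]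
  have "contracted \<sigma> lam (Suc n) (join_block 1 \<kappa>) f (u # us) =
    (LINT v|PiM (neg_blocks \<kappa>) (\<lambda>_. \<sigma>).
       f (u # diagonal_args n \<kappa> (u # us) v) * (lam u * pos_weight lam \<kappa> (u # us)) * neg_weight lam \<kappa> v)"
    unfolding contracted_eq neg diagonal_args_join_pos[OF G ne] pos_weight_join_pos[OF G ne]
      neg_weight_shift[OF neg]
    by (rule integral_PiM_bij[OF _ bij_image_Suc integrand_measurable[OF G kernel_Cons[OF f]]])
      (simp add: finite_neg_blocks[OF G])
  also have "\<dots> = (LINT v|PiM (neg_blocks \<kappa>) (\<lambda>_. \<sigma>).
       lam u * (f (u # diagonal_args n \<kappa> (u # us) v) * pos_weight lam \<kappa> (u # us) * neg_weight lam \<kappa> v))"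
    by (simp add: algebra_simps)
  finally show ?thesis
    by (simp add: contracted_eq)
qed

text \<open>
  The variable of the first \<open>+1\<close> block, which was free, is now integrated. It is split off the product over
  the \<open>-1\<close> blocks by Fubini.
\<close>
lemma contracted_join_neg:
  assumes G: "\<kappa> \<in> G n" and ne: "pos_blocks \<kappa> \<noteq> {}" and f: "kernel (Suc n) f"
  shows "contracted \<sigma> lam (Suc n) (join_block (-1) \<kappa>) f us =
    (LINT u|\<sigma>. contracted \<sigma> lam n \<kappa> (\<lambda>ts. f (u # ts)) (u # us))"
proof -
  let ?N = "join_block (-1) \<kappa>"
  define Z where "Z = insert 0 (Suc ` first_block \<kappa>)"
  define J where "J = (`) Suc ` neg_blocks \<kappa>"
  define \<Phi> where "\<Phi> u v = f (u # diagonal_args n \<kappa> (u # us) v) * pos_weight lam \<kappa> (u # us) * neg_weight lam \<kappa> v" for u v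
  define \<Psi> where "\<Psi> v = f (diagonal_args (Suc n) ?N us v) * pos_weight lam ?N us * neg_weight lam ?N v" for v
  have G': "?N \<in> G (Suc n)"
    using join_block_in_G[OF G ne] by simp
  have neg: "neg_blocks ?N = insert Z J"
    unfolding Z_def J_def by (rule neg_blocks_join_neg[OF G ne])
  have fin: "finite J" "Z \<notin> J"
    using finite_neg_blocks[OF G] by (auto simp: J_def Z_def)
  interpret J: sigma_finite_measure "PiM J (\<lambda>_. \<sigma>)"
    by (rule sigma_finite[OF fin(1)])
  have \<Psi>_eq: "\<Psi> v = \<Phi> (v Z) (\<lambda>D\<in>neg_blocks \<kappa>. v (Suc ` D))" for v
    unfolding \<Psi>_def \<Phi>_def mult.assoc
    using weight_join_neg[OF G ne, of lam us v] diagonal_args_join_neg[OF G ne, of us v]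
    by (simp add: Z_def)
  have int: "integrable (PiM ({Z} \<union> J) (\<lambda>_. \<sigma>)) \<Psi>"
    using integrand_integrable[OF G' f, of us "pos_weight lam ?N us"]
    by (simp add: neg \<Psi>_def[abs_def])
  have restr: "(\<lambda>D\<in>neg_blocks \<kappa>. (y(Z := u)) (Suc ` D)) = (\<lambda>D\<in>neg_blocks \<kappa>. y (Suc ` D))" for y :: "nat set \<Rightarrow> 'a" and u
    by (rule restrict_ext) (auto simp: Z_def)
  have inner: "(LINT y|PiM J (\<lambda>_. \<sigma>). \<Psi> (y(Z := u))) = contracted \<sigma> lam n \<kappa> (\<lambda>ts. f (u # ts)) (u # us)" for u
  proof -
    have "(LINT y|PiM J (\<lambda>_. \<sigma>). \<Psi> (y(Z := u))) =
        (LINT y|PiM J (\<lambda>_. \<sigma>). \<Phi> u (\<lambda>D\<in>neg_blocks \<kappa>. y (Suc ` D)))"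
      unfolding \<Psi>_eq restr by simp
    also have "\<dots> = (LINT v|PiM (neg_blocks \<kappa>) (\<lambda>_. \<sigma>). \<Phi> u v)"
      unfolding J_def \<Phi>_def
      by (rule integral_PiM_bij[OF _ bij_image_Suc integrand_measurable[OF G kernel_Cons[OF f]]])
        (simp add: finite_neg_blocks[OF G])
    finally show ?thesis
      by (simp add: contracted_eq \<Phi>_def)
  qed
  have "contracted \<sigma> lam (Suc n) ?N f us = (LINT v|PiM ({Z} \<union> J) (\<lambda>_. \<sigma>). \<Psi> v)"
    by (simp add: contracted_eq neg \<Psi>_def)
  also have "\<dots> = (LINT x|PiM {Z} (\<lambda>_. \<sigma>). LINT y|PiM J (\<lambda>_. \<sigma>). \<Psi> (merge {Z} J (x, y)))"
    using fin int by (intro product_integral_fold) auto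
  also have "\<dots> = (LINT x|PiM {Z} (\<lambda>_. \<sigma>). LINT y|PiM J (\<lambda>_. \<sigma>). \<Psi> (y(Z := x Z)))"
  proof (intro Bochner_Integration.integral_cong refl arg_cong[where f = \<Psi>])
    fix x y assume "y \<in> space (PiM J (\<lambda>_. \<sigma>))"
    then have "y \<in> extensional J"
      by (simp add: space_PiM PiE_def)
    then show "merge {Z} J (x, y) = y(Z := x Z)"
      using fin(2) by (auto simp: merge_def extensional_def fun_eq_iff)
  qed
  also have "\<dots> = (LINT u|\<sigma>. LINT y|PiM J (\<lambda>_. \<sigma>). \<Psi> (y(Z := u)))"
  proof (rule product_integral_singleton)
    have "(\<lambda>p. (snd p)(Z := fst p)) \<in> \<sigma> \<Otimes>\<^sub>M PiM J (\<lambda>_. \<sigma>) \<rightarrow>\<^sub>M PiM ({Z} \<union> J) (\<lambda>_. \<sigma>)"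
      using measurable_compose[OF measurable_Pair[OF measurable_snd measurable_fst] measurable_add_dim[of Z J "\<lambda>_. \<sigma>"]]
      by simp
    from measurable_compose[OF this borel_measurable_integrable[OF int]]
    show "(\<lambda>u. LINT y|PiM J (\<lambda>_. \<sigma>). \<Psi> (y(Z := u))) \<in> borel_measurable \<sigma>"
      by (intro J.borel_measurable_lebesgue_integral) (simp add: case_prod_beta)
  qed
  finally show ?thesis
    by (simp add: inner)
qed

lemma contracted_empty: "contracted \<sigma> lam 0 {} f us = f []"
  by (simp add: contracted_def pos_blocks_def neg_blocks_def PiM_empty lebesgue_integral_count_space_finite)

lemma kernel_prefix:
  assumes "kernel (length ts + n) f"
  shows "kernel n (\<lambda>ss. f (ts @ ss))"
  using assms
proof (induction ts arbitrary: f)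
  case (Cons t ts)
  have "kernel (length ts + n) (\<lambda>ss. f (t # ss))"
    using Cons.prems by (intro kernel_Cons) simp
  from Cons.IH[OF this] show ?case by simp
qed simp

lemma take_measurable: "(\<lambda>xs. take k xs) \<in> lists_of (k + m) \<rightarrow>\<^sub>M lists_of k"
proof (rule measurable_into_lists)
  fix i assume "i < k"
  then show "(\<lambda>xs. take k xs ! i) \<in> lists_of (k + m) \<rightarrow>\<^sub>M \<sigma>"
    using nth_measurable[of i "k + m"] by simp
qed auto

lemma drop_measurable: "(\<lambda>xs. drop k xs) \<in> lists_of (k + m) \<rightarrow>\<^sub>M lists_of m"
proof (rule measurable_into_lists)
  fix i assume i: "i < m"
  have "(\<lambda>xs. drop k xs ! i) \<in> lists_of (k + m) \<rightarrow>\<^sub>M \<sigma> \<longleftrightarrow> (\<lambda>xs. xs ! (k + i)) \<in> lists_of (k + m) \<rightarrow>\<^sub>M \<sigma>"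
    by (rule measurable_cong) auto
  then show "(\<lambda>xs. drop k xs ! i) \<in> lists_of (k + m) \<rightarrow>\<^sub>M \<sigma>"
    using nth_measurable[of "k + i" "k + m"] i by simp
qed auto

lemma kernel_diagonal:
  assumes H: "kernel (Suc (Suc (k + p))) H"
  shows "kernel (k + Suc p) (\<lambda>xs. H (take k xs @ xs ! k # drop k xs))"
    and "kernel (k + Suc p) (\<lambda>xs. lam (xs ! k) * H (take k xs @ xs ! k # drop k xs))"
proof -
  obtain B where Hm: "H \<in> borel_measurable (lists_of (k + Suc (Suc p)))" and B: "0 \<le> B"
    and le: "\<And>ts. length ts = Suc (Suc (k + p)) \<Longrightarrow> \<bar>H ts\<bar> \<le> B * of_bool (set ts \<subseteq> K)"
    using H by (auto elim!: kernelE)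
  note take_measurable[of k "Suc p", measurable] drop_measurable[of k "Suc p", measurable]
    nth_measurable[of k "k + Suc p", measurable]
  have m: "(\<lambda>xs. H (take k xs @ xs ! k # drop k xs)) \<in> borel_measurable (lists_of (k + Suc p))"
    by (rule measurable_compose[OF _ Hm], intro append_measurable Cons_measurable take_measurable
        drop_measurable nth_measurable) simp
  have bd: "\<bar>H (take k xs @ xs ! k # drop k xs)\<bar> \<le> B * of_bool (set xs \<subseteq> K)"
    and outside: "\<not> xs ! k \<in> K \<Longrightarrow> H (take k xs @ xs ! k # drop k xs) = 0"
    if "length xs = k + Suc p" for xs
  proof -
    have "xs ! k \<in> set xs"
      using that by simp
    then have "set (take k xs @ xs ! k # drop k xs) = set xs"
      by (auto dest: in_set_takeD in_set_dropD) (metis append_take_drop_id set_append UnE)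
    then show bd: "\<bar>H (take k xs @ xs ! k # drop k xs)\<bar> \<le> B * of_bool (set xs \<subseteq> K)"
      using le[of "take k xs @ xs ! k # drop k xs"] that by simp
    show "\<not> xs ! k \<in> K \<Longrightarrow> H (take k xs @ xs ! k # drop k xs) = 0"
      using bd \<open>xs ! k \<in> set xs\<close> by (cases "set xs \<subseteq> K") auto
  qed
  show "kernel (k + Suc p) (\<lambda>xs. H (take k xs @ xs ! k # drop k xs))"
    by (rule kernelI[OF m B bd])
  show "kernel (k + Suc p) (\<lambda>xs. lam (xs ! k) * H (take k xs @ xs ! k # drop k xs))"
  proof (rule kernelI)
    have "(\<lambda>xs. lam (xs ! k)) \<in> borel_measurable (lists_of (k + Suc p))"
      by (rule measurable_compose[OF nth_measurable lam_measurable]) simp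
    then show "(\<lambda>xs. lam (xs ! k) * H (take k xs @ xs ! k # drop k xs)) \<in> borel_measurable (lists_of (k + Suc p))"
      using m by (rule borel_measurable_times)
    show "0 \<le> L * B"
      using L_nonneg B by simp
    fix xs :: "'a list" assume xs: "length xs = k + Suc p"
    show "\<bar>lam (xs ! k) * H (take k xs @ xs ! k # drop k xs)\<bar> \<le> L * B * of_bool (set xs \<subseteq> K)"
    proof (cases "xs ! k \<in> K")
      case True
      then show ?thesis
        unfolding abs_mult mult.assoc using bd[OF xs] L_nonneg by (intro mult_mono lam_bounded) auto
    qed (use outside[OF xs] L_nonneg B in simp)
  qed
qed

lemma kernel_integral:
  assumes H: "kernel (Suc (Suc (k + p))) H"
  shows "kernel (k + p) (\<lambda>xs. LINT u|\<sigma>. H (take k xs @ u # u # drop k xs))"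
proof -
  obtain B where Hm: "H \<in> borel_measurable (lists_of (k + Suc (Suc p)))" and B: "0 \<le> B"
    and le: "\<And>ts. length ts = Suc (Suc (k + p)) \<Longrightarrow> \<bar>H ts\<bar> \<le> B * of_bool (set ts \<subseteq> K)"
    using H by (auto elim!: kernelE)
  note take_measurable[of k p, measurable] drop_measurable[of k p, measurable]
  show ?thesis
  proof (rule kernelI)
    show "(\<lambda>xs. LINT u|\<sigma>. H (take k xs @ u # u # drop k xs)) \<in> borel_measurable (lists_of (k + p))"
    proof (rule borel_measurable_lebesgue_integral)
      show "(\<lambda>(xs, u). H (take k xs @ u # u # drop k xs)) \<in> borel_measurable (lists_of (k + p) \<Otimes>\<^sub>M \<sigma>)"
        unfolding case_prod_beta by (rule measurable_compose[OF _ Hm]) measurable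
    qed
    show "0 \<le> B * measure \<sigma> K"
      using B by simp
    fix xs :: "'a list" assume xs: "length xs = k + p"
    have set_xs: "set (take k xs) \<union> set (drop k xs) = set xs"
      by (metis append_take_drop_id set_append)
    have bd: "\<bar>H (take k xs @ u # u # drop k xs)\<bar> \<le> B * of_bool (set xs \<subseteq> K) * indicator K u" for u
    proof -
      have "set (take k xs @ u # u # drop k xs) \<subseteq> K \<longleftrightarrow> set xs \<subseteq> K \<and> u \<in> K"
        using set_xs by auto
      then have "of_bool (set (take k xs @ u # u # drop k xs) \<subseteq> K) =
          (of_bool (set xs \<subseteq> K) * indicator K u :: real)"
        by (simp add: indicator_def)
      then show ?thesis
        using le[of "take k xs @ u # u # drop k xs"] xs unfolding mult.assoc by simp
    qed
    have intK: "integrable \<sigma> (indicator K :: 'a \<Rightarrow> real)"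
      using K_finite by simp
    have "\<bar>LINT u|\<sigma>. H (take k xs @ u # u # drop k xs)\<bar>
        \<le> (LINT u|\<sigma>. B * of_bool (set xs \<subseteq> K) * indicator K u)"
    proof (cases "integrable \<sigma> (\<lambda>u. H (take k xs @ u # u # drop k xs))")
      case True
      have "\<bar>LINT u|\<sigma>. H (take k xs @ u # u # drop k xs)\<bar>
          \<le> (LINT u|\<sigma>. \<bar>H (take k xs @ u # u # drop k xs)\<bar>)"
        using integral_norm_bound[of \<sigma> "\<lambda>u. H (take k xs @ u # u # drop k xs)"] by simp
      also have "\<dots> \<le> (LINT u|\<sigma>. B * of_bool (set xs \<subseteq> K) * indicator K u)"
        using True intK bd by (intro integral_mono) auto
      finally show ?thesis .
    qed (use B in \<open>simp add: not_integrable_integral_eq\<close>)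
    then show "\<bar>LINT u|\<sigma>. H (take k xs @ u # u # drop k xs)\<bar> \<le> B * measure \<sigma> K * of_bool (set xs \<subseteq> K)"
      by (simp add: mult_ac)
  qed
qed

text \<open>
  By induction along the construction of \<open>\<kappa>\<close>, each step of which leaves the arguments alone, or fuses two
  neighbouring ones, or fuses them and integrates over their common value. The first \<open>k\<close> arguments
  of \<open>f\<close> are parameters, and joint measurability in them is needed because the step evaluates the contraction with its parameter equal to its first argument.
\<close>
lemma kernel_contracted_prefix:
  assumes "\<kappa> \<in> G n" "kernel (k + n) f"
  shows "kernel (k + card (pos_blocks \<kappa>)) (\<lambda>xs. contracted \<sigma> lam n \<kappa> (\<lambda>ss. f (take k xs @ ss)) (drop k xs))"
  using assms
proof (induction n arbitrary: \<kappa> k f)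
  case 0
  then have \<kappa>: "\<kappa> = {}"
    by (simp add: G_0)
  show ?case
    by (rule kernel_congI[of _ f]) (use 0 in \<open>auto simp: \<kappa> contracted_empty pos_blocks_def\<close>)
next
  case (Suc n)
  note f = Suc.prems(2)
  have fts: "kernel (Suc n) (\<lambda>ss. f (take k xs @ ss))" if "k \<le> length xs" for xs
    using f that by (intro kernel_prefix) (simp add: min_absorb2)
  obtain \<tau> where \<tau>: "\<tau> \<in> G n"
    and cases: "\<kappa> = new_block \<tau> \<or> pos_blocks \<tau> \<noteq> {} \<and> (\<kappa> = join_block 1 \<tau> \<or> \<kappa> = join_block (-1) \<tau>)"
    using G_Suc_cases[OF Suc.prems(1)] by blast
  define p where "p = card (pos_blocks \<tau>)"
  define H where "H xs = contracted \<sigma> lam n \<tau> (\<lambda>ss. f (take (Suc k) xs @ ss)) (drop (Suc k) xs)" for xs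
  have H: "kernel (Suc k + p) H"
    unfolding H_def p_def using f by (intro Suc.IH \<tau>) simp
  have H_eq: "H (take k xs @ u # us) = contracted \<sigma> lam n \<tau> (\<lambda>ss. f (take k xs @ u # ss)) us"
    if "k \<le> length xs" for xs u us
    using that by (simp add: H_def min_absorb2)
  from cases show ?case
  proof (elim disjE conjE)
    assume \<kappa>: "\<kappa> = new_block \<tau>"
    show ?thesis
      unfolding \<kappa> card_pos_blocks_new[OF \<tau>] p_def[symmetric]
    proof (rule kernel_congI)
      show "kernel (k + Suc p) H" using H by simp
      fix xs :: "'a list" assume xs: "length xs = k + Suc p"
      have d: "drop k xs = xs ! k # drop (Suc k) xs"
        using xs by (simp add: Cons_nth_drop_Suc)
      have "H xs = H (take k xs @ xs ! k # drop (Suc k) xs)"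
        using d append_take_drop_id[of k xs] by simp
      also have "\<dots> = contracted \<sigma> lam (Suc n) (new_block \<tau>) (\<lambda>ss. f (take k xs @ ss)) (drop k xs)"
        unfolding d using xs by (simp add: H_eq contracted_new[OF \<tau> fts])
      finally show "H xs = contracted \<sigma> lam (Suc n) (new_block \<tau>) (\<lambda>ss. f (take k xs @ ss)) (drop k xs)" .
    qed
  next
    assume ne: "pos_blocks \<tau> \<noteq> {}" and \<kappa>: "\<kappa> = join_block 1 \<tau>"
    obtain q where q: "p = Suc q"
      using ne finite_pos_blocks[OF \<tau>] by (cases p) (auto simp: p_def)
    show ?thesis
      unfolding \<kappa> card_pos_blocks_join_pos[OF \<tau> ne] p_def[symmetric] q
    proof (rule kernel_congI)
      show "kernel (k + Suc q) (\<lambda>xs. lam (xs ! k) * H (take k xs @ xs ! k # drop k xs))"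
        using H by (intro kernel_diagonal(2)) (simp add: q)
      fix xs :: "'a list" assume xs: "length xs = k + Suc q"
      have d: "drop k xs = xs ! k # drop (Suc k) xs"
        using xs by (simp add: Cons_nth_drop_Suc)
      show "lam (xs ! k) * H (take k xs @ xs ! k # drop k xs) =
          contracted \<sigma> lam (Suc n) (join_block 1 \<tau>) (\<lambda>ss. f (take k xs @ ss)) (drop k xs)"
        unfolding d using xs by (simp add: H_eq contracted_join_pos[OF \<tau> ne fts])
    qed
  next
    assume ne: "pos_blocks \<tau> \<noteq> {}" and \<kappa>: "\<kappa> = join_block (-1) \<tau>"
    obtain q where q: "p = Suc q" "card (pos_blocks \<kappa>) = q"
      using card_pos_blocks_join_neg[OF \<tau> ne] unfolding p_def \<kappa> by simp
    show ?thesis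
      unfolding q(2)
    proof (rule kernel_congI)
      show "kernel (k + q) (\<lambda>xs. LINT u|\<sigma>. H (take k xs @ u # u # drop k xs))"
        using H by (intro kernel_integral) (simp add: q)
      fix xs :: "'a list" assume xs: "length xs = k + q"
      show "(LINT u|\<sigma>. H (take k xs @ u # u # drop k xs)) =
          contracted \<sigma> lam (Suc n) \<kappa> (\<lambda>ss. f (take k xs @ ss)) (drop k xs)"
        unfolding \<kappa> using xs by (simp add: H_eq contracted_join_neg[OF \<tau> ne fts])
    qed
  qed
qed

lemma kernel_contracted:
  assumes "\<kappa> \<in> G n" "kernel n f"
  shows "kernel (card (pos_blocks \<kappa>)) (contracted \<sigma> lam n \<kappa> f)"
  using kernel_contracted_prefix[of \<kappa> n 0 f] assms by simp

end

section \<open>Normal ordering of words\<close>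

text \<open>
  The effect of one more letter on the left of a Wick ordered word over the \<open>+1\<close> blocks of \<open>\<kappa>\<close>. If the
  letter contracts with the first letter of the word, its argument joins the first \<open>+1\<close> block;
  otherwise it is prepended.
\<close>
fun reduce_step :: "letter \<Rightarrow> (nat set \<times> int) set \<times> letter list \<Rightarrow> (nat set \<times> int) set \<times> letter list" where
  "reduce_step Cre (\<kappa>, v) = (new_block \<kappa>, Cre # v)"
| "reduce_step Ann (\<kappa>, Cre # v) = (join_block (-1) \<kappa>, v)"
| "reduce_step Ann (\<kappa>, Num # v) = (join_block 1 \<kappa>, Ann # v)"
| "reduce_step Num (\<kappa>, Cre # v) = (join_block 1 \<kappa>, Cre # v)"
| "reduce_step Num (\<kappa>, Num # v) = (join_block 1 \<kappa>, Num # v)"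
| "reduce_step x (\<kappa>, v) = (new_block \<kappa>, x # v)"

definition reduce :: "letter list \<Rightarrow> (nat set \<times> int) set \<times> letter list" where
  "reduce w = foldr reduce_step w ({}, [])"

lemma wick_words_0: "wick_words 0 = {[]}"
  by (simp add: wick_words_def)

lemma wick_words_Suc:
  "wick_words (Suc p) = (#) Cre ` wick_words p \<union> {replicate (Suc p) Ann, Num # replicate p Ann}"
proof -
  have I: "{1..Suc p} = insert 1 (Suc ` {1..p})"
    by (auto simp: image_iff)
  have A: "{replicate (i - 1) Cre @ replicate (Suc p - i + 1) Ann | i. i \<in> {1..Suc p}} =
      insert (replicate (Suc p) Ann) ((#) Cre ` {replicate (i - 1) Cre @ replicate (p - i + 1) Ann | i. i \<in> {1..p}})"
    (is "?l = insert ?a ?r")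
  proof -
    have "?l = (\<lambda>i. replicate (i - 1) Cre @ replicate (Suc p - i + 1) Ann) ` {1..Suc p}"
      by blast
    also have "\<dots> = insert ?a ((\<lambda>i. replicate i Cre @ replicate (p - i + 1) Ann) ` {1..p})"
      unfolding I by (simp add: image_image del: image_Suc_atLeastAtMost)
    also have "(\<lambda>i. replicate i Cre @ replicate (p - i + 1) Ann) ` {1..p} =
        (\<lambda>i. Cre # (replicate (i - 1) Cre @ replicate (p - i + 1) Ann)) ` {1..p}"
      by (rule image_cong[OF refl]) (auto simp: replicate_Suc[symmetric] simp del: replicate_Suc)
    also have "\<dots> = ?r"
      by blast
    finally show ?thesis .
  qed
  have B: "{replicate (i - 1) Cre @ [Num] @ replicate (Suc p - i) Ann | i. i \<in> {1..Suc p}} =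
      insert (Num # replicate p Ann) ((#) Cre ` {replicate (i - 1) Cre @ [Num] @ replicate (p - i) Ann | i. i \<in> {1..p}})"
    (is "?l = insert ?a ?r")
  proof -
    have "?l = (\<lambda>i. replicate (i - 1) Cre @ [Num] @ replicate (Suc p - i) Ann) ` {1..Suc p}"
      by blast
    also have "\<dots> = insert ?a ((\<lambda>i. replicate i Cre @ [Num] @ replicate (p - i) Ann) ` {1..p})"
      unfolding I by (simp add: image_image del: image_Suc_atLeastAtMost)
    also have "(\<lambda>i. replicate i Cre @ [Num] @ replicate (p - i) Ann) ` {1..p} =
        (\<lambda>i. Cre # (replicate (i - 1) Cre @ [Num] @ replicate (p - i) Ann)) ` {1..p}"
      by (rule image_cong[OF refl]) (auto simp: replicate_Suc[symmetric] simp del: replicate_Suc)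
    also have "\<dots> = ?r"
      by blast
    finally show ?thesis .
  qed
  show ?thesis
    unfolding wick_words_def A B by auto
qed

lemma finite_wick_words: "finite (wick_words p)"
  by (induction p) (simp_all add: wick_words_0 wick_words_Suc)

lemma length_wick_word: "v \<in> wick_words p \<Longrightarrow> length v = p"
  by (induction p arbitrary: v) (auto simp: wick_words_0 wick_words_Suc)

lemma sum_wick_words_Suc:
  fixes Q :: "letter list \<Rightarrow> real"
  shows "(\<Sum>v\<in>wick_words (Suc p). Q v) =
    (\<Sum>v\<in>wick_words p. Q (Cre # v)) + Q (replicate (Suc p) Ann) + Q (Num # replicate p Ann)"
proof -
  have "(\<Sum>v\<in>wick_words (Suc p). Q v) =
      (\<Sum>v\<in>(#) Cre ` wick_words p. Q v) + (\<Sum>v\<in>{replicate (Suc p) Ann, Num # replicate p Ann}. Q v)"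
    unfolding wick_words_Suc by (intro sum.union_disjoint) (auto simp: finite_wick_words)
  then show ?thesis
    by (simp add: sum.reindex)
qed

lemma wick_words_cases:
  assumes "v \<in> wick_words p"
  obtains "p = 0" "v = []"
  | q v' where "p = Suc q" "v = Cre # v'" "v' \<in> wick_words q"
  | q where "p = Suc q" "v = replicate (Suc q) Ann"
  | q where "p = Suc q" "v = Num # replicate q Ann"
  using assms by (cases p) (auto simp: wick_words_0 wick_words_Suc)

lemma reduce_step_wick:
  assumes \<kappa>: "\<kappa> \<in> G n" and v: "v \<in> wick_words (card (pos_blocks \<kappa>))"
    and eq: "reduce_step x (\<kappa>, v) = (\<kappa>', v')"
  shows "\<kappa>' \<in> G (Suc n) \<and> v' \<in> wick_words (card (pos_blocks \<kappa>'))"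
proof -
  have ne: "pos_blocks \<kappa> \<noteq> {}" if "card (pos_blocks \<kappa>) = Suc q" for q
    using that by auto
  note new = new_block_in_G[OF \<kappa>] card_pos_blocks_new[OF \<kappa>]
  note join = join_block_in_G[OF \<kappa> ne] card_pos_blocks_join_pos[OF \<kappa> ne] card_pos_blocks_join_neg[OF \<kappa> ne]
  show ?thesis
    using v
  proof (cases rule: wick_words_cases)
    case 1
    then show ?thesis
      using eq new by (cases x) (auto simp: wick_words_0 wick_words_Suc)
  next
    case (2 q u)
    then show ?thesis
      using eq new join[OF 2(1)] by (cases x) (auto simp: wick_words_Suc)
  next
    case (3 q)
    then show ?thesis
      using eq new by (cases x) (auto simp: wick_words_Suc)
  next
    case (4 q)
    then show ?thesis
      using eq new join[OF 4(1)] by (cases x) (auto simp: wick_words_Suc)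
  qed
qed

lemma reduce_wick:
  assumes "reduce w = (\<kappa>, v)"
  shows "\<kappa> \<in> G (length w) \<and> v \<in> wick_words (card (pos_blocks \<kappa>))"
  using assms
proof (induction w arbitrary: \<kappa> v)
  case Nil
  then show ?case
    by (auto simp: reduce_def G_0 pos_blocks_def wick_words_0)
next
  case (Cons x w)
  obtain \<kappa>' v' where r: "reduce w = (\<kappa>', v')"
    by (cases "reduce w")
  have "reduce_step x (\<kappa>', v') = (\<kappa>, v)"
    using Cons.prems r by (simp add: reduce_def)
  then show ?case
    using reduce_step_wick[of \<kappa>' "length w" v' x \<kappa> v] Cons.IH[OF r] by simp
qed

lemma UNIV_letter: "(UNIV :: letter set) = {Cre, Ann, Num}"
  using letter.exhaust by auto

lemma finite_words: "finite {w :: letter list. length w = n}"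
proof -
  have "finite (UNIV :: letter set)"
    unfolding UNIV_letter by simp
  from finite_lists_length_eq[OF this, of n] show ?thesis
    by simp
qed

lemma sum_words_Suc:
  fixes Q :: "letter list \<Rightarrow> real"
  shows "(\<Sum>w | length w = Suc n. Q w) = (\<Sum>w | length w = n. Q (Cre # w) + Q (Ann # w) + Q (Num # w))"
proof -
  have "{w :: letter list. length w = Suc n} = (\<lambda>(w, x). x # w) ` ({w. length w = n} \<times> UNIV)"
    by (auto simp: length_Suc_conv image_iff)
  then have "(\<Sum>w | length w = Suc n. Q w) = (\<Sum>(w, x)\<in>{w. length w = n} \<times> UNIV. Q (x # w))"
    by (simp add: sum.reindex inj_on_def case_prod_beta)
  also have "\<dots> = (\<Sum>w | length w = n. \<Sum>x\<in>UNIV. Q (x # w))"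
    by (rule sum.cartesian_product[symmetric])
  finally show ?thesis
    by (simp add: UNIV_letter add.assoc)
qed

text \<open>
  The Wick ordered words over the enlarged partitions are each obtained once: over \<open>new_block \<kappa>\<close> they begin with
  the prepended letter; over \<open>join_block 1 \<kappa>\<close> the words that begin with \<open>Cre\<close> or \<open>Num\<close> come from
  contraction with \<open>Num\<close>, and the word in \<open>Ann\<close> alone from \<open>Ann Num\<close>; over \<open>join_block (-1) \<kappa>\<close> all words
  come from \<open>Ann Cre\<close>.
\<close>
lemma sum_reduce_step:
  fixes Q :: "(nat set \<times> int) set \<times> letter list \<Rightarrow> real"
  assumes \<kappa>: "\<kappa> \<in> G n"
  shows "(\<Sum>v\<in>wick_words (card (pos_blocks \<kappa>)).
       Q (reduce_step Cre (\<kappa>, v)) + Q (reduce_step Ann (\<kappa>, v)) + Q (reduce_step Num (\<kappa>, v)))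
    = (\<Sum>v\<in>wick_words (card (pos_blocks (new_block \<kappa>))). Q (new_block \<kappa>, v)) +
      (if pos_blocks \<kappa> \<noteq> {} then
         (\<Sum>v\<in>wick_words (card (pos_blocks (join_block 1 \<kappa>))). Q (join_block 1 \<kappa>, v)) +
         (\<Sum>v\<in>wick_words (card (pos_blocks (join_block (-1) \<kappa>))). Q (join_block (-1) \<kappa>, v))
       else 0)"
proof (cases "card (pos_blocks \<kappa>)")
  case 0
  then have "pos_blocks \<kappa> = {}"
    using finite_pos_blocks[OF \<kappa>] by simp
  then show ?thesis
    using 0 by (simp add: card_pos_blocks_new[OF \<kappa>] wick_words_0 sum_wick_words_Suc)
next
  case (Suc q)
  then have ne: "pos_blocks \<kappa> \<noteq> {}"
    by auto
  have neg: "card (pos_blocks (join_block (-1) \<kappa>)) = q"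
    using card_pos_blocks_join_neg[OF \<kappa> ne] Suc by simp
  show ?thesis
    using ne unfolding card_pos_blocks_new[OF \<kappa>] card_pos_blocks_join_pos[OF \<kappa> ne] neg Suc
    by (simp add: sum_wick_words_Suc sum.distrib)
qed

lemma sum_reduce:
  fixes Q :: "(nat set \<times> int) set \<times> letter list \<Rightarrow> real"
  shows "(\<Sum>w | length w = n. Q (reduce w)) = (\<Sum>\<kappa>\<in>G n. \<Sum>v\<in>wick_words (card (pos_blocks \<kappa>)). Q (\<kappa>, v))"
proof (induction n arbitrary: Q)
  case 0
  show ?case
    by (simp add: reduce_def G_0 pos_blocks_def wick_words_0)
next
  case (Suc n)
  have "(\<Sum>w | length w = Suc n. Q (reduce w)) = (\<Sum>w | length w = n.
      Q (reduce_step Cre (reduce w)) + Q (reduce_step Ann (reduce w)) + Q (reduce_step Num (reduce w)))"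
    by (simp add: sum_words_Suc reduce_def)
  also have "\<dots> = (\<Sum>\<kappa>\<in>G n. \<Sum>v\<in>wick_words (card (pos_blocks \<kappa>)).
      Q (reduce_step Cre (\<kappa>, v)) + Q (reduce_step Ann (\<kappa>, v)) + Q (reduce_step Num (\<kappa>, v)))"
    by (rule Suc.IH[where Q = "\<lambda>p. Q (reduce_step Cre p) + Q (reduce_step Ann p) + Q (reduce_step Num p)"])
  also have "\<dots> = (\<Sum>\<kappa>\<in>G (Suc n). \<Sum>v\<in>wick_words (card (pos_blocks \<kappa>)). Q (\<kappa>, v))"
    unfolding sum_G_Suc by (intro sum.cong refl sum_reduce_step)
  finally show ?case .
qed

context noise_space
begin

text \<open>
  Equates the first two arguments, as \<open>\<delta>(t\<^sub>1, t\<^sub>2)\<close> does.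
\<close>
definition fuse :: "('a list \<Rightarrow> real) \<Rightarrow> 'a list \<Rightarrow> real" where
  "fuse h ts = h (hd ts # ts)"

lemma kernel_fuse:
  assumes "kernel (Suc (Suc p)) h"
  shows "kernel (Suc p) (fuse h)"
proof (rule kernel_congI)
  show "kernel (Suc p) (\<lambda>xs. h (take 0 xs @ xs ! 0 # drop 0 xs))"
    using kernel_diagonal(1)[of 0 p h] assms by simp
  show "h (take 0 ts @ ts ! 0 # drop 0 ts) = fuse h ts" if "length ts = Suc p" for ts
    using that by (cases ts) (simp_all add: fuse_def)
qed

lemma word_op_Ann_Cre:
  assumes h: "kernel (Suc (Suc (length w))) h" and g: "levelwise_measurable g" and ys: "good g ys"
  shows "word_op \<sigma> lam (Ann # Cre # w) h g ys = word_op \<sigma> lam w (\<lambda>ss. LINT t|\<sigma>. h (t # t # ss)) g ys"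
  using word_op_integral[OF kernel_fuse[OF h] g ys] by (simp add: word_op_Cons fuse_def)

lemma word_op_Ann_Num:
  "word_op \<sigma> lam (Ann # Num # w) h g ys = word_op \<sigma> lam (Ann # w) (\<lambda>ts. lam (hd ts) * fuse h ts) g ys"
  by (simp add: word_op_Cons word_op_scale fuse_def)

lemma word_op_Num_Cre:
  "word_op \<sigma> lam (Num # Cre # w) h g ys = word_op \<sigma> lam (Cre # w) (\<lambda>ts. lam (hd ts) * fuse h ts) g ys"
  by (cases ys) (simp_all add: word_op_Cons word_op_scale fuse_def)

lemma word_op_Num_Num:
  "word_op \<sigma> lam (Num # Num # w) h g ys = word_op \<sigma> lam (Num # w) (\<lambda>ts. lam (hd ts) * fuse h ts) g ys"
  by (cases ys) (simp_all add: word_op_Cons word_op_scale fuse_def)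

lemma fuse_contracted_pos:
  assumes "\<kappa> \<in> G n" "pos_blocks \<kappa> \<noteq> {}" "kernel (Suc n) f" "ts \<noteq> []"
  shows "lam (hd ts) * fuse (contracted \<sigma> lam (Suc n) (new_block \<kappa>) f) ts =
    contracted \<sigma> lam (Suc n) (join_block 1 \<kappa>) f ts"
  using assms by (cases ts) (simp_all add: fuse_def contracted_new contracted_join_pos)

text \<open>
  Before any contraction, the new letter acts on the reduced word with its argument as a new
  singleton block.
\<close>
lemma word_op_new:
  assumes \<kappa>: "\<kappa> \<in> G (length w)" and len: "length v = card (pos_blocks \<kappa>)"
    and IH: "\<And>f ys. kernel (length w) f \<Longrightarrow> good g ys \<Longrightarrow>
      word_op \<sigma> lam w f g ys = word_op \<sigma> lam v (contracted \<sigma> lam (length w) \<kappa> f) g ys"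
    and f: "kernel (Suc (length w)) f" and g: "levelwise_measurable g" and ys: "good g ys"
  shows "word_op \<sigma> lam (x # w) f g ys =
    word_op \<sigma> lam (x # v) (contracted \<sigma> lam (Suc (length w)) (new_block \<kappa>) f) g ys"
proof -
  define h where "h = contracted \<sigma> lam (Suc (length w)) (new_block \<kappa>) f"
  have h: "kernel (Suc (length v)) h"
    using kernel_contracted[OF new_block_in_G[OF \<kappa>] f] by (simp add: h_def card_pos_blocks_new[OF \<kappa>] len)
  have h_Cons: "(\<lambda>ss. h (t # ss)) = contracted \<sigma> lam (length w) \<kappa> (\<lambda>ss. f (t # ss))" for t
    by (rule ext) (simp add: h_def contracted_new[OF \<kappa> f])
  have step: "word_op \<sigma> lam w (\<lambda>ss. f (t # ss)) g zs = word_op \<sigma> lam v (\<lambda>ss. h (t # ss)) g zs"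
    if "t \<in> K \<longrightarrow> good g zs" for t zs
  proof (cases "t \<in> K")
    case True
    then show ?thesis
      using that unfolding h_Cons by (intro IH kernel_Cons[OF f]) simp
  qed (simp add: word_op_Cons_outside[OF f] word_op_Cons_outside[OF h])
  have "word_op \<sigma> lam (x # w) f g ys = word_op \<sigma> lam (x # v) h g ys"
  proof (cases x)
    case Cre
    then show ?thesis
      using step good_Cons_tail ys by (cases ys) (simp_all add: word_op_Cons)
  next
    case Num
    then show ?thesis
      using step ys by (cases ys) (simp_all add: word_op_Cons)
  next
    case Ann
    have "(LINT t|\<sigma>. word_op \<sigma> lam w (\<lambda>ss. f (t # ss)) g (t # ys)) =
        (LINT t|\<sigma>. word_op \<sigma> lam v (\<lambda>ss. h (t # ss)) g (t # ys))"
    proof (rule integral_cong_AE)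
      show "AE t in \<sigma>. word_op \<sigma> lam w (\<lambda>ss. f (t # ss)) g (t # ys) = word_op \<sigma> lam v (\<lambda>ss. h (t # ss)) g (t # ys)"
        using AE_good_Cons[OF g ys] by eventually_elim (rule step)
    qed (use f h g in \<open>auto intro: word_op_Cons_measurable kernel_measurable\<close>)
    then show ?thesis
      by (simp add: Ann word_op_Cons)
  qed
  then show ?thesis
    by (simp add: h_def)
qed

text \<open>
  The contraction rules for two neighbouring letters match the recursion of \<open>contracted\<close> for a
  point that joins the first \<open>+1\<close> block.
\<close>
lemma word_op_reduce_step:
  assumes \<kappa>: "\<kappa> \<in> G n" and v: "v \<in> wick_words (card (pos_blocks \<kappa>))"
    and f: "kernel (Suc n) f" and g: "levelwise_measurable g" and ys: "good g ys"
    and eq: "reduce_step x (\<kappa>, v) = (\<kappa>', v')"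
  shows "word_op \<sigma> lam (x # v) (contracted \<sigma> lam (Suc n) (new_block \<kappa>) f) g ys =
    word_op \<sigma> lam v' (contracted \<sigma> lam (Suc n) \<kappa>' f) g ys"
proof -
  define h where "h = contracted \<sigma> lam (Suc n) (new_block \<kappa>) f"
  have h: "kernel (Suc (length v)) h"
    using kernel_contracted[OF new_block_in_G[OF \<kappa>] f]
    by (simp add: h_def card_pos_blocks_new[OF \<kappa>] length_wick_word[OF v])
  have ne: "pos_blocks \<kappa> \<noteq> {}" if "v = y # u" for y u
    using length_wick_word[OF v] that by auto
  have pos: "word_op \<sigma> lam (y # u) (\<lambda>ts. lam (hd ts) * fuse h ts) g ys =
      word_op \<sigma> lam (y # u) (contracted \<sigma> lam (Suc n) (join_block 1 \<kappa>) f) g ys"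
    if "v \<noteq> []" for y u
    unfolding h_def using that ne[of "hd v" "tl v"]
    by (intro word_op_cong fuse_contracted_pos \<kappa> f) auto
  have neg: "word_op \<sigma> lam u (\<lambda>ss. LINT t|\<sigma>. h (t # t # ss)) g ys =
      word_op \<sigma> lam u (contracted \<sigma> lam (Suc n) (join_block (-1) \<kappa>) f) g ys"
    if "v \<noteq> []" for u
    unfolding h_def using that ne[of "hd v" "tl v"]
    by (intro word_op_cong) (simp add: contracted_new[OF \<kappa> f] contracted_join_neg[OF \<kappa> _ f])
  show ?thesis
    unfolding h_def[symmetric]
  proof (cases v rule: list.exhaust)
    case Nil
    then show "word_op \<sigma> lam (x # v) h g ys = word_op \<sigma> lam v' (contracted \<sigma> lam (Suc n) \<kappa>' f) g ys"
      using eq by (cases x) (auto simp: h_def)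
  next
    case (Cons y u)
    show "word_op \<sigma> lam (x # v) h g ys = word_op \<sigma> lam v' (contracted \<sigma> lam (Suc n) \<kappa>' f) g ys"
    proof (cases "x = Cre \<or> y = Ann")
      case True
      then show ?thesis
        using eq by (cases x; cases y) (auto simp: h_def Cons)
    next
      case False
      show ?thesis
      proof (cases "x = Ann \<and> y = Cre")
        case True
        then show ?thesis
          using eq h neg[of u] word_op_Ann_Cre[of u h g ys] g ys by (auto simp: Cons)
      next
        case not_AC: False
        then show ?thesis
          using eq False pos[of Ann u] pos[of Cre u] pos[of Num u]
          by (cases x; cases y) (auto simp: Cons word_op_Ann_Num word_op_Num_Cre word_op_Num_Num)
      qed
    qed
  qed
qed

lemma word_op_reduce:
  assumes "reduce w = (\<kappa>, v)" "kernel (length w) f" "levelwise_measurable g" "good g ys"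
  shows "word_op \<sigma> lam w f g ys = word_op \<sigma> lam v (contracted \<sigma> lam (length w) \<kappa> f) g ys"
  using assms
proof (induction w arbitrary: \<kappa> v f ys)
  case Nil
  then show ?case
    by (simp add: reduce_def word_op_Nil contracted_empty)
next
  case (Cons x w)
  obtain \<kappa>' v' where r: "reduce w = (\<kappa>', v')"
    by (cases "reduce w")
  have \<kappa>': "\<kappa>' \<in> G (length w)" and v': "v' \<in> wick_words (card (pos_blocks \<kappa>'))"
    using reduce_wick[OF r] by simp_all
  have f: "kernel (Suc (length w)) f"
    using Cons.prems(2) by simp
  have "word_op \<sigma> lam (x # w) f g ys =
      word_op \<sigma> lam (x # v') (contracted \<sigma> lam (Suc (length w)) (new_block \<kappa>') f) g ys"
    by (rule word_op_new[OF \<kappa>' length_wick_word[OF v'] _ f Cons.prems(3,4)])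
      (rule Cons.IH[OF r _ Cons.prems(3)])
  also have "\<dots> = word_op \<sigma> lam v (contracted \<sigma> lam (Suc (length w)) \<kappa> f) g ys"
    using Cons.prems(1) r
    by (intro word_op_reduce_step[OF \<kappa>' v' f Cons.prems(3,4)]) (simp add: reduce_def)
  finally show ?case by simp
qed

lemma wick_rule_pointwise:
  assumes f: "kernel n f" and g: "levelwise_measurable g" and ys: "good g ys"
  shows "noise_product \<sigma> lam n f g ys = (\<Sum>\<kappa>\<in>G n. wick_term \<sigma> lam n \<kappa> f g ys)"
proof -
  have "noise_product \<sigma> lam n f g ys = (\<Sum>w | length w = n.
      case reduce w of (\<kappa>, v) \<Rightarrow> word_op \<sigma> lam v (contracted \<sigma> lam n \<kappa> f) g ys)"
    unfolding noise_product_def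
    using word_op_reduce[OF _ _ g ys] f by (intro sum.cong refl) (auto split: prod.split)
  also have "\<dots> = (\<Sum>\<kappa>\<in>G n. \<Sum>v\<in>wick_words (card (pos_blocks \<kappa>)).
      word_op \<sigma> lam v (contracted \<sigma> lam n \<kappa> f) g ys)"
    using sum_reduce[where Q = "\<lambda>(\<kappa>, v). word_op \<sigma> lam v (contracted \<sigma> lam n \<kappa> f) g ys" and n = n] by simp
  finally show ?thesis
    by (simp add: wick_term_def wick_product_def)
qed

lemma wick_rule:
  assumes f: "kernel n f"
  shows "same_fock_operator \<sigma> (noise_product \<sigma> lam n f) (\<lambda>g ys. \<Sum>\<kappa>\<in>G n. wick_term \<sigma> lam n \<kappa> f g ys)"
  unfolding same_fock_operator_def
proof (intro conjI ballI)
  have "fock_op (\<lambda>g ys. \<Sum>w\<in>{w. length w = n}. word_op \<sigma> lam w f g ys)"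
    using f by (intro fock_op_sum finite_words fock_op_word_op) simp
  then show "bounded_fock_operator \<sigma> (noise_product \<sigma> lam n f)"
    by (intro bounded_fock_operatorI) (simp add: noise_product_def[abs_def])
  have "fock_op (\<lambda>g ys. \<Sum>\<kappa>\<in>G n. \<Sum>v\<in>wick_words (card (pos_blocks \<kappa>)).
      word_op \<sigma> lam v (contracted \<sigma> lam n \<kappa> f) g ys)"
    using kernel_contracted[OF _ f]
    by (intro fock_op_sum finite_G finite_wick_words fock_op_word_op) (simp add: length_wick_word)
  then show "bounded_fock_operator \<sigma> (\<lambda>g ys. \<Sum>\<kappa>\<in>G n. wick_term \<sigma> lam n \<kappa> f g ys)"
    by (intro bounded_fock_operatorI) (simp add: wick_term_def wick_product_def[abs_def])
  fix g assume g: "g \<in> fock \<sigma>"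
  then have lm: "levelwise_measurable g"
    by (simp add: mem_fock_iff)
  show "fock_eq \<sigma> (noise_product \<sigma> lam n f g) (\<lambda>ys. \<Sum>\<kappa>\<in>G n. wick_term \<sigma> lam n \<kappa> f g ys)"
    unfolding fock_eq_def
  proof
    fix m
    show "AE y in power_measure \<sigma> m. noise_product \<sigma> lam n f g (tuple m y) =
        (\<Sum>\<kappa>\<in>G n. wick_term \<sigma> lam n \<kappa> f g (tuple m y))"
      using AE_good[OF g, of m] by eventually_elim (rule wick_rule_pointwise[OF f lm])
  qed
qed

end

section \<open>Radon measures and test functions\<close>

text \<open>
  The members of a countable basis that lie inside a compact set have finite measure, and by local
  compactness they cover the space.
\<close>
lemma sigma_finite_radon:
  fixes \<sigma> :: "'a::{second_countable_topology, t2_space} measure"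
  assumes lc: "locally compact (UNIV :: 'a set)" and radon: "radon_measure \<sigma>"
  shows "sigma_finite_measure \<sigma>"
proof
  have sets: "sets \<sigma> = sets borel" and fin: "\<And>C. compact C \<Longrightarrow> emeasure \<sigma> C < \<infinity>"
    using radon by (auto simp: radon_measure_def)
  obtain B :: "'a set set" where B: "countable B" "topological_basis B"
    using ex_countable_basis by blast
  let ?A = "{b \<in> B. emeasure \<sigma> b \<noteq> \<infinity>}"
  have "x \<in> \<Union>?A" for x
  proof -
    obtain u C where u: "openin (top_of_set UNIV) u" "compact C" "x \<in> u" "u \<subseteq> C"
      using locallyE[OF lc, of UNIV x] by auto
    then have "open u" by simp
    then obtain b where b: "b \<in> B" "x \<in> b" "b \<subseteq> u"
      using topological_basisE[OF B(2) _ u(3)] by blast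
    have "C \<in> sets \<sigma>"
      using compact_imp_closed[OF u(2)] by (simp add: sets)
    then have "emeasure \<sigma> b \<le> emeasure \<sigma> C"
      using b(3) u(4) by (intro emeasure_mono) auto
    then have "emeasure \<sigma> b \<noteq> \<infinity>"
      using fin[OF u(2)] by auto
    then show ?thesis
      using b by blast
  qed
  moreover have "?A \<subseteq> sets \<sigma>"
    using topological_basis_open[OF B(2)] by (auto simp: sets)
  moreover have "countable ?A"
    by (rule countable_subset[OF _ B(1)]) auto
  ultimately show "\<exists>A. countable A \<and> A \<subseteq> sets \<sigma> \<and> \<Union>A = space \<sigma> \<and> (\<forall>a\<in>A. emeasure \<sigma> a \<noteq> \<infinity>)"
    using sets_eq_imp_space_eq[OF sets] by (intro exI[of _ ?A]) auto
qed

text \<open>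
  \<open>K\<close> is the union of the coordinate projections of the support.
\<close>
lemma test_function_support:
  fixes f :: "'a::t2_space list \<Rightarrow> real"
  assumes f: "f \<in> test_functions n"
  obtains K B where "compact K" "0 \<le> B"
    "\<And>xs. length xs = n \<Longrightarrow> \<bar>f xs\<bar> \<le> B * of_bool (set xs \<subseteq> K)"
proof -
  define S where "S = {t \<in> topspace (power_top n). f (tuple n t) \<noteq> 0}"
  define C where "C = power_top n closure_of S"
  have cont: "continuous_map (power_top n) euclideanreal (\<lambda>t. f (tuple n t))"
    and C: "compactin (power_top n) C"
    using f by (simp_all add: test_functions_def C_def S_def)
  have SC: "S \<subseteq> C"
    unfolding C_def by (rule closure_of_subset) (auto simp: S_def)
  define K where "K = (\<Union>i<n. (\<lambda>t. t i) ` C)"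
  have "compact ((\<lambda>t. t i) ` C)" if "i < n" for i
  proof -
    have "continuous_map (power_top n) euclidean (\<lambda>t. t i)"
      unfolding power_top_def by (rule continuous_map_product_projection) (use that in simp)
    from image_compactin[OF C this] show ?thesis
      by simp
  qed
  then have K: "compact K"
    unfolding K_def by (intro compact_UN) auto
  have "compact ((\<lambda>t. f (tuple n t)) ` C)"
    using image_compactin[OF C cont] by simp
  then obtain B where B: "\<And>t. t \<in> C \<Longrightarrow> \<bar>f (tuple n t)\<bar> \<le> B"
    using compact_imp_bounded[of "(\<lambda>t. f (tuple n t)) ` C"] unfolding bounded_iff by auto
  have "\<bar>f xs\<bar> \<le> max B 0 * of_bool (set xs \<subseteq> K)" if xs: "length xs = n" for xs
  proof (cases "f xs = 0")
    case False
    define t where "t = (\<lambda>i\<in>{..<n}. xs ! i)"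
    have "tuple n t = xs"
      using xs by (auto simp: tuple_def t_def intro!: nth_equalityI)
    moreover have "t \<in> topspace (power_top n)"
      by (simp add: power_top_def t_def)
    ultimately have "t \<in> C"
      using SC False by (auto simp: S_def)
    have "set xs \<subseteq> K"
    proof
      fix x assume "x \<in> set xs"
      then obtain i where "i < n" "x = xs ! i"
        using xs by (auto simp: in_set_conv_nth)
      then have "i < n" "x = t i"
        by (simp_all add: t_def)
      with \<open>t \<in> C\<close> show "x \<in> K"
        by (auto simp: K_def)
    qed
    then show ?thesis
      using B[OF \<open>t \<in> C\<close>] \<open>tuple n t = xs\<close> by simp
  qed simp
  with K show thesis
    by (intro that[of K "max B 0"]) auto
qed

text \<open>
  On the full product \<open>T\<^sup>\<nat>\<close> of a second countable space the Borel sets are generated by the coordinates, so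
  continuity is used there; only the first \<open>n\<close> coordinates enter.
\<close>
lemma test_function_measurable:
  fixes f :: "'a::second_countable_topology list \<Rightarrow> real"
  assumes f: "f \<in> test_functions n"
  shows "(\<lambda>t. f (tuple n t)) \<in> borel_measurable (PiM UNIV (\<lambda>_::nat. borel))"
proof -
  have cont: "continuous_map (power_top n) euclideanreal (\<lambda>t. f (tuple n t))"
    using f by (simp add: test_functions_def)
  have "continuous_map (product_topology (\<lambda>_::nat. euclidean) UNIV) (power_top n) (\<lambda>t. \<lambda>i\<in>{..<n}. t i :: 'a)"
    unfolding power_top_def
    by (auto simp: continuous_map_componentwise intro: continuous_map_product_projection)
  from continuous_map_compose[OF this cont]
  have "continuous_map (product_topology (\<lambda>_::nat. euclidean) UNIV) euclideanreal
      (\<lambda>t :: nat \<Rightarrow> 'a. f (tuple n (\<lambda>i\<in>{..<n}. t i)))"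
    by (simp add: o_def)
  moreover have "tuple n (\<lambda>i\<in>{..<n}. t i) = tuple n t" for t :: "nat \<Rightarrow> 'a"
    by (simp add: tuple_def)
  ultimately have "continuous_on UNIV (\<lambda>t :: nat \<Rightarrow> 'a. f (tuple n t))"
    by (simp add: euclidean_product_topology)
  then have "(\<lambda>t :: nat \<Rightarrow> 'a. f (tuple n t)) \<in> borel_measurable borel"
    by (rule borel_measurable_continuous_onI)
  then show ?thesis
    by (simp add: measurable_cong_sets[OF sets_PiM_equal_borel refl])
qed

theorem theorem2p3:
  fixes \<sigma> :: "'a::{second_countable_topology, t2_space, perfect_space} measure"
    and lam :: "'a \<Rightarrow> real"
    and n :: nat
    and f :: "'a list \<Rightarrow> real"
  assumes "locally compact (UNIV :: 'a set)"
    and "radon_measure \<sigma>"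
    and "non_atomic \<sigma>"
    and "\<And>U. open U \<Longrightarrow> U \<noteq> {} \<Longrightarrow> 0 < emeasure \<sigma> U"
    and "continuous_on UNIV lam"
    and "f \<in> test_functions n"
  shows "same_fock_operator \<sigma>
           (noise_product \<sigma> lam n f)
           (\<lambda>g ys. \<Sum>\<kappa>\<in>G n. wick_term \<sigma> lam n \<kappa> f g ys)"
proof -
  have sets: "sets \<sigma> = sets borel" and fin: "\<And>C. compact C \<Longrightarrow> emeasure \<sigma> C < \<infinity>"
    using assms(2) by (auto simp: radon_measure_def)
  obtain K B where K: "compact K" and B: "0 \<le> B"
    and bd: "\<And>xs. length xs = n \<Longrightarrow> \<bar>f xs\<bar> \<le> B * of_bool (set xs \<subseteq> K)"
    using test_function_support[OF assms(6)] by blast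
  have "compact (lam ` K)"
    using K assms(5) by (metis compact_continuous_image continuous_on_subset subset_UNIV)
  then obtain L where L: "\<And>x. x \<in> K \<Longrightarrow> \<bar>lam x\<bar> \<le> L"
    using compact_imp_bounded[of "lam ` K"] unfolding bounded_iff by auto
  have lam: "lam \<in> borel_measurable \<sigma>"
    using borel_measurable_continuous_onI[OF assms(5)] by (simp add: measurable_cong_sets[OF sets refl])
  interpret sigma_finite_measure \<sigma>
    by (rule sigma_finite_radon[OF assms(1,2)])
  interpret noise_space \<sigma> lam K "max L 0"
  proof
    show "space \<sigma> = UNIV"
      using sets_eq_imp_space_eq[OF sets] by simp
    show "K \<in> sets \<sigma>"
      using compact_imp_closed[OF K] by (simp add: sets)
    show "emeasure \<sigma> K < \<infinity>"
      by (rule fin[OF K])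
    show "\<bar>lam x\<bar> \<le> max L 0" if "x \<in> K" for x
      using L[OF that] by simp
  qed (use lam in auto)
  have "kernel n f"
  proof (rule kernelI[OF _ B bd])
    define E where "E xs = (\<lambda>i. if i < n then xs ! i else undefined)" for xs :: "'a list"
    have "E \<in> lists_of n \<rightarrow>\<^sub>M PiM UNIV (\<lambda>_::nat. \<sigma>)"
    proof -
      have "(\<lambda>xs. \<lambda>i\<in>UNIV. E xs i) \<in> lists_of n \<rightarrow>\<^sub>M PiM UNIV (\<lambda>_::nat. \<sigma>)"
      proof (rule measurable_restrict)
        fix i
        show "(\<lambda>xs. E xs i) \<in> lists_of n \<rightarrow>\<^sub>M \<sigma>"
          by (cases "i < n") (simp_all add: E_def nth_measurable)
      qed
      moreover have "(\<lambda>xs. \<lambda>i\<in>UNIV. E xs i) = E"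
        by (intro ext) simp
      ultimately show ?thesis by simp
    qed
    moreover have "(\<lambda>t. f (tuple n t)) \<in> borel_measurable (PiM UNIV (\<lambda>_::nat. \<sigma>))"
      using test_function_measurable[OF assms(6)]
      by (simp add: measurable_cong_sets[OF sets_PiM_cong[OF refl sets] refl])
    ultimately have "(\<lambda>xs. f (tuple n (E xs))) \<in> borel_measurable (lists_of n)"
      by (rule measurable_compose)
    also have "?this \<longleftrightarrow> f \<in> borel_measurable (lists_of n)"
    proof (rule measurable_cong)
      fix xs :: "'a list" assume "xs \<in> space (lists_of n)"
      then have "tuple n (E xs) = xs"
        by (auto simp: tuple_def E_def intro!: nth_equalityI)
      then show "f (tuple n (E xs)) = f xs" by simp
    qed
    finally show "f \<in> borel_measurable (lists_of n)" .
  qed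
  then show ?thesis
    by (rule wick_rule)
qed

end
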